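(* There is an absolute constant $C>0$ such that for all real numbers $a<b$, all $R>0$ and all $G\in L^2(\mathbb{R}\times\mathbb{S}^2)$ supported in $[a,b]\times\mathbb{S}^2$, $$\int_{|x|>R}|\mathbf{T}G(x)|^6\,dx\le C\,\frac{(b-a)^2}{R^2}\,\|G\|_{L^2(\mathbb{R}\times\mathbb{S}^2)}^6.$$
   Context: $\mathbb{S}^2$ is the unit sphere in $\mathbb{R}^3$ with surface measure $d\omega$, and $L^2(\mathbb{R}\times\mathbb{S}^2)$ is taken with respect to $ds\,d\omega$. For $G\in L^2(\mathbb{R}\times\mathbb{S}^2)$, $(\mathbf{T}G)(x)=\int_{\mathbb{S}^2}G(x\cdot\omega,\omega)\,d\omega$ for (almost every) $x\in\mathbb{R}^3$; $\mathbf{T}$ is a bounded linear operator from $L^2(\mathbb{R}\times\mathbb{S}^2)$ to $\dot H^1(\mathbb{R}^3)$ and hence to $L^6(\mathbb{R}^3)$. *)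

theory Defs
  imports "HOL-Analysis.Analysis"
begin

text \<open>
  The surface measure of the unit sphere of three-space is the measure occurring in polar
  coordinates: the area of a Borel set \<open>A\<close> is \<open>3\<close> times the volume of the cone
  \<open>{t *\<^sub>R \<omega> | 0 < t < 1, \<omega> \<in> A}\<close>, because a cone of height \<open>1\<close> over \<open>A\<close> has volume
  \<open>\<integral>\<^sub>0\<^sup>1 r\<^sup>2 dr\<close> times the area. Its underlying space is the sphere itself, not all of \<open>real ^ 3\<close>.
\<close>

definition sphere_measure :: "(real ^ 3) measure" where
  "sphere_measure =
     distr (scale_measure 3 (restrict_space lborel (ball 0 1 - {0})))
           (restrict_space borel (sphere 0 1)) sgn"

lemma sgn_measurable_sphere:
  "sgn \<in> measurable (scale_measure 3 (restrict_space lborel (ball 0 1 - {0 :: real ^ 3})))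
                    (restrict_space borel (sphere 0 1))"
proof -
  have m: "(\<lambda>x :: real ^ 3. x /\<^sub>R norm x) \<in> borel_measurable borel"
    by measurable
  have "sgn \<in> measurable (restrict_space lborel (ball 0 1 - {0 :: real ^ 3}))
                         (restrict_space borel (sphere 0 1))"
    using m
    by (intro measurable_restrict_space2 measurable_restrict_space1)
       (auto simp: space_restrict_space norm_sgn sgn_div_norm[abs_def])
  then show ?thesis
    by (simp add: measurable_def space_scale_measure sets_scale_measure)
qed

lemma space_sphere_measure: "space sphere_measure = sphere 0 1"
  by (simp add: sphere_measure_def space_restrict_space)

lemma emeasure_sphere_measure:
  assumes "A \<in> sets borel" "A \<subseteq> sphere 0 1"
  shows "emeasure sphere_measure A = 3 * emeasure lborel {x \<in> ball 0 1 - {0}. sgn x \<in> A}"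
proof -
  have A: "A \<in> sets (restrict_space borel (sphere 0 1))"
    using assms by (auto simp: sets_restrict_space_iff)
  have "emeasure sphere_measure A =
        3 * emeasure (restrict_space lborel (ball 0 1 - {0})) (sgn -` A \<inter> (ball 0 1 - {0}))"
    unfolding sphere_measure_def
    by (subst emeasure_distr[OF sgn_measurable_sphere A])
       (simp add: space_scale_measure space_restrict_space)
  also have "\<dots> = 3 * emeasure lborel (sgn -` A \<inter> (ball 0 1 - {0}))"
    by (subst emeasure_restrict_space) auto
  also have "sgn -` A \<inter> (ball 0 1 - {0}) = {x \<in> ball 0 1 - {0}. sgn x \<in> A}"
    by auto
  finally show ?thesis .
qed

lemma emeasure_sphere_measure_space: "emeasure sphere_measure (sphere 0 1) = ennreal (4 * pi)"
proof -
  have "emeasure sphere_measure (sphere 0 1) = 3 * emeasure lborel (ball 0 1 - {0 :: real ^ 3})"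
  proof -
    have "{x \<in> ball 0 1 - {0}. sgn x \<in> sphere 0 1} = ball 0 1 - {0 :: real ^ 3}"
      by (auto simp: norm_sgn)
    then show ?thesis
      by (subst emeasure_sphere_measure) auto
  qed
  also have "emeasure lborel (ball 0 1 - {0 :: real ^ 3}) = emeasure lborel (ball (0 :: real ^ 3) 1)"
    by (rule emeasure_Diff_null_set) auto
  also have "\<dots> = ennreal (4 / 3 * pi)"
    by (simp add: emeasure_ball unit_ball_vol_3)
  also have "3 * \<dots> = ennreal (3 * (4 / 3 * pi))"
    by (subst ennreal_mult) auto
  finally show ?thesis
    by simp
qed

abbreviation cylinder_measure :: "(real \<times> (real ^ 3)) measure" where
  "cylinder_measure \<equiv> lborel \<Otimes>\<^sub>M sphere_measure"

text \<open>
  Elements of \<open>L\<^sup>2\<close> are represented by functions measurable for the product of the Borel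
  sigma-algebras; every class has such a representative.
\<close>

definition in_L2 :: "(real \<times> (real ^ 3) \<Rightarrow> complex) \<Rightarrow> bool" where
  "in_L2 G \<longleftrightarrow> G \<in> borel_measurable cylinder_measure \<and>
     integrable cylinder_measure (\<lambda>p. (cmod (G p))\<^sup>2)"

definition L2_norm_cyl :: "(real \<times> (real ^ 3) \<Rightarrow> complex) \<Rightarrow> real" where
  "L2_norm_cyl G = sqrt (\<integral>p. (cmod (G p))\<^sup>2 \<partial>cylinder_measure)"

text \<open>The essential support lies in \<open>[a,b] \<times> S\<^sup>2\<close>.\<close>

definition supported_in :: "real \<Rightarrow> real \<Rightarrow> (real \<times> (real ^ 3) \<Rightarrow> complex) \<Rightarrow> bool" where
  "supported_in a b G \<longleftrightarrow> (AE p in cylinder_measure. fst p \<notin> {a..b} \<longrightarrow> G p = 0)"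

text \<open>
  For \<open>G\<close> in \<open>L\<^sup>2\<close> the integral converges absolutely for almost every \<open>x\<close>; on the exceptional
  null set the Bochner integral is \<open>0\<close> by convention.
\<close>

definition T_op :: "(real \<times> (real ^ 3) \<Rightarrow> complex) \<Rightarrow> real ^ 3 \<Rightarrow> complex" where
  "T_op G x = (\<integral>\<omega>. G (x \<bullet> \<omega>, \<omega>) \<partial>sphere_measure)"

end

theory Submission
  imports Defs
begin

text \<open>
  Since \<open>\<bar>T G\<bar> \<le> T \<bar>G\<bar>\<close>, the estimate is one for an integral operator with a positive kernel, and it is
  proved by duality. Let \<open>\<phi>\<close> be a truncation of \<open>\<bar>T G\<bar>\<close> to a bounded function supported in a bounded
  part of \<open>{x. norm x > R}\<close>. Then
  \<open>\<integral> \<phi> ^ 6 \<le> \<integral> \<phi> ^ 5 * T \<bar>G\<bar>\<close>, and the adjoint of \<open>T\<close> sends \<open>\<phi> ^ 5\<close> to its integrals over planes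
  \<open>{x. x \<bullet> \<omega> = s}\<close>. By the inequality of the means it suffices to control the square of these plane
  integrals over \<open>s \<in> {a..b}\<close> and all \<open>\<omega>\<close>. That square is a double integral
  \<open>\<integral>\<integral> \<phi> x ^ 5 * \<phi> y ^ 5 * K x y\<close>, where \<open>K x (x + z)\<close> is \<open>1 / norm z\<close> times the length of the set of
  those \<open>\<omega>\<close> on the great circle orthogonal to \<open>z\<close> that satisfy \<open>x \<bullet> \<omega> \<in> {a..b}\<close> (lemma \<open>dual_kernel\<close>).

  Along this circle \<open>x \<bullet> \<omega> = h * cos \<theta>\<close>, where \<open>h\<close> is the distance of the origin from the line through
  \<open>x\<close> with direction \<open>z\<close>. The set of admissible angles has length at most a constant times
  \<open>(b - a) / sqrt (h * (\<bar>h - b\<bar> + (b - a)))\<close>, plus the same expression with \<open>- a\<close> in place of \<open>b\<close>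
  (lemma \<open>arc_length_bound\<close>). The cube of this function of the direction of \<open>z\<close>, integrated over the
  sphere, is at most a constant times \<open>(b - a)\<^sup>2 / (norm x)\<^sup>2\<close> (lemma \<open>angular_integral\<close>), and this is
  the source of the factor in the theorem: it says that the quasinorm of \<open>K x\<close> in weak \<open>L\<^sup>3\<close>, whose
  cube is up to a constant that integral, is small when \<open>norm x\<close> is large.

  A kernel that is uniformly in weak \<open>L\<^sup>3\<close> maps \<open>L\<^sup>p\<close> with \<open>p = 6 / 5\<close> to \<open>L\<^sup>6\<close>, by the
  Hardy-Littlewood-Sobolev inequality. The version needed here has an elementary proof. By symmetry only
  pairs with \<open>\<phi> y \<le> \<phi> x\<close> need to be considered (lemma \<open>plane_integral_square_le\<close>). For these,
  \<open>\<phi> y ^ 5 * K x y\<close> is bounded by \<open>l * \<phi> x * \<phi> y ^ 6\<close> plus a function of \<open>\<phi> x\<close> and \<open>K x y\<close> alone, for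
  any \<open>l > 0\<close> (lemma \<open>young_split\<close>), and integration in \<open>y\<close> gives \<open>\<phi> x\<close> times a constant (lemma
  \<open>dual_operator_bound\<close>). Another factor \<open>\<phi> x ^ 5\<close> restores the sixth moment of \<open>\<phi>\<close>, which is thus
  estimated by itself and by the norm of \<open>G\<close>; a suitable choice of \<open>l\<close> and of the weight in the inequality
  of the means absorbs it into the left-hand side (lemma \<open>optimize_parameters\<close>).
\<close>

section \<open>Lebesgue integrals in coordinates\<close>

lemma borel_measurable_vec_nth [measurable]: "(\<lambda>x :: real ^ 3. x $ i) \<in> borel_measurable borel"
  by (intro borel_measurable_continuous_onI continuous_intros)

lemma borel_measurable_vector3 [measurable]:
  fixes f g h :: "'a \<Rightarrow> real"
  assumes [measurable]: "f \<in> borel_measurable M" "g \<in> borel_measurable M" "h \<in> borel_measurable M"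
  shows "(\<lambda>p. vector [f p, g p, h p] :: real ^ 3) \<in> borel_measurable M"
proof (rule borel_measurable_euclidean_space[THEN iffD2], intro ballI)
  fix b :: "real ^ 3" assume "b \<in> Basis"
  then obtain i :: 3 where b: "b = axis i 1" by (auto simp: Basis_vec_def)
  have "i = 1 \<or> i = 2 \<or> i = 3" by (metis exhaust_3)
  then show "(\<lambda>p. vector [f p, g p, h p] \<bullet> b) \<in> borel_measurable M"
    by (auto simp: b inner_axis)
qed

lemma Basis_vec3: "(Basis :: (real ^ 3) set) = {axis 1 1, axis 2 1, axis 3 1}"
  by (auto simp: Basis_vec_def) (metis exhaust_3)

lemma vec3_eq_iff: "x = y \<longleftrightarrow> x $ 1 = y $ 1 \<and> x $ 2 = y $ 2 \<and> x $ 3 = y $ 3" for x y :: "real ^ 3"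
  by (simp add: vec_eq_iff forall_3)

lemma vec3_inner: "x \<bullet> y = x $ 1 * y $ 1 + x $ 2 * y $ 2 + x $ 3 * y $ 3" for x y :: "real ^ 3"
  by (simp add: inner_vec_def sum_3)

lemma vec3_norm: "norm x = sqrt ((x $ 1)\<^sup>2 + (x $ 2)\<^sup>2 + (x $ 3)\<^sup>2)" for x :: "real ^ 3"
  by (simp add: norm_eq_sqrt_inner vec3_inner power2_eq_square)

lemma sigma_finite_lborel_pair: "sigma_finite_measure (lborel \<Otimes>\<^sub>M lborel :: (real \<times> real) measure)"
  unfolding lborel_prod ..

lemma lborel_vec3:
  "distr (lborel \<Otimes>\<^sub>M (lborel \<Otimes>\<^sub>M lborel)) borel (\<lambda>(x, y, z). vector [x, y, z]) = (lborel :: (real ^ 3) measure)"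
  (is "distr ?M _ ?v = _")
proof (rule lborel_eqI[symmetric])
  have [measurable]: "?v \<in> borel_measurable ?M" by measurable
  fix l u :: "real ^ 3"
  assume lu: "\<And>b. b \<in> Basis \<Longrightarrow> l \<bullet> b \<le> u \<bullet> b"
  have le: "l $ 1 \<le> u $ 1" "l $ 2 \<le> u $ 2" "l $ 3 \<le> u $ 3"
    using lu[of "axis 1 1"] lu[of "axis 2 1"] lu[of "axis 3 1"] by (auto simp: Basis_vec3 inner_axis)
  have "emeasure (distr ?M borel ?v) (box l u) = emeasure ?M (?v -` box l u \<inter> space ?M)"
    by (rule emeasure_distr) auto
  also have "?v -` box l u \<inter> space ?M =
      {l $ 1 <..< u $ 1} \<times> {l $ 2 <..< u $ 2} \<times> {l $ 3 <..< u $ 3}"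
    by (auto simp: space_pair_measure box_def Basis_vec3 inner_axis)
  also have "emeasure ?M \<dots> = ennreal ((u $ 1 - l $ 1) * ((u $ 2 - l $ 2) * (u $ 3 - l $ 3)))"
    using le by (simp add: sigma_finite_measure.emeasure_pair_measure_Times[OF sigma_finite_lborel_pair] lborel.emeasure_pair_measure_Times ennreal_mult)
  
  also have "(u $ 1 - l $ 1) * ((u $ 2 - l $ 2) * (u $ 3 - l $ 3)) = (\<Prod>b\<in>Basis. (u - l) \<bullet> b)"
    by (simp add: Basis_vec3 inner_axis axis_eq_axis)
  finally show "emeasure (distr ?M borel ?v) (box l u) = (\<Prod>b\<in>Basis. (u - l) \<bullet> b)" .
qed simp

lemma nn_integral_vec3:
  assumes [measurable]: "f \<in> borel_measurable borel"
  shows "(\<integral>\<^sup>+x. f x \<partial>lborel) = (\<integral>\<^sup>+x. \<integral>\<^sup>+y. \<integral>\<^sup>+z. f (vector [x, y, z] :: real ^ 3) \<partial>lborel \<partial>lborel \<partial>lborel)"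
proof -
  have m: "(\<lambda>(x, y, z). vector [x, y, z] :: real ^ 3) \<in> borel_measurable (lborel \<Otimes>\<^sub>M (lborel \<Otimes>\<^sub>M lborel))"
    by measurable
  have "(\<integral>\<^sup>+x. f x \<partial>lborel) = (\<integral>\<^sup>+p. f ((\<lambda>(x, y, z). vector [x, y, z]) p) \<partial>(lborel \<Otimes>\<^sub>M (lborel \<Otimes>\<^sub>M lborel)))"
    by (subst lborel_vec3[symmetric], subst nn_integral_distr[OF m]) auto
  also have "\<dots> = (\<integral>\<^sup>+x. \<integral>\<^sup>+q. f (vector [x, fst q, snd q]) \<partial>(lborel \<Otimes>\<^sub>M lborel) \<partial>lborel)"
    by (subst sigma_finite_measure.nn_integral_fst[OF sigma_finite_lborel_pair, symmetric]) (auto simp: case_prod_beta)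
  also have "\<dots> = (\<integral>\<^sup>+x. \<integral>\<^sup>+y. \<integral>\<^sup>+z. f (vector [x, y, z]) \<partial>lborel \<partial>lborel \<partial>lborel)"
    by (subst lborel.nn_integral_fst[symmetric]) auto
  finally show ?thesis .
qed

lemma distr_lborel_orthogonal:
  fixes Q :: "real ^ 3 \<Rightarrow> real ^ 3"
  assumes Q: "orthogonal_transformation Q"
  shows "distr lborel borel Q = lborel"
proof (rule lborel_eqI[symmetric])
  have lin: "linear Q" using Q by (simp add: orthogonal_transformation_linear)
  have [measurable]: "Q \<in> borel_measurable borel"
    using lin by (intro borel_measurable_continuous_onI linear_continuous_on linear_conv_bounded_linear[THEN iffD1])
  fix l u :: "real ^ 3"
  assume lu: "\<And>b. b \<in> Basis \<Longrightarrow> l \<bullet> b \<le> u \<bullet> b"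
  have "emeasure (distr lborel borel Q) (box l u) = emeasure lborel (Q -` box l u)"
    by (subst emeasure_distr) auto
  also have "Q -` box l u = inv Q ` box l u"
    using orthogonal_transformation_bij[OF Q] by (simp add: bij_vimage_eq_inv_image)
  also have "emeasure lborel (inv Q ` box l u) = emeasure lebesgue (inv Q ` box l u)"
    using measurable_sets[of Q borel borel "box l u"] \<open>Q -` box l u = inv Q ` box l u\<close>
    by (simp add: emeasure_completion)
  also have "\<dots> = measure lebesgue (inv Q ` box l u)"
    using measurable_orthogonal_image[OF orthogonal_transformation_inv[OF Q], of "box l u"]
    by (intro emeasure_eq_measure2 fmeasurableD2) auto
  also have "\<dots> = measure lebesgue (box l u)"
    using measure_orthogonal_image[OF orthogonal_transformation_inv[OF Q], of "box l u"] by simp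
  also have "\<dots> = (\<Prod>b\<in>Basis. (u - l) \<bullet> b)"
    using lu by (simp add: measure_lborel_box_eq)
  finally show "emeasure (distr lborel borel Q) (box l u) = (\<Prod>b\<in>Basis. (u - l) \<bullet> b)" .
qed simp

lemma nn_integral_orthogonal:
  fixes Q :: "real ^ 3 \<Rightarrow> real ^ 3"
  assumes Q: "orthogonal_transformation Q" and [measurable]: "f \<in> borel_measurable borel"
  shows "(\<integral>\<^sup>+x. f (Q x) \<partial>lborel) = (\<integral>\<^sup>+x. f x \<partial>lborel)"
proof -
  have lin: "linear Q" using Q by (simp add: orthogonal_transformation_linear)
  have [measurable]: "Q \<in> borel_measurable borel"
    using lin by (intro borel_measurable_continuous_onI linear_continuous_on linear_conv_bounded_linear[THEN iffD1])
  show ?thesis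
    by (subst (2) distr_lborel_orthogonal[OF Q, symmetric]) (simp add: nn_integral_distr)
qed

lemma nn_integral_translate:
  fixes t :: "'a :: euclidean_space"
  assumes [measurable]: "f \<in> borel_measurable borel"
  shows "(\<integral>\<^sup>+x. f (t + x) \<partial>lborel) = (\<integral>\<^sup>+x. f x \<partial>lborel)"
  by (subst (2) lborel_distr_plus[of t, symmetric]) (simp add: nn_integral_distr)

section \<open>The surface measure of the sphere\<close>

lemma sets_sphere_measure [measurable_cong]: "sets sphere_measure = sets (restrict_space borel (sphere 0 1))"
  by (simp add: sphere_measure_def)

interpretation sphere: finite_measure sphere_measure
  by (rule finite_measureI) (simp add: space_sphere_measure emeasure_sphere_measure_space)

lemma measurable_ident_sphere: "(\<lambda>\<omega>. \<omega>) \<in> measurable sphere_measure borel"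
  by (simp add: measurable_cong_sets[OF sets_sphere_measure refl] measurable_restrict_space1)

lemma borel_measurable_sphere_nth [measurable]: "(\<lambda>\<omega>. \<omega> $ i) \<in> borel_measurable sphere_measure"
  by (rule measurable_compose[OF measurable_ident_sphere borel_measurable_vec_nth])

lemma nn_integral_sphere:
  assumes F: "F \<in> borel_measurable sphere_measure"
  shows "(\<integral>\<^sup>+\<omega>. F \<omega> \<partial>sphere_measure) = 3 * (\<integral>\<^sup>+v. F (sgn v) * indicator (ball 0 1 - {0}) v \<partial>lborel)"
proof -
  have F': "F \<in> borel_measurable (restrict_space borel (sphere 0 1))"
    using F by (simp add: measurable_cong_sets[OF sets_sphere_measure refl])
  have "(\<integral>\<^sup>+\<omega>. F \<omega> \<partial>sphere_measure) = (\<integral>\<^sup>+v. F (sgn v) \<partial>(scale_measure 3 (restrict_space lborel (ball 0 1 - {0 :: real ^ 3}))))"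
    unfolding sphere_measure_def by (rule nn_integral_distr[OF sgn_measurable_sphere]) (use F' in simp)
  also have "\<dots> = 3 * (\<integral>\<^sup>+v. F (sgn v) \<partial>(restrict_space lborel (ball 0 1 - {0 :: real ^ 3})))"
    using measurable_compose[OF sgn_measurable_sphere F'] 
    by (intro nn_integral_scale_measure) (simp add: measurable_def space_scale_measure sets_scale_measure)
  also have "\<dots> = 3 * (\<integral>\<^sup>+v. F (sgn v) * indicator (ball 0 1 - {0}) v \<partial>lborel)"
    by (subst nn_integral_restrict_space) auto
  finally show ?thesis .
qed


lemma sphere_slice: "{x \<in> ball 0 1 - {0}. sgn x \<in> {\<omega> \<in> sphere 0 1. (\<omega> :: real ^ 3) $ 3 = 0}} = {x \<in> ball 0 1 - {0}. x $ 3 = 0}"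
proof -
  have "sgn x $ 3 = 0 \<longleftrightarrow> x $ 3 = 0" if "x \<noteq> 0" for x :: "real ^ 3"
    using that by (simp add: sgn_div_norm)
  then show ?thesis by (auto simp: norm_sgn)
qed

text \<open>
  Planes are written below as graphs over the first two coordinates, which leaves out the normal
  directions in the equatorial plane; these have no area.
\<close>

lemma AE_sphere_third_nonzero: "AE \<omega> in sphere_measure. \<omega> $ 3 \<noteq> 0"
proof (rule AE_I)
  have meas: "{\<omega> \<in> sphere 0 1. \<omega> $ 3 = 0} \<in> sets (borel :: (real ^ 3) measure)"
    by (intro borel_closed closed_Collect_conj closed_Collect_eq)
      (auto simp: intro!: continuous_intros closed_Collect_eq)
  have "{x :: real ^ 3. x $ 3 = 0} \<in> null_sets lborel"
  proof -
    have "negligible {x :: real ^ 3. axis 3 1 \<bullet> x = 0}"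
      by (rule negligible_hyperplane) (simp add: axis_eq_0_iff)
    moreover have "closed {x :: real ^ 3. x $ 3 = 0}"
      by (intro closed_Collect_eq continuous_intros)
    ultimately show ?thesis
      by (simp add: negligible_iff_null_sets null_sets_def inner_axis' emeasure_completion)
  qed
  then have "emeasure lborel ({x \<in> ball 0 1 - {0}. x $ 3 = 0} :: (real ^ 3) set) = 0"
    by (rule null_setsD1[OF null_sets_subset]) auto
  then show "emeasure sphere_measure {\<omega> \<in> sphere 0 1. \<omega> $ 3 = 0} = 0"
    unfolding emeasure_sphere_measure[OF meas Collect_restrict] sphere_slice by simp
  show "{\<omega> \<in> sphere 0 1. \<omega> $ 3 = 0} \<in> sets sphere_measure"
    using meas by (auto simp: sets_sphere_measure sets_restrict_space_iff)
qed (auto simp: space_sphere_measure)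

section \<open>Integration over planes\<close>

lemma borel_measurable_fst_real [measurable]: "fst \<in> borel_measurable (borel :: (real \<times> real) measure)"
  by (intro borel_measurable_continuous_onI continuous_intros)

lemma lborel_measurable_fst_real [measurable]: "fst \<in> borel_measurable (lborel :: (real \<times> real) measure)"
  by simp

lemma lborel_measurable_snd_real [measurable]: "snd \<in> borel_measurable (lborel :: (real \<times> real) measure)"
  by (simp add: borel_measurable_continuous_onI continuous_intros)

lemma borel_measurable_snd_real [measurable]: "snd \<in> borel_measurable (borel :: (real \<times> real) measure)"
  by (intro borel_measurable_continuous_onI continuous_intros)

lemma nn_integral_lborel_pair:
  fixes f :: "real \<times> real \<Rightarrow> ennreal"
  assumes [measurable]: "f \<in> borel_measurable borel"
  shows "(\<integral>\<^sup>+p. f p \<partial>lborel) = (\<integral>\<^sup>+x. \<integral>\<^sup>+y. f (x, y) \<partial>lborel \<partial>lborel)"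
proof -
  have "f \<in> borel_measurable (lborel \<Otimes>\<^sub>M lborel)"
    using assms by (simp add: lborel_prod)
  from lborel.nn_integral_fst[OF this] show ?thesis
    by (simp add: lborel_prod)
qed

lemma nn_integral_vec3_first:
  assumes [measurable]: "f \<in> borel_measurable borel"
  shows "(\<integral>\<^sup>+x. f x \<partial>lborel) = (\<integral>\<^sup>+x. \<integral>\<^sup>+p. f (vector [x, fst p, snd p] :: real ^ 3) \<partial>lborel \<partial>lborel)"
proof -
  have "(\<lambda>p. f (vector [x, fst p, snd p])) \<in> borel_measurable borel" for x by measurable
  then show ?thesis
    by (simp add: nn_integral_vec3[OF assms] nn_integral_lborel_pair)
qed

lemma nn_integral_vec3_last:
  assumes [measurable]: "f \<in> borel_measurable borel"
  shows "(\<integral>\<^sup>+x. f x \<partial>lborel) = (\<integral>\<^sup>+p. \<integral>\<^sup>+z. f (vector [fst p, snd p, z] :: real ^ 3) \<partial>lborel \<partial>lborel)"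
proof -
  have "(\<lambda>p. \<integral>\<^sup>+z. f (vector [fst p, snd p, z]) \<partial>lborel) \<in> borel_measurable borel" by measurable
  then show ?thesis
    by (simp add: nn_integral_vec3[OF assms] nn_integral_lborel_pair)
qed

lemma lborel_Fubini:
  fixes f :: "'a :: euclidean_space \<Rightarrow> 'b :: euclidean_space \<Rightarrow> ennreal"
  assumes "case_prod f \<in> borel_measurable (borel \<Otimes>\<^sub>M borel)"
  shows "(\<integral>\<^sup>+x. \<integral>\<^sup>+y. f x y \<partial>lborel \<partial>lborel) = (\<integral>\<^sup>+y. \<integral>\<^sup>+x. f x y \<partial>lborel \<partial>lborel)"
  using assms by (intro lborel_pair.Fubini'[symmetric]) (simp add: measurable_cong_sets[OF sets_pair_measure_cong[OF sets_lborel sets_lborel]])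

text \<open>
  The integral of \<open>f\<close> against the distribution \<open>\<delta>(n \<bullet> x - s)\<close>: for a unit vector \<open>n\<close> it is the
  integral over the plane \<open>n \<bullet> x = s\<close> with respect to area, and in general the area is divided by
  \<open>norm n\<close>. Describing the plane as a graph reduces every change of variables to an affine
  substitution in a single variable. For \<open>n $ 3 = 0\<close> the value is \<open>0\<close>.
\<close>

definition plane_integral :: "(real ^ 3 \<Rightarrow> ennreal) \<Rightarrow> real \<Rightarrow> real ^ 3 \<Rightarrow> ennreal" where
  "plane_integral f s n = ennreal (1 / \<bar>n $ 3\<bar>) *
     (\<integral>\<^sup>+p. f (vector [fst p, snd p, (s - n $ 1 * fst p - n $ 2 * snd p) / n $ 3]) \<partial>lborel)"

lemma measurable_plane_integral [measurable]:
  assumes [measurable]: "case_prod U \<in> borel_measurable (M \<Otimes>\<^sub>M borel)"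
    "s \<in> borel_measurable M" "n \<in> borel_measurable M"
  shows "(\<lambda>t. plane_integral (U t) (s t) (n t)) \<in> borel_measurable M"
  unfolding plane_integral_def by measurable

text \<open>
  Slicing space by parallel planes. The integrand may depend on the slice because \<open>x \<bullet> n = s\<close> holds
  on all of it.
\<close>

lemma plane_disintegration:
  fixes U :: "real \<Rightarrow> real ^ 3 \<Rightarrow> ennreal"
  assumes n: "n $ 3 \<noteq> 0" and [measurable]: "case_prod U \<in> borel_measurable (borel \<Otimes>\<^sub>M borel)"
  shows "(\<integral>\<^sup>+x. U (x \<bullet> n) x \<partial>lborel) = (\<integral>\<^sup>+s. plane_integral (U s) s n \<partial>lborel)"
proof -
  let ?c = "ennreal (1 / \<bar>n $ 3\<bar>)"
  let ?h = "\<lambda>p s. (s - n $ 1 * fst p - n $ 2 * snd p) / n $ 3"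
  have "(\<integral>\<^sup>+s. plane_integral (U s) s n \<partial>lborel) =
      ?c * (\<integral>\<^sup>+s. \<integral>\<^sup>+p. U s (vector [fst p, snd p, ?h p s]) \<partial>lborel \<partial>lborel)"
    unfolding plane_integral_def by (rule nn_integral_cmult) measurable
  also have "(\<integral>\<^sup>+s. \<integral>\<^sup>+p. U s (vector [fst p, snd p, ?h p s]) \<partial>lborel \<partial>lborel) =
      (\<integral>\<^sup>+p. \<integral>\<^sup>+s. U s (vector [fst p, snd p, ?h p s]) \<partial>lborel \<partial>lborel)"
    by (rule lborel_Fubini) measurable
  also have "\<dots> = (\<integral>\<^sup>+p. ennreal \<bar>n $ 3\<bar> * (\<integral>\<^sup>+z. U (vector [fst p, snd p, z] \<bullet> n) (vector [fst p, snd p, z]) \<partial>lborel) \<partial>lborel)"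
  proof (rule nn_integral_cong)
    fix p :: "real \<times> real"
    show "(\<integral>\<^sup>+s. U s (vector [fst p, snd p, ?h p s]) \<partial>lborel) =
      ennreal \<bar>n $ 3\<bar> * (\<integral>\<^sup>+z. U (vector [fst p, snd p, z] \<bullet> n) (vector [fst p, snd p, z]) \<partial>lborel)"
      using n by (subst nn_integral_real_affine[where c = "n $ 3" and t = "n $ 1 * fst p + n $ 2 * snd p"])
        (auto simp: vec3_inner algebra_simps)
  qed
  also have "\<dots> = ennreal \<bar>n $ 3\<bar> * (\<integral>\<^sup>+p. \<integral>\<^sup>+z. U (vector [fst p, snd p, z] \<bullet> n) (vector [fst p, snd p, z]) \<partial>lborel \<partial>lborel)"
    by (rule nn_integral_cmult) measurable
  also have "(\<integral>\<^sup>+p. \<integral>\<^sup>+z. U (vector [fst p, snd p, z] \<bullet> n) (vector [fst p, snd p, z]) \<partial>lborel \<partial>lborel) =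
     (\<integral>\<^sup>+x. U (x \<bullet> n) x \<partial>lborel)"
    by (rule nn_integral_vec3_last[symmetric]) measurable
  finally show ?thesis
    using n by (simp add: mult.assoc[symmetric] ennreal_mult[symmetric])
qed

lemma plane_integral_translate:
  assumes [measurable]: "f \<in> borel_measurable borel"
  shows "plane_integral f (x \<bullet> n) n = plane_integral (\<lambda>z. f (x + z)) 0 n"
proof (cases "n $ 3 = 0")
  case False
  have [measurable]: "(\<lambda>p. f (vector [fst p, snd p, (x \<bullet> n - n $ 1 * fst p - n $ 2 * snd p) / n $ 3])) \<in> borel_measurable borel"
    by measurable
  have *: "vector [x $ 1 + fst p, x $ 2 + snd p, (x \<bullet> n - n $ 1 * (x $ 1 + fst p) - n $ 2 * (x $ 2 + snd p)) / n $ 3] =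
     x + vector [fst p, snd p, (0 - n $ 1 * fst p - n $ 2 * snd p) / n $ 3]" for p :: "real \<times> real"
    using False by (simp add: vec3_eq_iff vec3_inner field_simps)
  show ?thesis
    unfolding plane_integral_def
    by (subst nn_integral_translate[of _ "(x $ 1, x $ 2)", symmetric]) (simp_all add: * )
qed (simp add: plane_integral_def)

text \<open>
  The distribution \<open>\<delta>(n \<bullet> x - s)\<close> is homogeneous of degree \<open>-1\<close> in \<open>(s, n)\<close>.
\<close>

lemma plane_integral_scale:
  assumes "t > 0"
  shows "plane_integral f (t * s) (t *\<^sub>R n) = ennreal (1 / t) * plane_integral f s n"
proof -
  have *: "(t * s - (t *\<^sub>R n) $ 1 * fst p - (t *\<^sub>R n) $ 2 * snd p) / (t *\<^sub>R n) $ 3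
     = (s - n $ 1 * fst p - n $ 2 * snd p) / n $ 3" for p :: "real \<times> real"
  proof (cases "n $ 3 = 0")
    case False then show ?thesis using assms by (simp add: divide_simps) (simp add: algebra_simps)
  qed simp
  show ?thesis
    unfolding plane_integral_def * using assms
    by (simp add: abs_mult mult.assoc[symmetric] ennreal_mult[symmetric])
qed

lemma plane_integral_cmult:
  assumes [measurable]: "f \<in> borel_measurable borel"
  shows "plane_integral (\<lambda>x. c * f x) s n = c * plane_integral f s n"
proof -
  have [measurable]: "(\<lambda>p. f (vector [fst p, snd p, (s - n $ 1 * fst p - n $ 2 * snd p) / n $ 3])) \<in> borel_measurable borel"
    by measurable
  show ?thesis
    unfolding plane_integral_def by (subst nn_integral_cmult) (auto simp: mult.left_commute)
qed

text \<open>
  Both sides integrate \<open>\<Psi>\<close> against \<open>\<delta>(v \<bullet> z)\<close> over all pairs \<open>(v, z)\<close>. On the left \<open>z $ 3\<close> is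
  eliminated by means of the equation \<open>v \<bullet> z = 0\<close>, on the right \<open>v $ 1\<close> is. The equation is affine in
  each coordinate separately, so that exchanging the roles of \<open>v $ 1\<close> and \<open>z $ 3\<close> is one affine
  substitution under the integral over the four other coordinates.
\<close>

lemma incidence_swap:
  fixes \<Psi> :: "real ^ 3 \<Rightarrow> real ^ 3 \<Rightarrow> ennreal"
  assumes [measurable]: "case_prod \<Psi> \<in> borel_measurable (borel \<Otimes>\<^sub>M borel)"
  shows "(\<integral>\<^sup>+v. plane_integral (\<Psi> v) 0 v \<partial>lborel) =
    (\<integral>\<^sup>+z. ennreal (1 / \<bar>z $ 1\<bar>) *
       (\<integral>\<^sup>+p. \<Psi> (vector [- (z $ 2 * fst p + z $ 3 * snd p) / z $ 1, fst p, snd p]) z \<partial>lborel) \<partial>lborel)"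
proof -
  \<comment> \<open>the two integrands, with \<open>a\<close> for the coordinates 2, 3 of \<open>v\<close> and \<open>c\<close> for the coordinates 1, 2 of \<open>z\<close>\<close>
  define F where "F = (\<lambda>(v1 :: real) (a :: real \<times> real) (c :: real \<times> real). ennreal (1 / \<bar>snd a\<bar>) *
    \<Psi> (vector [v1, fst a, snd a]) (vector [fst c, snd c, (0 - v1 * fst c - fst a * snd c) / snd a]))"
  define G where "G = (\<lambda>(z3 :: real) (a :: real \<times> real) (c :: real \<times> real). ennreal (1 / \<bar>fst c\<bar>) *
    \<Psi> (vector [- (snd c * fst a + z3 * snd a) / fst c, fst a, snd a]) (vector [fst c, snd c, z3]))"
  have [measurable]: "(\<lambda>x. F (f x) (g x) (h x)) \<in> borel_measurable M"
    if [measurable]: "f \<in> borel_measurable M" "g \<in> borel_measurable M" "h \<in> borel_measurable M"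
    for f g h and M :: "'a measure"
    unfolding F_def by measurable
  have [measurable]: "(\<lambda>x. G (f x) (g x) (h x)) \<in> borel_measurable M"
    if [measurable]: "f \<in> borel_measurable M" "g \<in> borel_measurable M" "h \<in> borel_measurable M"
    for f g h and M :: "'a measure"
    unfolding G_def by measurable
  have snd0: "AE a in lborel. snd (a :: real \<times> real) \<noteq> 0"
    unfolding lborel_prod[symmetric]
  proof (rule lborel_pair.AE_pair_measure)
    show "{a \<in> space (lborel \<Otimes>\<^sub>M lborel). snd a \<noteq> 0} \<in> sets (lborel \<Otimes>\<^sub>M (lborel :: real measure))"
      by measurable
  qed (simp add: AE_lborel_singleton)
  have fst0: "AE c in lborel. fst (c :: real \<times> real) \<noteq> 0"
    unfolding lborel_prod[symmetric]
  proof (rule lborel_pair.AE_pair_measure)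
    show "{a \<in> space (lborel \<Otimes>\<^sub>M lborel). fst a \<noteq> 0} \<in> sets (lborel \<Otimes>\<^sub>M (lborel :: real measure))"
      by measurable
    show "AE x in lborel. AE y in (lborel :: real measure). fst (x :: real, y) \<noteq> 0"
      using AE_lborel_singleton[of "0 :: real"] by eventually_elim simp
  qed
  have "(\<integral>\<^sup>+v. plane_integral (\<Psi> v) 0 v \<partial>lborel) = (\<integral>\<^sup>+v1. \<integral>\<^sup>+a. \<integral>\<^sup>+c. F v1 a c \<partial>lborel \<partial>lborel \<partial>lborel)"
  proof (subst nn_integral_vec3_first)
    show "(\<lambda>v. plane_integral (\<Psi> v) 0 v) \<in> borel_measurable borel" by measurable
    show "(\<integral>\<^sup>+v1. \<integral>\<^sup>+a. plane_integral (\<Psi> (vector [v1, fst a, snd a])) 0 (vector [v1, fst a, snd a]) \<partial>lborel \<partial>lborel) =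
      (\<integral>\<^sup>+v1. \<integral>\<^sup>+a. \<integral>\<^sup>+c. F v1 a c \<partial>lborel \<partial>lborel \<partial>lborel)"
      unfolding plane_integral_def F_def by (intro nn_integral_cong, subst nn_integral_cmult) simp_all
  qed
  also have "\<dots> = (\<integral>\<^sup>+a. \<integral>\<^sup>+v1. \<integral>\<^sup>+c. F v1 a c \<partial>lborel \<partial>lborel \<partial>lborel)"
    by (rule lborel_Fubini) measurable
  also have "\<dots> = (\<integral>\<^sup>+a. \<integral>\<^sup>+c. \<integral>\<^sup>+v1. F v1 a c \<partial>lborel \<partial>lborel \<partial>lborel)"
    by (intro nn_integral_cong lborel_Fubini) measurable
  also have "\<dots> = (\<integral>\<^sup>+a. \<integral>\<^sup>+c. \<integral>\<^sup>+z3. G z3 a c \<partial>lborel \<partial>lborel \<partial>lborel)"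
  proof (rule nn_integral_cong_AE, use snd0 in eventually_elim)
    fix a :: "real \<times> real" assume a: "snd a \<noteq> 0"
    show "(\<integral>\<^sup>+c. \<integral>\<^sup>+v1. F v1 a c \<partial>lborel \<partial>lborel) = (\<integral>\<^sup>+c. \<integral>\<^sup>+z3. G z3 a c \<partial>lborel \<partial>lborel)"
    proof (rule nn_integral_cong_AE, use fst0 in eventually_elim)
      fix c :: "real \<times> real" assume c: "fst c \<noteq> 0"
      have m: "(\<lambda>v1. F v1 a c) \<in> borel_measurable borel" by measurable
      have m': "(\<lambda>v1. G v1 a c) \<in> borel_measurable borel" by measurable
      have *: "(0 - (- (snd c * fst a) / fst c + - (snd a / fst c) * z) * fst c - fst a * snd c) / snd a = z" for z
        using a c by (simp add: field_simps)
      have **: "- (snd c * fst a) / fst c + - (snd a / fst c) * z = - (snd c * fst a + z * snd a) / fst c" for z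
        using a c by (simp add: field_simps)
      have "ennreal \<bar>- (snd a / fst c)\<bar> * F (- (snd c * fst a) / fst c + - (snd a / fst c) * z) a c = G z a c" for z
        unfolding F_def G_def * unfolding ** using a c
        by (simp add: mult.assoc[symmetric] ennreal_mult[symmetric])
      then have "(\<integral>\<^sup>+z3. G z3 a c \<partial>lborel) = (\<integral>\<^sup>+z. ennreal \<bar>- (snd a / fst c)\<bar> * F (- (snd c * fst a) / fst c + - (snd a / fst c) * z) a c \<partial>lborel)"
        by simp
      also have "\<dots> = ennreal \<bar>- (snd a / fst c)\<bar> * (\<integral>\<^sup>+z. F (- (snd c * fst a) / fst c + - (snd a / fst c) * z) a c \<partial>lborel)"
        by (rule nn_integral_cmult) measurable
      also have "\<dots> = (\<integral>\<^sup>+v1. F v1 a c \<partial>lborel)"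
        using a c by (intro nn_integral_real_affine[symmetric] m) auto
      finally show "(\<integral>\<^sup>+v1. F v1 a c \<partial>lborel) = (\<integral>\<^sup>+z3. G z3 a c \<partial>lborel)" ..
    qed
  qed
  also have "\<dots> = (\<integral>\<^sup>+c. \<integral>\<^sup>+a. \<integral>\<^sup>+z3. G z3 a c \<partial>lborel \<partial>lborel \<partial>lborel)"
    by (rule lborel_Fubini) measurable
  also have "\<dots> = (\<integral>\<^sup>+c. \<integral>\<^sup>+z3. \<integral>\<^sup>+a. G z3 a c \<partial>lborel \<partial>lborel \<partial>lborel)"
    by (intro nn_integral_cong lborel_Fubini) measurable
  also have "\<dots> = (\<integral>\<^sup>+z. ennreal (1 / \<bar>z $ 1\<bar>) *
       (\<integral>\<^sup>+p. \<Psi> (vector [- (z $ 2 * fst p + z $ 3 * snd p) / z $ 1, fst p, snd p]) z \<partial>lborel) \<partial>lborel)"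
  proof (subst nn_integral_vec3_last)
    show "(\<lambda>z. ennreal (1 / \<bar>z $ 1\<bar>) *
       (\<integral>\<^sup>+p. \<Psi> (vector [- (z $ 2 * fst p + z $ 3 * snd p) / z $ 1, fst p, snd p]) z \<partial>lborel)) \<in> borel_measurable borel"
      by measurable
    show "(\<integral>\<^sup>+c. \<integral>\<^sup>+z3. \<integral>\<^sup>+a. G z3 a c \<partial>lborel \<partial>lborel \<partial>lborel) =
      (\<integral>\<^sup>+c. \<integral>\<^sup>+z. ennreal (1 / \<bar>(vector [fst c, snd c, z] :: real ^ 3) $ 1\<bar>) *
       (\<integral>\<^sup>+p. \<Psi> (vector [- ((vector [fst c, snd c, z] :: real ^ 3) $ 2 * fst p + (vector [fst c, snd c, z] :: real ^ 3) $ 3 * snd p) /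
          (vector [fst c, snd c, z] :: real ^ 3) $ 1, fst p, snd p]) (vector [fst c, snd c, z]) \<partial>lborel) \<partial>lborel \<partial>lborel)"
      unfolding G_def by (intro nn_integral_cong, subst nn_integral_cmult) simp_all
  qed
  finally show ?thesis .
qed

section \<open>Orthonormal coordinates on planes through the origin\<close>

lemma nn_integral_pair_swap:
  fixes f :: "real \<times> real \<Rightarrow> ennreal"
  assumes [measurable]: "f \<in> borel_measurable borel"
  shows "(\<integral>\<^sup>+p. f (snd p, fst p) \<partial>lborel) = (\<integral>\<^sup>+p. f p \<partial>lborel)"
proof -
  have m0: "case_prod (\<lambda>x y. f (x, y)) \<in> borel_measurable (borel \<Otimes>\<^sub>M borel)"
    using assms by (simp add: borel_prod)
  have m: "(\<lambda>p. f (snd p, fst p)) \<in> borel_measurable borel"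
    by (subst borel_prod[symmetric]) measurable
  show ?thesis
    using lborel_Fubini[OF m0] by (simp add: nn_integral_lborel_pair m)
qed

text \<open>
  A nonzero entry \<open>a\<close> is a pivot: eliminating with it leaves one substitution in each variable.
\<close>

lemma nn_integral_linear2_aux:
  fixes f :: "real \<times> real \<Rightarrow> ennreal"
  assumes [measurable]: "f \<in> borel_measurable borel" and a: "a \<noteq> 0" and det: "a * d - b * c \<noteq> 0"
  shows "(\<integral>\<^sup>+p. f p \<partial>lborel) =
    ennreal \<bar>a * d - b * c\<bar> * (\<integral>\<^sup>+p. f (a * fst p + b * snd p, c * fst p + d * snd p) \<partial>lborel)"
proof -
  let ?D = "(a * d - b * c) / a"
  have D: "?D \<noteq> 0" using a det by simp
  have [measurable]: "case_prod (\<lambda>x y. f (x, y)) \<in> borel_measurable (borel \<Otimes>\<^sub>M borel)"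
    using assms by (simp add: borel_prod)
  have m: "(\<lambda>p. f (a * fst p + b * snd p, c * fst p + d * snd p)) \<in> borel_measurable borel"
    by (rule measurable_compose[OF _ assms(1)])
      (intro borel_measurable_continuous_onI continuous_intros)
  have m2: "(\<lambda>(x, q). f (x, c / a * x + ?D * q)) \<in> borel_measurable (borel \<Otimes>\<^sub>M borel)"
    by measurable
  have "(\<integral>\<^sup>+p. f p \<partial>lborel) = (\<integral>\<^sup>+x. \<integral>\<^sup>+y. f (x, y) \<partial>lborel \<partial>lborel)"
    by (simp add: nn_integral_lborel_pair)
  also have "\<dots> = (\<integral>\<^sup>+x. ennreal \<bar>?D\<bar> * (\<integral>\<^sup>+q. f (x, c / a * x + ?D * q) \<partial>lborel) \<partial>lborel)"
    by (intro nn_integral_cong nn_integral_real_affine D) measurable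
  also have "\<dots> = ennreal \<bar>?D\<bar> * (\<integral>\<^sup>+x. \<integral>\<^sup>+q. f (x, c / a * x + ?D * q) \<partial>lborel \<partial>lborel)"
    by (rule nn_integral_cmult) measurable
  also have "(\<integral>\<^sup>+x. \<integral>\<^sup>+q. f (x, c / a * x + ?D * q) \<partial>lborel \<partial>lborel) =
      (\<integral>\<^sup>+q. \<integral>\<^sup>+x. f (x, c / a * x + ?D * q) \<partial>lborel \<partial>lborel)"
    by (rule lborel_Fubini[OF m2])
  also have "\<dots> = (\<integral>\<^sup>+q. ennreal \<bar>a\<bar> * (\<integral>\<^sup>+p. f (b * q + a * p, c / a * (b * q + a * p) + ?D * q) \<partial>lborel) \<partial>lborel)"
    by (intro nn_integral_cong nn_integral_real_affine a) measurable
  also have "\<dots> = ennreal \<bar>a\<bar> * (\<integral>\<^sup>+q. \<integral>\<^sup>+p. f (b * q + a * p, c / a * (b * q + a * p) + ?D * q) \<partial>lborel \<partial>lborel)"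
    by (rule nn_integral_cmult) measurable
  also have "(\<integral>\<^sup>+q. \<integral>\<^sup>+p. f (b * q + a * p, c / a * (b * q + a * p) + ?D * q) \<partial>lborel \<partial>lborel) =
      (\<integral>\<^sup>+q. \<integral>\<^sup>+p. f (a * p + b * q, c * p + d * q) \<partial>lborel \<partial>lborel)"
  proof -
    have "c / a * (b * q + a * p) + ?D * q = c * p + d * q" for p q
      using a by (simp add: field_simps)
    then show ?thesis by (simp add: add.commute)
  qed
  also have "\<dots> = (\<integral>\<^sup>+p. \<integral>\<^sup>+q. f (a * p + b * q, c * p + d * q) \<partial>lborel \<partial>lborel)"
    by (rule lborel_Fubini) measurable
  also have "\<dots> = (\<integral>\<^sup>+p. f (a * fst p + b * snd p, c * fst p + d * snd p) \<partial>lborel)"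
    using nn_integral_lborel_pair[OF m] by simp
  finally have "(\<integral>\<^sup>+p. f p \<partial>lborel) = (ennreal \<bar>?D\<bar> * ennreal \<bar>a\<bar>) *
      (\<integral>\<^sup>+p. f (a * fst p + b * snd p, c * fst p + d * snd p) \<partial>lborel)"
    by (simp add: mult.assoc)
  also have "ennreal \<bar>?D\<bar> * ennreal \<bar>a\<bar> = ennreal \<bar>a * d - b * c\<bar>"
    using a by (simp add: ennreal_mult[symmetric] abs_divide)
  finally show ?thesis .
qed

lemma nn_integral_linear2:
  fixes f :: "real \<times> real \<Rightarrow> ennreal"
  assumes f: "f \<in> borel_measurable borel" and det: "a * d - b * c \<noteq> 0"
  shows "(\<integral>\<^sup>+p. f p \<partial>lborel) =
    ennreal \<bar>a * d - b * c\<bar> * (\<integral>\<^sup>+p. f (a * fst p + b * snd p, c * fst p + d * snd p) \<partial>lborel)"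
proof (cases "a = 0")
  case True
  then have c: "c \<noteq> 0" using det by auto
  have [measurable]: "(\<lambda>p. f (snd p, fst p)) \<in> borel_measurable borel"
    using measurable_compose[OF _ f, of "\<lambda>p. (snd p, fst p)" borel]
    by (simp add: borel_measurable_continuous_onI continuous_intros)
  have "(\<integral>\<^sup>+p. f p \<partial>lborel) = (\<integral>\<^sup>+p. f (snd p, fst p) \<partial>lborel)"
    by (rule nn_integral_pair_swap[OF f, symmetric])
  also have "\<dots> = ennreal \<bar>c * b - d * a\<bar> * (\<integral>\<^sup>+p. f (a * fst p + b * snd p, c * fst p + d * snd p) \<partial>lborel)"
    using nn_integral_linear2_aux[of "\<lambda>p. f (snd p, fst p)" c b d a] det c by (simp add: algebra_simps)
  also have "\<bar>c * b - d * a\<bar> = \<bar>a * d - b * c\<bar>"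
    by (simp add: algebra_simps)
  finally show ?thesis .
qed (rule nn_integral_linear2_aux[OF f _ det])

text \<open>
  The distance of the origin from the line through \<open>x\<close> with direction \<open>z\<close>.
\<close>

definition dist_line :: "real ^ 3 \<Rightarrow> real ^ 3 \<Rightarrow> real" where
  "dist_line x z = sqrt ((norm x)\<^sup>2 - (x \<bullet> z)\<^sup>2 / (norm z)\<^sup>2)"

text \<open>
  With \<open>e\<close> and \<open>cross3 z e\<close> as axes, the linear function \<open>x \<bullet> _\<close> restricted to the unit circle
  orthogonal to \<open>z\<close> becomes \<open>dist_line x z\<close> times the cosine of the angle from \<open>e\<close>. The vector \<open>e\<close>
  is the normalized component of \<open>x\<close> orthogonal to \<open>z\<close>; if that component vanishes, then so does
  the distance, and any direction orthogonal to \<open>z\<close> serves.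
\<close>

lemma orthonormal_frame:
  fixes x z :: "real ^ 3"
  assumes z: "z \<noteq> 0"
  obtains e where "norm e = 1" "z \<bullet> e = 0" "x \<bullet> e = dist_line x z" "x \<bullet> cross3 z e = 0"
proof -
  let ?y = "x - (x \<bullet> z / (norm z)\<^sup>2) *\<^sub>R z"
  have yz: "z \<bullet> ?y = 0"
    using z by (simp add: inner_diff_right inner_commute power2_norm_eq_inner)
  have "(norm (x - c *\<^sub>R z))\<^sup>2 = (norm x)\<^sup>2 - 2 * c * (x \<bullet> z) + c\<^sup>2 * (norm z)\<^sup>2" for c
    unfolding power2_norm_eq_inner
    by (simp add: inner_diff_left inner_diff_right inner_commute power2_eq_square algebra_simps)
  note sq = this[of "x \<bullet> z / (norm z)\<^sup>2"]
  have "2 * (k / m) * k - (k / m)\<^sup>2 * m = k\<^sup>2 / m" if "m \<noteq> 0" for k m :: real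
    using that by (simp add: power2_eq_square field_simps)
  from this[of "(norm z)\<^sup>2" "x \<bullet> z"] sq have ny: "(norm ?y)\<^sup>2 = (norm x)\<^sup>2 - (x \<bullet> z)\<^sup>2 / (norm z)\<^sup>2"
    using z by simp
  then have h: "dist_line x z = norm ?y"
    unfolding dist_line_def by (metis norm_ge_zero real_sqrt_unique)
  show thesis
  proof (cases "?y = 0")
    case True
    obtain u where u: "u \<noteq> 0" "orthogonal z u"
      using orthogonal_to_vector_exists[of z] by (auto simp: DIM_cart)
    have x: "x = (x \<bullet> z / (norm z)\<^sup>2) *\<^sub>R z" using True by simp
    have "z \<bullet> sgn u = 0" using u by (simp add: orthogonal_def sgn_div_norm)
    moreover have "x \<bullet> sgn u = 0" using \<open>z \<bullet> sgn u = 0\<close> by (subst x) simp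
    moreover have "x \<bullet> cross3 z (sgn u) = 0" by (subst x) (simp add: dot_cross_self)
    ultimately show ?thesis
      using u h True by (intro that[of "sgn u"]) (auto simp: norm_sgn)
  next
    case False
    have x: "x = (x \<bullet> z / (norm z)\<^sup>2) *\<^sub>R z + ?y" by simp
    have "z \<bullet> sgn ?y = 0" using yz by (simp add: sgn_div_norm)
    moreover have "x \<bullet> sgn ?y = norm ?y"
    proof -
      have "x \<bullet> ?y = (norm ?y)\<^sup>2"
        unfolding power2_norm_eq_inner[of ?y] inner_diff_left[of x _ ?y] inner_scaleR_left yz by simp
      then show ?thesis using False by (simp add: sgn_div_norm power2_eq_square)
    qed
    moreover have "x \<bullet> cross3 z (sgn ?y) = 0"
    proof -
      have "(\<alpha> *\<^sub>R z + y) \<bullet> cross3 z (\<beta> *\<^sub>R y) = 0" for \<alpha> \<beta> y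
        by (simp add: cross3_simps)
      from this[of "x \<bullet> z / (norm z)\<^sup>2" ?y "inverse (norm ?y)"] show ?thesis
        by (simp add: sgn_div_norm)
    qed
    ultimately show ?thesis
      using False h by (intro that[of "sgn ?y"]) (auto simp: norm_sgn)
  qed
qed

text \<open>
  The graph coordinates on the left are the second and third coordinates of a point of the plane
  orthogonal to \<open>z\<close>. As linear functions of the orthonormal coordinates they have determinant
  \<open>z $ 1 / norm z\<close>.
\<close>

lemma plane_through_origin_frame:
  fixes \<Psi> :: "real ^ 3 \<Rightarrow> ennreal" and z e :: "real ^ 3"
  assumes [measurable]: "\<Psi> \<in> borel_measurable borel"
    and z1: "z $ 1 \<noteq> 0" and e: "norm e = 1" "z \<bullet> e = 0"
  shows "ennreal (1 / \<bar>z $ 1\<bar>) *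
       (\<integral>\<^sup>+p. \<Psi> (vector [- (z $ 2 * fst p + z $ 3 * snd p) / z $ 1, fst p, snd p]) \<partial>lborel) =
     ennreal (1 / norm z) * (\<integral>\<^sup>+p. \<Psi> (fst p *\<^sub>R e + (snd p / norm z) *\<^sub>R cross3 z e) \<partial>lborel)"
proof -
  let ?e' = "cross3 z e"
  have nz: "norm z > 0" using z1 by auto
  have e1: "z $ 1 * e $ 1 = - (z $ 2 * e $ 2 + z $ 3 * e $ 3)"
    using e by (simp add: vec3_inner)
  have "(e $ 1)\<^sup>2 + (e $ 2)\<^sup>2 + (e $ 3)\<^sup>2 = 1"
    using e by (simp add: vec3_norm)
  then have "z $ 1 = z $ 1 * ((e $ 1)\<^sup>2 + (e $ 2)\<^sup>2 + (e $ 3)\<^sup>2)" by simp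
  also have "\<dots> = z $ 1 * ((e $ 2)\<^sup>2 + (e $ 3)\<^sup>2) + (z $ 1 * e $ 1) * e $ 1"
    by (simp add: algebra_simps power2_eq_square)
  also have "\<dots> = e $ 2 * ?e' $ 3 - ?e' $ 2 * e $ 3"
    unfolding e1 by (simp add: cross3_def algebra_simps power2_eq_square)
  finally have "e $ 2 * (?e' $ 3 / norm z) - ?e' $ 2 / norm z * e $ 3 = z $ 1 / norm z"
    by (simp add: diff_divide_distrib)
  note det = this
  have ze': "z \<bullet> ?e' = 0" by (simp add: dot_cross_self)
  have *: "vector [- (z $ 2 * (e $ 2 * p + ?e' $ 2 / norm z * q) + z $ 3 * (e $ 3 * p + ?e' $ 3 / norm z * q)) / z $ 1,
       e $ 2 * p + ?e' $ 2 / norm z * q, e $ 3 * p + ?e' $ 3 / norm z * q] = p *\<^sub>R e + (q / norm z) *\<^sub>R ?e'" (is "?l = ?r") for p q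
  proof -
    have "z \<bullet> ?r = 0" using e ze' by (simp add: inner_add_right)
    then have "z $ 1 * ?r $ 1 = - (z $ 2 * ?r $ 2 + z $ 3 * ?r $ 3)"
      by (simp only: vec3_inner)
    then have "?r $ 1 = - (z $ 2 * ?r $ 2 + z $ 3 * ?r $ 3) / z $ 1"
      using z1 by (metis nonzero_mult_div_cancel_left)
    then show ?thesis
      unfolding vec3_eq_iff by (simp add: mult.commute)
  qed
  have "(\<integral>\<^sup>+p. \<Psi> (vector [- (z $ 2 * fst p + z $ 3 * snd p) / z $ 1, fst p, snd p]) \<partial>lborel) =
    ennreal \<bar>z $ 1 / norm z\<bar> * (\<integral>\<^sup>+p. \<Psi> (fst p *\<^sub>R e + (snd p / norm z) *\<^sub>R ?e') \<partial>lborel)"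
  proof (subst nn_integral_linear2[where a = "e $ 2" and b = "?e' $ 2 / norm z" and c = "e $ 3" and d = "?e' $ 3 / norm z"])
    show "(\<lambda>p. \<Psi> (vector [- (z $ 2 * fst p + z $ 3 * snd p) / z $ 1, fst p, snd p])) \<in> borel_measurable borel"
      by measurable
    show "e $ 2 * (?e' $ 3 / norm z) - ?e' $ 2 / norm z * e $ 3 \<noteq> 0"
      unfolding det using z1 nz by simp
  qed (unfold det, simp only: fst_conv snd_conv *)
  then show ?thesis
    using z1 nz by (simp add: mult.assoc[symmetric] ennreal_mult[symmetric] abs_divide)
qed

section \<open>Arcs of a circle on which a linear function lies in an interval\<close>

text \<open>
  In the variable \<open>w = tan \<theta>\<close> this is the length of the set of angles \<open>\<theta>\<close> with \<open>\<bar>\<theta>\<bar> < pi / 2\<close>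
  and \<open>h * cos \<theta> \<in> {a..b}\<close>. The rational form fits the homogeneous coordinates in which it arises.
\<close>

definition arc_length :: "real \<Rightarrow> real \<Rightarrow> real \<Rightarrow> ennreal" where
  "arc_length a b h = (\<integral>\<^sup>+w. ennreal (1 / (1 + w\<^sup>2)) * indicator {a..b} (h / sqrt (1 + w\<^sup>2)) \<partial>lborel)"

lemma measurable_arc_length [measurable]:
  assumes [measurable]: "h \<in> borel_measurable M"
  shows "(\<lambda>x. arc_length a b (h x)) \<in> borel_measurable M"
  unfolding arc_length_def by measurable

lemma nn_integral_real_split:
  fixes f :: "real \<Rightarrow> ennreal"
  assumes [measurable]: "f \<in> borel_measurable borel"
  shows "(\<integral>\<^sup>+p. f p \<partial>lborel) = (\<integral>\<^sup>+p. (f p + f (- p)) * indicator {0<..} p \<partial>lborel)"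
proof -
  have "(\<integral>\<^sup>+p. f p \<partial>lborel) = (\<integral>\<^sup>+p. f p * indicator {0<..} p + f p * indicator {..<0} p \<partial>lborel)"
  proof (rule nn_integral_cong_AE)
    show "AE p in lborel. f p = f p * indicator {0<..} p + f p * indicator {..<0} p"
      using AE_lborel_singleton[of "0 :: real"] by eventually_elim (auto split: split_indicator)
  qed
  also have "\<dots> = (\<integral>\<^sup>+p. f p * indicator {0<..} p \<partial>lborel) + (\<integral>\<^sup>+p. f p * indicator {..<0} p \<partial>lborel)"
    by (rule nn_integral_add) auto
  also have "(\<integral>\<^sup>+p. f p * indicator {..<0} p \<partial>lborel) = (\<integral>\<^sup>+p. f (- p) * indicator {0<..} p \<partial>lborel)"
    by (subst nn_integral_real_affine[where c = "-1" and t = 0])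
      (auto intro!: nn_integral_cong split: split_indicator)
  also have "(\<integral>\<^sup>+p. f p * indicator {0<..} p \<partial>lborel) + \<dots> = (\<integral>\<^sup>+p. f p * indicator {0<..} p + f (- p) * indicator {0<..} p \<partial>lborel)"
    by (rule nn_integral_add[symmetric]) auto
  finally show ?thesis by (simp add: distrib_right)
qed

lemma nn_integral_square_Ioo:
  assumes "c > 0"
  shows "(\<integral>\<^sup>+p. ennreal (p\<^sup>2) * indicator {0<..<c} p \<partial>lborel) = ennreal (c ^ 3 / 3)"
proof -
  have "(\<integral>\<^sup>+p. ennreal (p\<^sup>2) * indicator {0<..<c} p \<partial>lborel) = (\<integral>\<^sup>+p. ennreal (p\<^sup>2) * indicator {0..c} p \<partial>lborel)"
    using AE_lborel_singleton[of "0 :: real"] AE_lborel_singleton[of c]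
    by (intro nn_integral_cong_AE) (auto split: split_indicator)
  also have "\<dots> = ennreal (c ^ 3 / 3 - 0 ^ 3 / 3)"
    using assms by (intro nn_integral_FTC_Icc) (auto intro!: derivative_eq_intros simp: power2_eq_square)
  finally show ?thesis by simp
qed

lemma sqrt_homogeneous: "sqrt (p\<^sup>2 + (p * w)\<^sup>2) = \<bar>p\<bar> * sqrt (1 + w\<^sup>2)" for p w :: real
proof -
  have "p\<^sup>2 + (p * w)\<^sup>2 = p\<^sup>2 * (1 + w\<^sup>2)" by (simp add: power_mult_distrib algebra_simps)
  then show ?thesis by (simp add: real_sqrt_mult)
qed

text \<open>
  Apart from the factor \<open>sqrt ((fst p)\<^sup>2 + (snd p)\<^sup>2)\<close> the integrand depends on the direction of \<open>p\<close>
  only. In the coordinates \<open>(p, p * w)\<close> the radial integral is that of a square, which accounts for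
  the factor \<open>3\<close>, and the two half-discs \<open>p > 0\<close> and \<open>p < 0\<close> contribute the two arcs.
\<close>

lemma disc_sector_integral:
  fixes a b h :: real
  shows "3 * (\<integral>\<^sup>+p. ennreal (sqrt ((fst p)\<^sup>2 + (snd p)\<^sup>2)) *
      indicator {s. 0 < s \<and> s < 1 \<and> h * fst p / s \<in> {a..b}} (sqrt ((fst p)\<^sup>2 + (snd p)\<^sup>2)) \<partial>lborel)
    = arc_length a b h + arc_length a b (- h)"
proof -
  define \<Phi> where "\<Phi> = (\<lambda>p q. ennreal (sqrt (p\<^sup>2 + q\<^sup>2)) * 
     indicator {s. 0 < s \<and> s < 1 \<and> h * p / s \<in> {a..b}} (sqrt (p\<^sup>2 + q\<^sup>2)))"
  have \<Phi>': "\<Phi> = (\<lambda>p q. ennreal (sqrt (p\<^sup>2 + q\<^sup>2)) * 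
     (indicator {0<..<1} (sqrt (p\<^sup>2 + q\<^sup>2)) * indicator {a..b} (h * p / sqrt (p\<^sup>2 + q\<^sup>2))))"
    unfolding \<Phi>_def by (auto simp: fun_eq_iff split: split_indicator)
  have [measurable]: "(\<lambda>x. \<Phi> (f x) (g x)) \<in> borel_measurable M"
    if [measurable]: "f \<in> borel_measurable M" "g \<in> borel_measurable M" for f g and M :: "'a measure"
    unfolding \<Phi>' by measurable
  define S where "S = (\<lambda>w :: real. sqrt (1 + w\<^sup>2))"
  have Sw: "sqrt (1 + w\<^sup>2) = S w" for w by (simp add: S_def)
  have S: "S w > 0" "S w \<noteq> 0" "S w ^ 2 = 1 + w\<^sup>2" for w
    unfolding S_def by (auto simp: add_pos_nonneg add_nonneg_eq_0_iff)
  have [measurable]: "S \<in> borel_measurable borel" unfolding S_def by measurable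
  have *: "ennreal \<bar>p\<bar> * \<Phi> p (p * w) = ennreal (S w) * (ennreal (p\<^sup>2) * indicator {0<..<1 / S w} \<bar>p\<bar>) *
      indicator {a..b} (sgn p * h / S w)" if "p \<noteq> 0" for p w
  proof -
    have 1: "h * p / (\<bar>p\<bar> * S w) = sgn p * h / S w"
      using that by (simp add: sgn_if)
    have 2: "indicator {0<..<1} (\<bar>p\<bar> * S w) = (indicator {0<..<1 / S w} \<bar>p\<bar> :: ennreal)"
      using that S(1)[of w] by (auto simp: field_simps split: split_indicator)
    have "ennreal \<bar>p\<bar> * ennreal (\<bar>p\<bar> * S w) = ennreal (S w) * ennreal (p\<^sup>2)"
      using S(1)[of w] by (simp add: ennreal_mult[symmetric] power2_eq_square mult.assoc[symmetric])
        (simp add: ac_simps)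
    then show ?thesis
      unfolding \<Phi>' sqrt_homogeneous Sw 1 2 by (simp add: mult.assoc[symmetric])
  qed
  have "(\<integral>\<^sup>+p. \<Phi> (fst p) (snd p) \<partial>lborel) = (\<integral>\<^sup>+p. \<integral>\<^sup>+q. \<Phi> p q \<partial>lborel \<partial>lborel)"
  proof -
    have "(\<lambda>p. \<Phi> (fst p) (snd p)) \<in> borel_measurable borel" by measurable
    from nn_integral_lborel_pair[OF this] show ?thesis by simp
  qed
  also have "\<dots> = (\<integral>\<^sup>+p. \<integral>\<^sup>+w. ennreal \<bar>p\<bar> * \<Phi> p (p * w) \<partial>lborel \<partial>lborel)"
    using AE_lborel_singleton[of "0 :: real"]
  proof (intro nn_integral_cong_AE, eventually_elim)
    fix p :: real assume "p \<noteq> 0"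
    then show "(\<integral>\<^sup>+q. \<Phi> p q \<partial>lborel) = (\<integral>\<^sup>+w. ennreal \<bar>p\<bar> * \<Phi> p (p * w) \<partial>lborel)"
      by (subst nn_integral_real_affine[where c = p and t = 0]) (auto simp: nn_integral_cmult)
  qed
  also have "\<dots> = (\<integral>\<^sup>+w. \<integral>\<^sup>+p. ennreal \<bar>p\<bar> * \<Phi> p (p * w) \<partial>lborel \<partial>lborel)"
    by (rule lborel_Fubini) measurable
  also have "\<dots> = (\<integral>\<^sup>+w. (ennreal (1 / 3) * ennreal (1 / (1 + w\<^sup>2))) *
      (indicator {a..b} (h / S w) + indicator {a..b} (- h / S w)) \<partial>lborel)"
  proof (rule nn_integral_cong)
    fix w :: real
    let ?i = "indicator {a..b} (h / S w) + indicator {a..b} (- h / S w) :: ennreal"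
    have "(\<integral>\<^sup>+p. ennreal \<bar>p\<bar> * \<Phi> p (p * w) \<partial>lborel) =
       (\<integral>\<^sup>+p. (ennreal (S w) * ?i) * (ennreal (p\<^sup>2) * indicator {0<..<1 / S w} p) \<partial>lborel)"
    proof -
      have "ennreal \<bar>p\<bar> * \<Phi> p (p * w) + ennreal \<bar>- p\<bar> * \<Phi> (- p) (- p * w) =
          (ennreal (S w) * ?i) * (ennreal (p\<^sup>2) * indicator {0<..<1 / S w} p)" if "p > 0" for p
      proof -
        have dist: "X * Y * i + X * Y * j = X * (i + j) * Y" for X Y i j :: ennreal
          by (simp only: distrib_left distrib_right mult_ac)
        show ?thesis unfolding *[of p w, OF less_imp_neq[OF that, symmetric]]
          using *[of "- p" w] that dist by simp
      qed
      then have eq: "(ennreal \<bar>p\<bar> * \<Phi> p (p * w) + ennreal \<bar>- p\<bar> * \<Phi> (- p) (- p * w)) * indicator {0<..} p =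
          (ennreal (S w) * ?i) * (ennreal (p\<^sup>2) * indicator {0<..<1 / S w} p)" for p
        by (cases "p > 0") auto
      have "(\<lambda>p. ennreal \<bar>p\<bar> * \<Phi> p (p * w)) \<in> borel_measurable borel" by measurable
      from nn_integral_real_split[OF this] show ?thesis unfolding eq .
    qed
    also have "\<dots> = (ennreal (S w) * ?i) * ennreal ((1 / S w) ^ 3 / 3)"
      using S(1)[of w] by (subst nn_integral_cmult) (auto simp: nn_integral_square_Ioo)
    also have "\<dots> = (ennreal (S w) * ennreal ((1 / S w) ^ 3 / 3)) * ?i"
      by (simp add: ac_simps)
    also have "ennreal (S w) * ennreal ((1 / S w) ^ 3 / 3) = ennreal (1 / 3) * ennreal (1 / (1 + w\<^sup>2))"
      unfolding S(3)[symmetric] using S(1)[of w]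
      by (simp add: ennreal_mult[symmetric] power3_eq_cube power2_eq_square)
    finally show "(\<integral>\<^sup>+p. ennreal \<bar>p\<bar> * \<Phi> p (p * w) \<partial>lborel) = (ennreal (1 / 3) * ennreal (1 / (1 + w\<^sup>2))) * ?i" .
  qed
  also have "\<dots> = ennreal (1 / 3) * (arc_length a b h + arc_length a b (- h))"
  proof -
    have sum: "arc_length a b h + arc_length a b (- h) = (\<integral>\<^sup>+w. ennreal (1 / (1 + w\<^sup>2)) * indicator {a..b} (h / S w) +
        ennreal (1 / (1 + w\<^sup>2)) * indicator {a..b} (- h / S w) \<partial>lborel)"
      unfolding arc_length_def Sw by (rule nn_integral_add[symmetric]) measurable
    show ?thesis
      unfolding sum by (subst nn_integral_cmult[symmetric]) (measurable, simp only: mult.assoc distrib_left)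
  qed
  finally have "(\<integral>\<^sup>+p. \<Phi> (fst p) (snd p) \<partial>lborel) = ennreal (1 / 3) * (arc_length a b h + arc_length a b (- h))" .
  then have "3 * (\<integral>\<^sup>+p. \<Phi> (fst p) (snd p) \<partial>lborel) = (3 * ennreal (1 / 3)) * (arc_length a b h + arc_length a b (- h))"
    by (simp only: mult.assoc)
  also have "3 * ennreal (1 / 3) = 1"
    using ennreal_mult[of 3 "1 / 3"] by simp
  finally show ?thesis
    unfolding \<Phi>_def by (simp only: mult_1)
qed

lemma sin_ge_third:
  assumes "0 \<le> x" "x \<le> pi / 2"
  shows "x / 3 \<le> sin x"
proof -
  have "\<bar>sin x - (\<Sum>m<3. sin_coeff m * x ^ m)\<bar> \<le> inverse (fact 3) * \<bar>x\<bar> ^ 3"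
    by (rule Maclaurin_sin_bound)
  moreover have "(\<Sum>m<3. sin_coeff m * x ^ m) = x"
    by (simp add: numeral_3_eq_3 sin_coeff_def)
  ultimately have "6 * \<bar>sin x - x\<bar> \<le> x ^ 3"
    using assms by (simp add: fact_numeral)
  then have "x - x ^ 3 / 6 \<le> sin x" using abs_ge_minus_self[of "sin x - x"] by simp
  moreover have "x ^ 3 \<le> 4 * x"
  proof -
    have "x \<le> 2" using assms pi_half_less_two by linarith
    then have "x * x \<le> 2 * 2" using assms by (intro mult_mono) auto
    then have "x * (x * x) \<le> x * 4" using assms by (intro mult_left_mono) auto
    then show ?thesis by (simp add: power3_eq_cube ac_simps)
  qed
  ultimately show ?thesis by simp
qed

text \<open>
  One inequality covers both the quadratic behaviour of the cosine at \<open>0\<close> and the linear behaviour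
  away from it.
\<close>

lemma cos_diff_lower:
  assumes "0 \<le> s" "s \<le> t" "t \<le> pi / 2"
  shows "(t - s) * (t + s) / 18 \<le> cos s - cos t"
proof -
  have "(s + t) / 2 / 3 * ((t - s) / 2 / 3) \<le> sin ((s + t) / 2) * sin ((t - s) / 2)"
    using assms by (intro mult_mono sin_ge_third) (auto intro!: sin_ge_zero)
  then show ?thesis
    unfolding cos_diff_cos by (simp add: field_simps)
qed

lemma nn_integral_atLeast_le:
  fixes f :: "real \<Rightarrow> ennreal"
  assumes [measurable]: "f \<in> borel_measurable borel"
    and le: "\<And>n :: nat. (\<integral>\<^sup>+x. f x * indicator {0..real n} x \<partial>lborel) \<le> D"
  shows "(\<integral>\<^sup>+x. f x * indicator {0..} x \<partial>lborel) \<le> D"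
proof -
  have "(SUP n :: nat. f x * indicator {0..real n} x) = f x * indicator {0..} x" for x
  proof (cases "x \<ge> 0")
    case True
    obtain n :: nat where n: "x \<le> real n" using real_arch_simple by blast
    show ?thesis
    proof (rule antisym)
      show "f x * indicator {0..} x \<le> (SUP n :: nat. f x * indicator {0..real n} x)"
        using True n by (intro SUP_upper2[of n]) auto
    qed (auto intro!: SUP_least split: split_indicator)
  qed auto
  then have "(\<integral>\<^sup>+x. f x * indicator {0..} x \<partial>lborel) = (\<integral>\<^sup>+x. (SUP n :: nat. f x * indicator {0..real n} x) \<partial>lborel)"
    by simp
  also have "\<dots> = (SUP n :: nat. (\<integral>\<^sup>+x. f x * indicator {0..real n} x \<partial>lborel))"
    by (rule nn_integral_monotone_convergence_SUP)
      (auto simp: incseq_def le_fun_def intro!: mult_left_mono split: split_indicator)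
  also have "\<dots> \<le> D" by (intro SUP_least le)
  finally show ?thesis .
qed

text \<open>
  The substitution \<open>t = arctan w\<close> turns the integral into the measure of \<open>A \<inter> {0..<pi / 2}\<close>, a set
  contained in an interval of length \<open>D\<close> that starts at its infimum.
\<close>

lemma arctan_measure_le:
  assumes A: "A \<in> sets borel" and D: "\<And>s t. s \<in> A \<Longrightarrow> t \<in> A \<Longrightarrow> 0 \<le> s \<Longrightarrow> s \<le> t \<Longrightarrow> t < pi / 2 \<Longrightarrow> t - s \<le> D"
    and D0: "D \<ge> 0"
  shows "(\<integral>\<^sup>+w. ennreal (1 / (1 + w\<^sup>2)) * indicator A (arctan w) * indicator {0..} w \<partial>lborel) \<le> ennreal D"
proof (rule nn_integral_atLeast_le)
  note A[measurable]
  show "(\<lambda>w. ennreal (1 / (1 + w\<^sup>2)) * indicator A (arctan w)) \<in> borel_measurable borel"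
    by (intro borel_measurable_times_ennreal measurable_compose[OF _ borel_measurable_indicator[OF A]])
      (auto intro!: borel_measurable_continuous_onI continuous_intros)
  fix n :: nat
  have "(\<integral>\<^sup>+w. ennreal (1 / (1 + w\<^sup>2)) * indicator A (arctan w) * indicator {0..real n} w \<partial>lborel) =
     (\<integral>\<^sup>+w. ennreal (indicator A (arctan w) * (1 / (1 + w\<^sup>2)) * indicator {0..real n} w) \<partial>lborel)"
    by (intro nn_integral_cong) (auto split: split_indicator)
  also have "\<dots> = (\<integral>\<^sup>+t. ennreal (indicator A t * indicator {arctan 0..arctan (real n)} t) \<partial>lborel)"
    by (rule nn_integral_substitution[symmetric])
      (auto intro!: derivative_eq_intros continuous_intros simp: set_borel_measurable_def field_simps add_nonneg_eq_0_iff)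
  also have "\<dots> = emeasure lborel (A \<inter> {0..arctan (real n)})"
  proof -
    have "ennreal (indicator A t * indicator {0..arctan (real n)} t) = indicator (A \<inter> {0..arctan (real n)}) t" for t
      by (simp split: split_indicator)
    then show ?thesis by simp
  qed
  also have "\<dots> \<le> ennreal D"
  proof (cases "A \<inter> {0..arctan (real n)} = {}")
    case False
    let ?B = "A \<inter> {0..arctan (real n)}"
    let ?i = "Inf ?B"
    have bd: "bdd_below ?B" by (rule bdd_belowI[of _ 0]) auto
    have lt: "t < pi / 2" if "t \<in> ?B" for t
      using that arctan_ubound[of "real n"] by auto
    have "?B \<subseteq> {?i..?i + D}"
    proof
      fix t assume t: "t \<in> ?B"
      have "t - D \<le> s" if s: "s \<in> ?B" for s
      proof (cases "s \<le> t")
        case True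
        then show ?thesis using D[of s t] s t lt[OF t] by auto
      qed (use D0 in auto)
      then have "t - D \<le> ?i" using False by (intro cInf_greatest) auto
      then show "t \<in> {?i..?i + D}" using cInf_lower[OF t bd] by auto
    qed
    then have "emeasure lborel ?B \<le> emeasure lborel {?i..?i + D}"
      by (rule emeasure_mono) simp
    also have "\<dots> = ennreal D" using D0 by simp
    finally show ?thesis .
  qed simp
  finally show "(\<integral>\<^sup>+w. ennreal (1 / (1 + w\<^sup>2)) * indicator A (arctan w) * indicator {0..real n} w \<partial>lborel) \<le> ennreal D" .
qed

text \<open>
  If the interval reaches the top \<open>h\<close> of the range of \<open>h * cos \<theta>\<close>, then \<open>\<bar>h - b\<bar> \<le> b - a\<close>, and the
  quadratic behaviour of the cosine gives a bound by the square root of \<open>(b - a) / h\<close>. If \<open>h > b\<close>, the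
  angles near \<open>0\<close> are excluded, since \<open>s\<^sup>2 \<ge> 2 * (h - b) / h\<close>, and at such angles the cosine varies
  at a definite speed. The bound stated here interpolates between the two cases; its decay in
  \<open>\<bar>h - b\<bar>\<close> is what makes the cube integrable with the right power of \<open>b - a\<close>.
\<close>

lemma arc_angle_bound:
  assumes ab: "a < b" and h: "h > 0" and st: "0 \<le> s" "s \<le> t" "t < pi / 2"
    and I: "h * cos s \<in> {a..b}" "h * cos t \<in> {a..b}"
  shows "t - s \<le> 14 * (b - a) / sqrt (h * (\<bar>h - b\<bar> + (b - a)))"
proof -
  let ?d = "b - a"
  have d: "?d > 0" using ab by simp
  have "h * ((t - s) * (t + s) / 18) \<le> h * (cos s - cos t)"
    using cos_diff_lower[of s t] st h by (intro mult_left_mono) auto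
  also have "\<dots> \<le> ?d" using I by (simp add: algebra_simps)
  finally have 1: "h * (t - s) * (t + s) \<le> 18 * ?d" by simp
  have "h * (t - s)\<^sup>2 \<le> h * (t - s) * (t + s)"
    unfolding power2_eq_square mult.assoc using st h by (intro mult_left_mono) auto
  with 1 have 2: "h * (t - s)\<^sup>2 \<le> 18 * ?d" by simp
  have 3: "h * (t - s)\<^sup>2 * \<bar>h - b\<bar> \<le> 162 * ?d\<^sup>2"
  proof (cases "h \<le> b")
    case True
    have "h * cos s \<le> h" using h by simp
    then have "\<bar>h - b\<bar> \<le> ?d" using I True by auto
    then have "h * (t - s)\<^sup>2 * \<bar>h - b\<bar> \<le> (18 * ?d) * ?d"
      by (rule mult_mono[OF 2]) (use d in auto)
    also have "\<dots> \<le> 162 * ?d\<^sup>2" using d by (simp add: power2_eq_square)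
    finally show ?thesis .
  next
    case False
    have "cos s = 1 - 2 * (sin (s / 2))\<^sup>2"
      using cos_double_sin[of "s / 2"] by simp
    moreover have "(sin (s / 2))\<^sup>2 \<le> (s / 2)\<^sup>2"
      using power_mono[OF abs_sin_x_le_abs_x[of "s / 2"] abs_ge_zero, of 2] by (simp only: power2_abs)
    ultimately have "1 - cos s \<le> s\<^sup>2 / 2" by (simp add: power_divide)
    then have "h * (1 - cos s) \<le> h * (s\<^sup>2 / 2)" using h by (intro mult_left_mono) auto
    then have hb: "2 * (h - b) \<le> h * s\<^sup>2" using I by (simp add: algebra_simps)
    have "s\<^sup>2 \<le> (t + s)\<^sup>2" using st by (intro power_mono) auto
    then have "h * s\<^sup>2 \<le> h * (t + s)\<^sup>2" using h by (intro mult_left_mono) auto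
    with hb have hb': "2 * (h - b) \<le> h * (t + s)\<^sup>2" by linarith
    have "(h * (t - s)\<^sup>2) * (2 * (h - b)) \<le> (h * (t - s)\<^sup>2) * (h * (t + s)\<^sup>2)"
      using hb' h by (intro mult_left_mono) auto
    also have "\<dots> = (h * (t - s) * (t + s))\<^sup>2" by (simp add: power2_eq_square algebra_simps)
    also have "\<dots> \<le> (18 * ?d)\<^sup>2" using 1 st h by (intro power_mono) auto
    also have "(18 * ?d)\<^sup>2 = 2 * (162 * ?d\<^sup>2)" unfolding power_mult_distrib by simp
    also have "(h * (t - s)\<^sup>2) * (2 * (h - b)) = 2 * (h * (t - s)\<^sup>2 * (h - b))" by (simp only: mult.left_commute)
    finally have "h * (t - s)\<^sup>2 * (h - b) \<le> 162 * ?d\<^sup>2" by linarith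
    then show ?thesis using False by simp
  qed
  let ?q = "h * (\<bar>h - b\<bar> + ?d)"
  have q: "?q > 0" using h d by (intro mult_pos_pos) auto
  have "h * (t - s)\<^sup>2 * ?d \<le> 18 * ?d * ?d" using 2 d by (intro mult_right_mono) auto
  moreover have "(t - s)\<^sup>2 * ?q = h * (t - s)\<^sup>2 * \<bar>h - b\<bar> + h * (t - s)\<^sup>2 * ?d"
    by (simp only: distrib_left mult_ac)
  moreover have "18 * ?d * ?d = 18 * ?d\<^sup>2" by (simp only: power2_eq_square mult_ac)
  moreover have "(14 * ?d)\<^sup>2 = 196 * ?d\<^sup>2" unfolding power_mult_distrib by simp
  moreover have "?d\<^sup>2 \<ge> 0" by (rule zero_le_power2)
  ultimately have "(t - s)\<^sup>2 * ?q \<le> (14 * ?d)\<^sup>2" using 3 by linarith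
  then have "((t - s) * sqrt ?q)\<^sup>2 \<le> (14 * ?d)\<^sup>2"
    using q by (simp add: power_mult_distrib)
  then have "(t - s) * sqrt ?q \<le> 14 * ?d" by (rule power2_le_imp_le) (use d in auto)
  then show ?thesis using q by (simp add: pos_le_divide_eq)
qed

lemma arc_length_bound:
  assumes ab: "a < b" and h: "h > 0"
  shows "arc_length a b h \<le> ennreal (28 * (b - a) / sqrt (h * (\<bar>h - b\<bar> + (b - a))))"
proof -
  define D where "D = 14 * (b - a) / sqrt (h * (\<bar>h - b\<bar> + (b - a)))"
  let ?A = "{t. h * cos t \<in> {a..b}}"
  let ?f = "\<lambda>w. ennreal (1 / (1 + w\<^sup>2)) * indicator ?A (arctan w)"
  have D0: "D \<ge> 0" unfolding D_def using ab h by simp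
  have f: "ennreal (1 / (1 + w\<^sup>2)) * indicator {a..b} (h / sqrt (1 + w\<^sup>2)) = ?f w" for w
    by (simp add: cos_arctan indicator_def)
  have [measurable]: "(\<lambda>w. ennreal (1 / (1 + w\<^sup>2)) * indicator {a..b} (h / sqrt (1 + w\<^sup>2))) \<in> borel_measurable borel"
    by measurable
  have A: "?A \<in> sets borel" by measurable
  have le: "(\<integral>\<^sup>+w. ?f w * indicator {0..} w \<partial>lborel) \<le> ennreal D"
    using arc_angle_bound[OF ab h, folded D_def] by (intro arctan_measure_le A D0) auto
  have "arc_length a b h = (\<integral>\<^sup>+w. 2 * (?f w * indicator {0<..} w) \<partial>lborel)"
    unfolding arc_length_def f[symmetric]
    by (subst nn_integral_real_split) (auto intro!: nn_integral_cong simp: mult_2 distrib_right mult.assoc)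
  also have "\<dots> = 2 * (\<integral>\<^sup>+w. ?f w * indicator {0<..} w \<partial>lborel)"
    unfolding f[symmetric] by (rule nn_integral_cmult) measurable
  also have "\<dots> \<le> 2 * (\<integral>\<^sup>+w. ?f w * indicator {0..} w \<partial>lborel)"
    by (intro mult_left_mono nn_integral_mono) (auto split: split_indicator)
  also have "\<dots> \<le> 2 * ennreal D" by (intro mult_left_mono le) auto
  also have "\<dots> = ennreal (2 * D)" using D0 by (simp add: ennreal_mult)
  finally show ?thesis by (simp add: D_def)
qed

section \<open>The kernel of the truncated operator composed with its adjoint\<close>

lemma measurable_dist_line [measurable]: "dist_line x \<in> borel_measurable borel"
  unfolding dist_line_def[abs_def] by measurable

lemma measurable_plane_integral_sphere [measurable]:
  assumes [measurable]: "f \<in> borel_measurable borel"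
  shows "(\<lambda>\<omega>. plane_integral f (x \<bullet> \<omega>) \<omega>) \<in> borel_measurable sphere_measure"
proof -
  note measurable_ident_sphere[measurable]
  show ?thesis by (rule measurable_plane_integral) measurable
qed

lemma measurable_inner_sphere [measurable]: "(\<lambda>\<omega>. x \<bullet> \<omega>) \<in> borel_measurable sphere_measure"
  unfolding vec3_inner by measurable

text \<open>
  The points \<open>x\<close> and \<open>x + z\<close> lie in a common plane with unit normal \<open>\<omega>\<close> exactly if \<open>\<omega>\<close> belongs to
  the great circle orthogonal to \<open>z\<close>, and \<open>\<delta>(z \<bullet> \<omega>)\<close> restricts the area measure to that circle
  with density \<open>1 / norm z\<close>. So the kernel is \<open>1 / norm z\<close> times the length of the part of the circle
  on which \<open>x \<bullet> \<omega> \<in> {a..b}\<close>; the two summands are the two half-circles.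
\<close>

lemma dual_kernel:
  fixes g :: "real ^ 3 \<Rightarrow> ennreal"
  assumes [measurable]: "g \<in> borel_measurable borel"
  shows "(\<integral>\<^sup>+\<omega>. indicator {a..b} (x \<bullet> \<omega>) * plane_integral g (x \<bullet> \<omega>) \<omega> \<partial>sphere_measure) =
    (\<integral>\<^sup>+z. g (x + z) * (ennreal (1 / norm z) *
       (arc_length a b (dist_line x z) + arc_length a b (- dist_line x z))) \<partial>lborel)"
proof -
  define c where "c = (\<lambda>v :: real ^ 3. ennreal (norm v) * indicator {0<..<1} (norm v) * (indicator {a..b} (x \<bullet> v / norm v) :: ennreal))"
  have c[measurable]: "c \<in> borel_measurable borel" unfolding c_def by measurable
  define \<Psi> where "\<Psi> = (\<lambda>v z. c v * g (x + z))"
  have \<Psi>m: "case_prod \<Psi> \<in> borel_measurable (borel \<Otimes>\<^sub>M borel)" unfolding \<Psi>_def by measurable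
  have "(\<integral>\<^sup>+\<omega>. indicator {a..b} (x \<bullet> \<omega>) * plane_integral g (x \<bullet> \<omega>) \<omega> \<partial>sphere_measure) =
     3 * (\<integral>\<^sup>+v. indicator {a..b} (x \<bullet> sgn v) * plane_integral g (x \<bullet> sgn v) (sgn v) * indicator (ball 0 1 - {0}) v \<partial>lborel)"
    by (rule nn_integral_sphere) measurable
  also have "(\<integral>\<^sup>+v. indicator {a..b} (x \<bullet> sgn v) * plane_integral g (x \<bullet> sgn v) (sgn v) * indicator (ball 0 1 - {0}) v \<partial>lborel) =
     (\<integral>\<^sup>+v. plane_integral (\<Psi> v) 0 v \<partial>lborel)"
  proof (rule nn_integral_cong)
    fix v :: "real ^ 3"
    show "indicator {a..b} (x \<bullet> sgn v) * plane_integral g (x \<bullet> sgn v) (sgn v) * indicator (ball 0 1 - {0}) v =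
      plane_integral (\<Psi> v) 0 v"
    proof (cases "v = 0")
      case False
      then have nv: "norm v > 0" by simp
      have sv: "sgn v = (1 / norm v) *\<^sub>R v" "x \<bullet> sgn v = 1 / norm v * (x \<bullet> v)"
        by (simp_all add: sgn_div_norm divide_inverse)
      have "plane_integral g (x \<bullet> sgn v) (sgn v) = ennreal (norm v) * plane_integral g (x \<bullet> v) v"
        using plane_integral_scale[of "1 / norm v" g "x \<bullet> v" v] nv by (simp add: sv(1))
      also have "plane_integral g (x \<bullet> v) v = plane_integral (\<lambda>z. g (x + z)) 0 v"
        by (rule plane_integral_translate) measurable
      finally have "plane_integral g (x \<bullet> sgn v) (sgn v) = ennreal (norm v) * plane_integral (\<lambda>z. g (x + z)) 0 v" .
      moreover have "plane_integral (\<Psi> v) 0 v = c v * plane_integral (\<lambda>z. g (x + z)) 0 v"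
        unfolding \<Psi>_def by (rule plane_integral_cmult) measurable
      moreover have "c v = indicator {a..b} (x \<bullet> sgn v) * ennreal (norm v) * indicator (ball 0 1 - {0}) v"
        unfolding c_def sv using False by (auto split: split_indicator)
      ultimately show ?thesis by (simp add: mult_ac)
    qed (simp add: plane_integral_def)
  qed
  also have "\<dots> = (\<integral>\<^sup>+z. ennreal (1 / \<bar>z $ 1\<bar>) *
       (\<integral>\<^sup>+p. \<Psi> (vector [- (z $ 2 * fst p + z $ 3 * snd p) / z $ 1, fst p, snd p]) z \<partial>lborel) \<partial>lborel)"
    by (rule incidence_swap[OF \<Psi>m])
  also have "3 * \<dots> = (\<integral>\<^sup>+z. 3 * (ennreal (1 / \<bar>z $ 1\<bar>) *
       (\<integral>\<^sup>+p. \<Psi> (vector [- (z $ 2 * fst p + z $ 3 * snd p) / z $ 1, fst p, snd p]) z \<partial>lborel)) \<partial>lborel)"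
    unfolding \<Psi>_def by (rule nn_integral_cmult[symmetric]) measurable
  also have "\<dots> = (\<integral>\<^sup>+z. g (x + z) * (ennreal (1 / norm z) *
       (arc_length a b (dist_line x z) + arc_length a b (- dist_line x z))) \<partial>lborel)"
  proof (rule nn_integral_cong_AE)
    have "{z :: real ^ 3. z $ 1 = 0} \<in> null_sets lborel"
    proof -
      have "negligible {x :: real ^ 3. axis 1 1 \<bullet> x = 0}"
        by (rule negligible_hyperplane) (simp add: axis_eq_0_iff)
      moreover have "closed {x :: real ^ 3. x $ 1 = 0}"
        by (intro closed_Collect_eq continuous_intros)
      ultimately show ?thesis
        by (simp add: negligible_iff_null_sets null_sets_def inner_axis' emeasure_completion)
    qed
    then have "AE z :: real ^ 3 in lborel. z $ 1 \<noteq> 0" by (rule AE_I') auto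
    then show "AE z in lborel. 3 * (ennreal (1 / \<bar>z $ 1\<bar>) *
       (\<integral>\<^sup>+p. \<Psi> (vector [- (z $ 2 * fst p + z $ 3 * snd p) / z $ 1, fst p, snd p]) z \<partial>lborel)) =
       g (x + z) * (ennreal (1 / norm z) *
       (arc_length a b (dist_line x z) + arc_length a b (- dist_line x z)))"
    proof eventually_elim
      fix z :: "real ^ 3" assume z1: "z $ 1 \<noteq> 0"
      then have z0: "z \<noteq> 0" by auto
      let ?h = "dist_line x z"
      obtain e where e: "norm e = 1" "z \<bullet> e = 0" "x \<bullet> e = ?h" "x \<bullet> cross3 z e = 0"
        using orthonormal_frame[OF z0] by blast
      let ?v = "\<lambda>p. fst p *\<^sub>R e + (snd p / norm z) *\<^sub>R cross3 z e"
      have ncross: "norm (cross3 z e) = norm z"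
        using norm_cross_dot[of z e] e by (simp add: power2_eq_iff_nonneg)
      have nv: "norm (?v p) = sqrt ((fst p)\<^sup>2 + (snd p)\<^sup>2)" for p :: "real \<times> real"
      proof -
        have "orthogonal (fst p *\<^sub>R e) ((snd p / norm z) *\<^sub>R cross3 z e)"
          by (simp add: orthogonal_def dot_cross_self)
        then have "(norm (?v p))\<^sup>2 = (fst p)\<^sup>2 + (snd p)\<^sup>2"
          using z0 by (simp add: norm_add_Pythagorean ncross e power_mult_distrib power_divide)
        then show ?thesis by (simp add: real_sqrt_unique)
      qed
      have xv: "x \<bullet> ?v p = ?h * fst p" for p :: "real \<times> real"
        using e by (simp add: inner_add_right)
      have cv: "c (?v p) = ennreal (sqrt ((fst p)\<^sup>2 + (snd p)\<^sup>2)) *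
        indicator {s. 0 < s \<and> s < 1 \<and> ?h * fst p / s \<in> {a..b}} (sqrt ((fst p)\<^sup>2 + (snd p)\<^sup>2))" for p
        unfolding c_def nv xv by (auto split: split_indicator)
      have [measurable]: "(\<lambda>p. c (?v p)) \<in> borel_measurable borel"
        by measurable
      have "ennreal (1 / \<bar>z $ 1\<bar>) * (\<integral>\<^sup>+p. \<Psi> (vector [- (z $ 2 * fst p + z $ 3 * snd p) / z $ 1, fst p, snd p]) z \<partial>lborel)
        = ennreal (1 / norm z) * (\<integral>\<^sup>+p. \<Psi> (?v p) z \<partial>lborel)"
        by (rule plane_through_origin_frame[OF _ z1 e(1,2), of "\<lambda>v. \<Psi> v z"]) (simp add: \<Psi>_def)
      also have "(\<integral>\<^sup>+p. \<Psi> (?v p) z \<partial>lborel) = (\<integral>\<^sup>+p. c (?v p) \<partial>lborel) * g (x + z)"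
        unfolding \<Psi>_def by (rule nn_integral_multc) measurable
      finally have "3 * (ennreal (1 / \<bar>z $ 1\<bar>) * (\<integral>\<^sup>+p. \<Psi> (vector [- (z $ 2 * fst p + z $ 3 * snd p) / z $ 1, fst p, snd p]) z \<partial>lborel))
        = g (x + z) * (ennreal (1 / norm z) * (3 * (\<integral>\<^sup>+p. c (?v p) \<partial>lborel)))"
        by (simp add: mult_ac)
      also have "3 * (\<integral>\<^sup>+p. c (?v p) \<partial>lborel) = arc_length a b ?h + arc_length a b (- ?h)"
        unfolding cv by (rule disc_sector_integral)
      finally show "3 * (ennreal (1 / \<bar>z $ 1\<bar>) *
       (\<integral>\<^sup>+p. \<Psi> (vector [- (z $ 2 * fst p + z $ 3 * snd p) / z $ 1, fst p, snd p]) z \<partial>lborel)) =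
       g (x + z) * (ennreal (1 / norm z) * (arc_length a b ?h + arc_length a b (- ?h)))" .
    qed
  qed
  finally show ?thesis .
qed

section \<open>The cube of the arc bound integrated over the sphere\<close>

lemma nn_integral_inverse_sqrt:
  assumes "d > 0"
  shows "(\<integral>\<^sup>+x. ennreal (1 / sqrt x) * indicator {0<..<d} x \<partial>lborel) = ennreal (2 * sqrt d)"
proof -
  have "(\<integral>\<^sup>+x. ennreal (1 / sqrt x) * indicator {0<..<d} x \<partial>lborel) =
    (\<integral>\<^sup>+x. ennreal (1 / sqrt x * indicator {0\<^sup>2..(sqrt d)\<^sup>2} x) \<partial>lborel)"
  proof (rule nn_integral_cong_AE)
    show "AE x in lborel. ennreal (1 / sqrt x) * indicator {0<..<d} x = ennreal (1 / sqrt x * indicator {0\<^sup>2..(sqrt d)\<^sup>2} x)"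
      using AE_lborel_singleton[of d] by eventually_elim (use assms in \<open>auto split: split_indicator\<close>)
  qed
  also have "\<dots> = (\<integral>\<^sup>+u. ennreal (1 / sqrt (u\<^sup>2) * (2 * u) * indicator {0..sqrt d} u) \<partial>lborel)"
    using assms
    by (intro nn_integral_substitution[where g = "\<lambda>u. u\<^sup>2"])
      (auto intro!: derivative_eq_intros continuous_intros simp: set_borel_measurable_def)
  also have "\<dots> = (\<integral>\<^sup>+u. 2 * indicator {0..sqrt d} u \<partial>lborel)"
  proof (rule nn_integral_cong_AE)
    show "AE u in lborel. ennreal (1 / sqrt (u\<^sup>2) * (2 * u) * indicator {0..sqrt d} u) = 2 * indicator {0..sqrt d} u"
      using AE_lborel_singleton[of "0 :: real"] by eventually_elim (auto split: split_indicator)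
  qed
  also have "\<dots> = ennreal (2 * sqrt d)"
    using assms by (simp add: nn_integral_cmult ennreal_mult)
  finally show ?thesis .
qed

lemma nn_integral_shifted_decay:
  assumes d: "d > 0"
  shows "(\<integral>\<^sup>+x. ennreal (1 / sqrt (\<bar>x - c\<bar> + d) ^ 3) \<partial>lborel) = ennreal (4 / sqrt d)"
proof -
  let ?f = "\<lambda>x. ennreal (1 / sqrt (\<bar>x\<bar> + d) ^ 3)"
  have half: "(\<integral>\<^sup>+x. ennreal (1 / sqrt (x + d) ^ 3) * indicator {0..} x \<partial>lborel) = ennreal (0 - (- 2 / sqrt (0 + d)))"
  proof (rule nn_integral_FTC_atLeast)
    fix x :: real assume x: "0 \<le> x"
    then have p: "x + d > 0" using d by simp
    have "((\<lambda>x. - 2 / sqrt (x + d)) has_real_derivative (2 * (inverse (sqrt (x + d)) / 2) / (sqrt (x + d))\<^sup>2)) (at x)"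
      using p by (auto intro!: derivative_eq_intros simp: power2_eq_square divide_simps)
    moreover have "2 * (inverse (sqrt (x + d)) / 2) / (sqrt (x + d))\<^sup>2 = 1 / sqrt (x + d) ^ 3"
      by (simp add: power2_eq_square power3_eq_cube field_simps del: real_sqrt_mult_self real_sqrt_mult)
    ultimately show "((\<lambda>x. - 2 / sqrt (x + d)) has_real_derivative 1 / sqrt (x + d) ^ 3) (at x)" by simp
    show "0 \<le> 1 / sqrt (x + d) ^ 3" using p by simp
  next
    have "filterlim (\<lambda>x. sqrt (x + d)) at_top at_top"
      using filterlim_compose[OF sqrt_at_top filterlim_tendsto_add_at_top[OF tendsto_const[of d] filterlim_ident]]
      by (simp add: add.commute)
    then show "((\<lambda>x. - 2 / sqrt (x + d)) \<longlongrightarrow> 0) at_top"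
      by (intro tendsto_divide_0[OF tendsto_const] filterlim_at_top_imp_at_infinity)
  qed measurable
  have "(\<integral>\<^sup>+x. ennreal (1 / sqrt (\<bar>x - c\<bar> + d) ^ 3) \<partial>lborel) = (\<integral>\<^sup>+x. ?f x \<partial>lborel)"
    by (subst nn_integral_real_affine[where c = 1 and t = c]) auto
  also have "\<dots> = (\<integral>\<^sup>+x. (?f x + ?f (- x)) * indicator {0<..} x \<partial>lborel)"
    by (rule nn_integral_real_split) measurable
  also have "\<dots> = (\<integral>\<^sup>+x. 2 * (ennreal (1 / sqrt (x + d) ^ 3) * indicator {0..} x) \<partial>lborel)"
  proof (rule nn_integral_cong_AE)
    show "AE x in lborel. (?f x + ?f (- x)) * indicator {0<..} x = 2 * (ennreal (1 / sqrt (x + d) ^ 3) * indicator {0..} x)"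
      using AE_lborel_singleton[of "0 :: real"] by eventually_elim (auto simp: mult_2 split: split_indicator)
  qed
  also have "\<dots> = 2 * ennreal (2 / sqrt d)"
    by (subst nn_integral_cmult) (use half in auto)
  also have "\<dots> = ennreal (4 / sqrt d)"
    using d ennreal_mult[of 2 "2 / sqrt d"] by simp
  finally show ?thesis .
qed

text \<open>
  One of \<open>h\<close> and \<open>r - h\<close> is at least \<open>r / 2\<close>.
\<close>

lemma inverse_sqrt_product_le:
  fixes h r :: real
  assumes "0 < h" "h < r"
  shows "1 / (sqrt h * sqrt (r - h)) \<le> sqrt (2 / r) * (1 / sqrt h + 1 / sqrt (r - h))"
proof (cases "h \<ge> r / 2")
  case True
  then have "1 / h \<le> 2 / r" using assms by (simp add: field_simps)
  then have "sqrt (1 / h) \<le> sqrt (2 / r)" by (rule real_sqrt_le_mono)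
  then have "1 / sqrt h * (1 / sqrt (r - h)) \<le> sqrt (2 / r) * (1 / sqrt (r - h))"
    using assms by (intro mult_right_mono) (auto simp: real_sqrt_divide)
  also have "\<dots> \<le> sqrt (2 / r) * (1 / sqrt h + 1 / sqrt (r - h))"
    using assms by (intro mult_left_mono) auto
  finally show ?thesis by simp
next
  case False
  then have "1 / (r - h) \<le> 2 / r" using assms by (simp add: field_simps)
  then have "sqrt (1 / (r - h)) \<le> sqrt (2 / r)" by (rule real_sqrt_le_mono)
  then have "1 / sqrt h * (1 / sqrt (r - h)) \<le> 1 / sqrt h * sqrt (2 / r)"
    using assms by (intro mult_left_mono) (auto simp: real_sqrt_divide)
  also have "\<dots> \<le> sqrt (2 / r) * (1 / sqrt h + 1 / sqrt (r - h))"
    using assms by (simp add: distrib_left)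
  finally show ?thesis by simp
qed

text \<open>
  For \<open>x < d\<close> the second factor is bounded by its value at \<open>Y = d\<close>, and for \<open>x \<ge> d\<close> the first one
  by its value at \<open>x = d\<close>.
\<close>

lemma inverse_sqrt_split_le:
  fixes x Y d :: real
  assumes "0 < x" "0 < d" "d \<le> Y"
  shows "1 / sqrt x * (1 / sqrt Y ^ 3) \<le>
    1 / sqrt d ^ 3 * (1 / sqrt x * indicator {0<..<d} x) + 1 / sqrt d * (1 / sqrt Y ^ 3)"
proof (cases "x < d")
  case True
  have "1 / sqrt Y ^ 3 \<le> 1 / sqrt d ^ 3"
    using assms by (intro divide_left_mono power_mono) auto
  then have "1 / sqrt x * (1 / sqrt Y ^ 3) \<le> 1 / sqrt x * (1 / sqrt d ^ 3)"
    using assms by (intro mult_left_mono) auto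
  moreover have "0 \<le> 1 / sqrt d * (1 / sqrt Y ^ 3)" using assms by simp
  moreover have "A * B \<le> C * (A * 1) + E" if "A * B \<le> A * C" "0 \<le> E" for A B C E :: real
    using that by (simp add: mult.commute)
  moreover have "indicator {0<..<d} x = (1 :: real)" using True assms by simp
  ultimately show ?thesis by metis
next
  case False
  then have "1 / sqrt x * (1 / sqrt Y ^ 3) \<le> 1 / sqrt d * (1 / sqrt Y ^ 3)"
    using assms by (intro mult_right_mono divide_left_mono) auto
  then show ?thesis using False by simp
qed

text \<open>
  The integrand has inverse square root singularities at \<open>0\<close> and \<open>r\<close> and a peak of width \<open>d\<close> at
  \<open>c\<close>, which may lie anywhere, in particular near \<open>0\<close> or \<open>r\<close>. The two preceding inequalities separate
  the three. Every resulting integral is of order \<open>1 / d\<close>, uniformly in \<open>c\<close>.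
\<close>

lemma singular_integral_bound:
  fixes c d r :: real
  assumes d: "d > 0" and r: "r > 0"
  shows "(\<integral>\<^sup>+h. ennreal (1 / (sqrt h * sqrt (r - h)) * (1 / sqrt (\<bar>h - c\<bar> + d) ^ 3)) * indicator {0<..<r} h \<partial>lborel)
    \<le> ennreal (sqrt (2 / r) * (12 / d))"
proof -
  let ?Y = "\<lambda>h. 1 / sqrt (\<bar>h - c\<bar> + d) ^ 3"
  let ?k = "\<lambda>x. ennreal (1 / sqrt x) * indicator {0<..<d} x"
  have Y: "?Y h \<ge> 0" for h using d by simp
  have pw: "ennreal (1 / (sqrt h * sqrt (r - h)) * ?Y h) * indicator {0<..<r} h \<le>
     ennreal (sqrt (2 / r)) * (ennreal (1 / sqrt d ^ 3) * ?k h + ennreal (1 / sqrt d ^ 3) * ?k (r - h) + ennreal (2 / sqrt d) * ennreal (?Y h))" for h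
  proof (cases "0 < h \<and> h < r")
    case True
    let ?K = "\<lambda>x. 1 / sqrt x * indicator {0<..<d} x"
    have "1 / (sqrt h * sqrt (r - h)) * ?Y h \<le> sqrt (2 / r) * (1 / sqrt h + 1 / sqrt (r - h)) * ?Y h"
      using inverse_sqrt_product_le[of h r] True Y by (intro mult_right_mono) auto
    also have "\<dots> = sqrt (2 / r) * (1 / sqrt h * ?Y h + 1 / sqrt (r - h) * ?Y h)"
      by (simp only: distrib_right distrib_left mult.assoc)
    also have "\<dots> \<le> sqrt (2 / r) * ((1 / sqrt d ^ 3 * ?K h + 1 / sqrt d * ?Y h) + (1 / sqrt d ^ 3 * ?K (r - h) + 1 / sqrt d * ?Y h))"
      using True d r by (intro mult_left_mono add_mono inverse_sqrt_split_le) auto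
    also have "\<dots> = sqrt (2 / r) * (1 / sqrt d ^ 3 * ?K h + 1 / sqrt d ^ 3 * ?K (r - h) + 2 / sqrt d * ?Y h)"
      by simp
    finally have "ennreal (1 / (sqrt h * sqrt (r - h)) * ?Y h) \<le>
        ennreal (sqrt (2 / r) * (1 / sqrt d ^ 3 * ?K h + 1 / sqrt d ^ 3 * ?K (r - h) + 2 / sqrt d * ?Y h))"
      by (rule ennreal_leI)
    also have "\<dots> = ennreal (sqrt (2 / r)) * (ennreal (1 / sqrt d ^ 3) * ?k h + ennreal (1 / sqrt d ^ 3) * ?k (r - h) + ennreal (2 / sqrt d) * ennreal (?Y h))"
    proof -
      have K: "ennreal (?K x) = ?k x" "?K x \<ge> 0" if "x > 0" for x
        using that by (auto split: split_indicator)
      have "ennreal (A * (B * k + B * l + M * y)) = ennreal A * (ennreal B * ennreal k + ennreal B * ennreal l + ennreal M * ennreal y)"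
        if "0 \<le> A" "0 \<le> B" "0 \<le> M" "0 \<le> k" "0 \<le> l" "0 \<le> y" for A B M k l y :: real
        using that by (simp add: ennreal_mult ennreal_plus)
      from this[of "sqrt (2 / r)" "1 / sqrt d ^ 3" "2 / sqrt d" "?K h" "?K (r - h)" "?Y h"] show ?thesis
        using True d r Y K[of h] K[of "r - h"] by simp
    qed
    finally show ?thesis using True by simp
  qed (auto split: split_indicator)
  have "(\<integral>\<^sup>+h. ennreal (1 / (sqrt h * sqrt (r - h)) * ?Y h) * indicator {0<..<r} h \<partial>lborel) \<le>
    (\<integral>\<^sup>+h. ennreal (sqrt (2 / r)) * (ennreal (1 / sqrt d ^ 3) * ?k h + ennreal (1 / sqrt d ^ 3) * ?k (r - h) + ennreal (2 / sqrt d) * ennreal (?Y h)) \<partial>lborel)"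
    by (rule nn_integral_mono) (rule pw)
  also have "\<dots> = ennreal (sqrt (2 / r)) * (ennreal (1 / sqrt d ^ 3) * (\<integral>\<^sup>+h. ?k h \<partial>lborel) +
     ennreal (1 / sqrt d ^ 3) * (\<integral>\<^sup>+h. ?k (r - h) \<partial>lborel) + ennreal (2 / sqrt d) * (\<integral>\<^sup>+h. ennreal (?Y h) \<partial>lborel))"
    by (simp add: nn_integral_cmult nn_integral_add)
  also have "(\<integral>\<^sup>+h. ?k (r - h) \<partial>lborel) = (\<integral>\<^sup>+h. ?k h \<partial>lborel)"
    by (subst (2) nn_integral_real_affine[where c = "-1" and t = r]) auto
  also have "ennreal (1 / sqrt d ^ 3) * (\<integral>\<^sup>+h. ?k h \<partial>lborel) +
     ennreal (1 / sqrt d ^ 3) * (\<integral>\<^sup>+h. ?k h \<partial>lborel) + ennreal (2 / sqrt d) * (\<integral>\<^sup>+h. ennreal (?Y h) \<partial>lborel) =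
     ennreal (1 / sqrt d ^ 3 * (2 * sqrt d) + 1 / sqrt d ^ 3 * (2 * sqrt d) + 2 / sqrt d * (4 / sqrt d))"
  proof -
    have sum: "ennreal B * ennreal k + ennreal B * ennreal k + ennreal M * ennreal y = ennreal (B * k + B * k + M * y)"
      if "0 \<le> B" "0 \<le> M" "0 \<le> k" "0 \<le> y" for B M k y :: real
      using that by (simp only: ennreal_mult[symmetric] ennreal_plus[symmetric] mult_nonneg_nonneg add_nonneg_nonneg)
    show ?thesis
      unfolding nn_integral_inverse_sqrt[OF d] nn_integral_shifted_decay[OF d] by (rule sum) (use d in auto)
  qed
  also have "1 / sqrt d ^ 3 * (2 * sqrt d) + 1 / sqrt d ^ 3 * (2 * sqrt d) + 2 / sqrt d * (4 / sqrt d) = 12 / d"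
    using d by (simp add: power3_eq_cube field_simps)
  also have "ennreal (sqrt (2 / r)) * ennreal (12 / d) = ennreal (sqrt (2 / r) * (12 / d))"
    by (rule ennreal_mult[symmetric]) (use d r in auto)
  finally show ?thesis .
qed

text \<open>
  The variable \<open>y\<close> is the cotangent of the angle between \<open>z\<close> and \<open>x\<close>, where \<open>r = norm x\<close>, and
  \<open>h = r / sqrt (1 + y\<^sup>2)\<close> is the distance of the line from the origin. On each half-line \<open>h\<close> is
  monotone in \<open>y\<close>, and the substitution replaces \<open>dy / sqrt (1 + y\<^sup>2) ^ 3\<close> by
  \<open>h dh / (r * sqrt (r\<^sup>2 - h\<^sup>2))\<close>.
\<close>

lemma angular_integral_one:
  fixes c d r :: real
  assumes d: "d > 0" and r: "r > 0"
  shows "(\<integral>\<^sup>+y. ennreal (1 / sqrt (1 + y\<^sup>2) ^ 3 *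
      (1 / sqrt (r / sqrt (1 + y\<^sup>2) * (\<bar>r / sqrt (1 + y\<^sup>2) - c\<bar> + d))) ^ 3) \<partial>lborel) \<le> ennreal (34 / (d * r\<^sup>2))"
proof -
  define S where "S = (\<lambda>y :: real. sqrt (1 + y\<^sup>2))"
  have S: "S y > 0" "S y \<noteq> 0" "S y ^ 2 = 1 + y\<^sup>2" "S (- y) = S y" for y
    unfolding S_def by (auto simp: add_pos_nonneg add_nonneg_eq_0_iff)
  have S1: "S y > 1" if "y \<noteq> 0" for y using that by (simp add: S_def)
  have [measurable]: "S \<in> borel_measurable borel" unfolding S_def by measurable
  define F where "F = (\<lambda>h. (1 / sqrt (h * (\<bar>h - c\<bar> + d))) ^ 3)"
  have [measurable]: "F \<in> borel_measurable borel" unfolding F_def by measurable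
  \<comment> \<open>the integrand after the substitution \<open>h = r / S y\<close>\<close>
  define f where "f = (\<lambda>h. h / (r * sqrt (r\<^sup>2 - h\<^sup>2)) * F h)"
  have [measurable]: "f \<in> borel_measurable borel" unfolding f_def by measurable
  let ?e = "\<lambda>y. ennreal (1 / S y ^ 3 * F (r / S y))"
  have S_deriv: "((\<lambda>t. r / S t) has_real_derivative - r * t / S t ^ 3) (at t)" for t
  proof -
    have "1 + t\<^sup>2 > 0" by (simp add: add_pos_nonneg)
    then have "(S has_real_derivative t / S t) (at t)"
      unfolding S_def by (auto intro!: derivative_eq_intros simp: field_simps)
    from DERIV_divide[OF DERIV_const this S(2), of r]
    show ?thesis using S(2)[of t] by (simp add: power3_eq_cube power2_eq_square field_simps)
  qed
  have contS: "continuous_on A S" for A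
    unfolding S_def by (intro continuous_intros)
  let ?B = "ennreal (1 / (r * sqrt r)) * ennreal (sqrt (2 / r) * (12 / d))"
  have fle: "ennreal (f h) * indicator {0<..<r} h \<le> ennreal (1 / (r * sqrt r)) *
      (ennreal (1 / (sqrt h * sqrt (r - h)) * (1 / sqrt (\<bar>h - c\<bar> + d) ^ 3)) * indicator {0<..<r} h)" for h
  proof (cases "0 < h \<and> h < r")
    case True
    let ?Y = "\<bar>h - c\<bar> + d"
    have sq: "sqrt (r\<^sup>2 - h\<^sup>2) = sqrt (r - h) * sqrt (r + h)"
      by (simp add: real_sqrt_mult[symmetric] power2_eq_square algebra_simps)
    have Yp: "?Y > 0" using d by simp
    have hs: "h = sqrt h * sqrt h" using True by simp
    have "h * (1 / sqrt h) ^ 3 = 1 / sqrt h"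
      by (subst hs) (use True in \<open>simp add: power3_eq_cube del: real_sqrt_mult_self\<close>)
    moreover have "F h = (1 / sqrt h) ^ 3 * (1 / sqrt ?Y ^ 3)"
      unfolding F_def real_sqrt_mult by (simp add: power_mult_distrib power_divide)
    ultimately have Fh: "h * F h = 1 / sqrt h * (1 / sqrt ?Y ^ 3)"
      by (metis mult.assoc)
    have "f h = (h * F h) * (1 / (r * sqrt (r + h))) * (1 / sqrt (r - h))"
      unfolding f_def sq by simp
    also have "\<dots> \<le> (h * F h) * (1 / (r * sqrt r)) * (1 / sqrt (r - h))"
    proof (intro mult_right_mono mult_left_mono divide_left_mono)
      show "0 \<le> h * F h" unfolding Fh using True Yp by simp
    qed (use True r in auto)
    also have "\<dots> = 1 / (r * sqrt r) * (1 / (sqrt h * sqrt (r - h)) * (1 / sqrt ?Y ^ 3))"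
      unfolding Fh by simp
    finally have "ennreal (f h) \<le> ennreal (1 / (r * sqrt r) * (1 / (sqrt h * sqrt (r - h)) * (1 / sqrt ?Y ^ 3)))"
      by (rule ennreal_leI)
    also have "\<dots> = ennreal (1 / (r * sqrt r)) * ennreal (1 / (sqrt h * sqrt (r - h)) * (1 / sqrt ?Y ^ 3))"
      using r True Yp by (intro ennreal_mult) auto
    finally show ?thesis using True by simp
  qed (auto split: split_indicator)
  have half: "(\<integral>\<^sup>+y. ?e y * indicator {0..} y \<partial>lborel) \<le> ?B"
  proof (rule nn_integral_atLeast_le)
    fix n :: nat
    \<comment> \<open>on negative \<open>y\<close> the map \<open>y \<mapsto> r / S y\<close> is increasing, as the substitution rule requires\<close>
    have "(\<integral>\<^sup>+y. ?e y * indicator {0..real n} y \<partial>lborel) = (\<integral>\<^sup>+y. ?e y * indicator {- real n..0} y \<partial>lborel)"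
      by (subst nn_integral_real_affine[where c = "-1" and t = 0])
        (auto intro!: nn_integral_cong simp: S split: split_indicator)
    also have "\<dots> = (\<integral>\<^sup>+t. ennreal (f (r / S t) * (- r * t / S t ^ 3) * indicator {- real n..0} t) \<partial>lborel)"
    proof (rule nn_integral_cong_AE)
      have eq: "?e t * indicator {- real n..0} t = ennreal (f (r / S t) * (- r * t / S t ^ 3) * indicator {- real n..0} t)" if "t \<noteq> 0" for t
      proof (cases "t < 0")
        case True
        have "r\<^sup>2 - (r / S t)\<^sup>2 = (r * t / S t)\<^sup>2"
        proof -
          have "1 + t\<^sup>2 \<noteq> 0" using S(2)[of t] S(3)[of t] by (metis power_not_zero)
          then show ?thesis
            unfolding power_divide power_mult_distrib S(3) by (simp add: field_simps)
        qed
        then have "sqrt (r\<^sup>2 - (r / S t)\<^sup>2) = r * (- t) / S t"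
          using True r S(1)[of t] by (simp add: abs_mult)
        then have "f (r / S t) * (- r * t / S t ^ 3) = 1 / S t ^ 3 * F (r / S t)"
          unfolding f_def using True r S(1)[of t] by (simp add: field_simps)
        then show ?thesis by (auto split: split_indicator)
      qed (use that in auto)
      show "AE t in lborel. ?e t * indicator {- real n..0} t = ennreal (f (r / S t) * (- r * t / S t ^ 3) * indicator {- real n..0} t)"
        using AE_lborel_singleton[of "0 :: real"] by eventually_elim (rule eq)
    qed
    also have "\<dots> = (\<integral>\<^sup>+h. ennreal (f h * indicator {r / S (- real n)..r / S 0} h) \<partial>lborel)"
    proof (rule nn_integral_substitution[symmetric])
      show "set_borel_measurable borel {r / S (- real n)..r / S 0} f"
        unfolding set_borel_measurable_def by measurable
      show "continuous_on {- real n..0} (\<lambda>t. - r * t / S t ^ 3)"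
        using S(2) by (intro continuous_intros contS) auto
      show "0 \<le> - r * t / S t ^ 3" if "t \<in> {- real n..0}" for t
        using that r S(1)[of t] by (auto intro!: divide_nonpos_pos mult_nonneg_nonpos)
    qed (use S_deriv in auto)
    also have "\<dots> \<le> (\<integral>\<^sup>+h. ennreal (f h) * indicator {0<..<r} h \<partial>lborel)"
    proof (rule nn_integral_mono_AE)
      have ends: "r / S (- real n) > 0" "r / S 0 = r" using r S(1) by (auto simp: S_def)
      show "AE h in lborel. ennreal (f h * indicator {r / S (- real n)..r / S 0} h) \<le> ennreal (f h) * indicator {0<..<r} h"
        using AE_lborel_singleton[of r] by eventually_elim (use ends in \<open>auto split: split_indicator\<close>)
    qed
    also have "\<dots> \<le> (\<integral>\<^sup>+h. ennreal (1 / (r * sqrt r)) *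
      (ennreal (1 / (sqrt h * sqrt (r - h)) * (1 / sqrt (\<bar>h - c\<bar> + d) ^ 3)) * indicator {0<..<r} h) \<partial>lborel)"
      by (intro nn_integral_mono fle)
    also have "\<dots> = ennreal (1 / (r * sqrt r)) * (\<integral>\<^sup>+h. 
      ennreal (1 / (sqrt h * sqrt (r - h)) * (1 / sqrt (\<bar>h - c\<bar> + d) ^ 3)) * indicator {0<..<r} h \<partial>lborel)"
      by (rule nn_integral_cmult) measurable
    also have "\<dots> \<le> ?B" by (intro mult_left_mono singular_integral_bound d r) simp
    finally show "(\<integral>\<^sup>+y. ?e y * indicator {0..real n} y \<partial>lborel) \<le> ?B" .
  qed measurable
  have "(\<integral>\<^sup>+y. ?e y \<partial>lborel) = (\<integral>\<^sup>+y. (?e y + ?e (- y)) * indicator {0<..} y \<partial>lborel)"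
    by (rule nn_integral_real_split) measurable
  also have "\<dots> \<le> (\<integral>\<^sup>+y. 2 * (?e y * indicator {0..} y) \<partial>lborel)"
    by (intro nn_integral_mono) (auto simp: S mult_2 split: split_indicator)
  also have "\<dots> = 2 * (\<integral>\<^sup>+y. ?e y * indicator {0..} y \<partial>lborel)"
    by (rule nn_integral_cmult) measurable
  also have "\<dots> \<le> 2 * ?B" by (intro mult_left_mono half) simp
  also have "\<dots> = ennreal (2 * (1 / (r * sqrt r) * (sqrt (2 / r) * (12 / d))))"
  proof -
    have "2 * (ennreal A * ennreal B) = ennreal (2 * (A * B))" if "0 \<le> A" "0 \<le> B" for A B :: real
      using that by (simp add: ennreal_mult)
    then show ?thesis by this (use r d in auto)
  qed
  also have "\<dots> \<le> ennreal (34 / (d * r\<^sup>2))"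
  proof (rule ennreal_leI)
    have "sqrt 2 \<le> 17 / 12" by (rule real_le_lsqrt) (auto simp: power2_eq_square)
    have "2 * (1 / (r * sqrt r) * (sqrt (2 / r) * (12 / d))) = sqrt 2 * (24 / (d * r\<^sup>2))"
      using r d by (simp add: real_sqrt_divide power2_eq_square field_simps)
    also have "\<dots> \<le> 17 / 12 * (24 / (d * r\<^sup>2))"
      using \<open>sqrt 2 \<le> 17 / 12\<close> r d by (intro mult_right_mono) auto
    finally show "2 * (1 / (r * sqrt r) * (sqrt (2 / r) * (12 / d))) \<le> 34 / (d * r\<^sup>2)" by simp
  qed
  finally show ?thesis unfolding S_def F_def .
qed

section \<open>Splitting a homogeneous kernel against a sixth power\<close>

lemma nn_integral_cauchy_density: "(\<integral>\<^sup>+w. ennreal (1 / (1 + w\<^sup>2)) \<partial>lborel) = ennreal pi"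
proof -
  have half: "(\<integral>\<^sup>+w. ennreal (1 / (1 + w\<^sup>2)) * indicator {0..} w \<partial>lborel) = ennreal (pi / 2 - arctan 0)"
    by (rule nn_integral_FTC_atLeast)
      (auto intro!: derivative_eq_intros tendsto_arctan_at_top simp: field_simps add_nonneg_eq_0_iff)
  have "(\<integral>\<^sup>+w. ennreal (1 / (1 + w\<^sup>2)) \<partial>lborel) =
    (\<integral>\<^sup>+w. (ennreal (1 / (1 + w\<^sup>2)) + ennreal (1 / (1 + (- w)\<^sup>2))) * indicator {0<..} w \<partial>lborel)"
    by (rule nn_integral_real_split) measurable
  also have "\<dots> = (\<integral>\<^sup>+w. 2 * (ennreal (1 / (1 + w\<^sup>2)) * indicator {0..} w) \<partial>lborel)"
  proof (rule nn_integral_cong_AE)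
    show "AE w in lborel. (ennreal (1 / (1 + w\<^sup>2)) + ennreal (1 / (1 + (- w)\<^sup>2))) * indicator {0<..} w =
      2 * (ennreal (1 / (1 + w\<^sup>2)) * indicator {0..} w)"
      using AE_lborel_singleton[of "0 :: real"] by eventually_elim (auto simp: mult_2 split: split_indicator)
  qed
  also have "\<dots> = 2 * ennreal (pi / 2)"
    by (subst nn_integral_cmult) (use half in auto)
  also have "\<dots> = ennreal pi"
    using ennreal_mult[of 2 "pi / 2"] by simp
  finally show ?thesis .
qed

lemma nn_integral_radial_profile:
  assumes c: "c > 0"
  shows "(\<integral>\<^sup>+p. ennreal (\<bar>p\<bar> / (1 + (c * p)\<^sup>2)\<^sup>2) \<partial>lborel) = ennreal (1 / c\<^sup>2)"
proof -
  have half: "(\<integral>\<^sup>+p. ennreal (p / (1 + (c * p)\<^sup>2)\<^sup>2) * indicator {0..} p \<partial>lborel) =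
    ennreal (0 - (- 1 / (2 * c\<^sup>2 * (1 + (c * 0)\<^sup>2))))"
  proof (rule nn_integral_FTC_atLeast)
    fix p :: real assume "0 \<le> p"
    have nz: "1 + (c * p)\<^sup>2 \<noteq> 0" by (metis add_nonneg_eq_0_iff zero_le_power2 zero_le_one one_neq_zero)
    then show "((\<lambda>p. - 1 / (2 * c\<^sup>2 * (1 + (c * p)\<^sup>2))) has_real_derivative p / (1 + (c * p)\<^sup>2)\<^sup>2) (at p)"
      using c by (auto intro!: derivative_eq_intros simp: power2_eq_square divide_simps)
    show "0 \<le> p / (1 + (c * p)\<^sup>2)\<^sup>2" using \<open>0 \<le> p\<close> by simp
  next
    have "filterlim (\<lambda>p. 2 * c\<^sup>2 * (1 + (c * p)\<^sup>2)) at_top at_top"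
      using c by (intro filterlim_tendsto_pos_mult_at_top[OF tendsto_const] filterlim_tendsto_add_at_top[OF tendsto_const]
          filterlim_pow_at_top filterlim_ident) auto
    then show "((\<lambda>p. - 1 / (2 * c\<^sup>2 * (1 + (c * p)\<^sup>2))) \<longlongrightarrow> 0) at_top"
      by (intro tendsto_divide_0[OF tendsto_const] filterlim_at_top_imp_at_infinity)
  qed measurable
  have "(\<integral>\<^sup>+p. ennreal (\<bar>p\<bar> / (1 + (c * p)\<^sup>2)\<^sup>2) \<partial>lborel) =
    (\<integral>\<^sup>+p. (ennreal (\<bar>p\<bar> / (1 + (c * p)\<^sup>2)\<^sup>2) + ennreal (\<bar>- p\<bar> / (1 + (c * - p)\<^sup>2)\<^sup>2)) * indicator {0<..} p \<partial>lborel)"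
    by (rule nn_integral_real_split) measurable
  also have "\<dots> = (\<integral>\<^sup>+p. 2 * (ennreal (p / (1 + (c * p)\<^sup>2)\<^sup>2) * indicator {0..} p) \<partial>lborel)"
  proof (rule nn_integral_cong_AE)
    show "AE p in lborel. (ennreal (\<bar>p\<bar> / (1 + (c * p)\<^sup>2)\<^sup>2) + ennreal (\<bar>- p\<bar> / (1 + (c * - p)\<^sup>2)\<^sup>2)) * indicator {0<..} p =
      2 * (ennreal (p / (1 + (c * p)\<^sup>2)\<^sup>2) * indicator {0..} p)"
      using AE_lborel_singleton[of "0 :: real"] by eventually_elim (auto simp: mult_2 split: split_indicator)
  qed
  also have "\<dots> = 2 * ennreal (1 / (2 * c\<^sup>2))"
    by (subst nn_integral_cmult) (use half in auto)
  also have "\<dots> = ennreal (1 / c\<^sup>2)"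
    using ennreal_mult[of 2 "1 / (2 * c\<^sup>2)"] by simp
  finally show ?thesis .
qed

text \<open>
  This dominates \<open>k * T ^ 5 * min 1 (k / m) ^ 4\<close> and has an elementary integral when \<open>k\<close> is
  proportional to \<open>1 / \<bar>p\<bar>\<close>.
\<close>

definition young_majorant :: "real \<Rightarrow> real \<Rightarrow> real \<Rightarrow> real" where
  "young_majorant m T k = 4 * k * T ^ 5 / (1 + (m / k)\<^sup>2)\<^sup>2"

text \<open>
  If \<open>k \<le> l * T * \<phi>\<close>, the first summand suffices. Otherwise \<open>\<phi> < k / (l * T)\<close>, which together with
  \<open>\<phi> \<le> T\<close> says that \<open>\<phi> \<le> T * min 1 (k / (l * T\<^sup>2))\<close>. This is Young's inequality adapted to a kernel
  that is in weak \<open>L\<^sup>3\<close> only, and it replaces the layer cake decomposition in the proof of the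
  Hardy-Littlewood-Sobolev inequality.
\<close>

lemma young_split:
  assumes k: "k \<ge> 0" and \<phi>: "0 \<le> \<phi>" "\<phi> \<le> T" and l: "l > 0" and T: "T > 0"
  shows "\<phi> ^ 5 * k \<le> l * T * \<phi> ^ 6 + young_majorant (l * T\<^sup>2) T k"
proof (cases "k \<le> l * T * \<phi>")
  case True
  then have "\<phi> ^ 5 * k \<le> \<phi> ^ 5 * (l * T * \<phi>)" using \<phi> by (intro mult_left_mono) auto
  also have "\<dots> = l * T * \<phi> ^ 6" by (simp add: eval_nat_numeral)
  finally show ?thesis using k T unfolding young_majorant_def
    by (smt (verit) divide_nonneg_nonneg mult_nonneg_nonneg zero_le_power zero_le_power2)
next
  case False
  then have k0: "k > 0" using k l T \<phi> by (smt (verit) mult_nonneg_nonneg)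
  define q where "q = l * T\<^sup>2 / k"
  have q0: "q > 0" using l T k0 by (simp add: q_def)
  have nn: "0 \<le> l * T * \<phi> ^ 6" using l T \<phi> by simp
  have "\<phi> * q \<le> T"
  proof -
    have "(l * T * \<phi>) * T \<le> k * T" using False T by (intro mult_right_mono) auto
    then show ?thesis using k0 by (simp add: q_def field_simps power2_eq_square)
  qed
  have "\<phi>\<^sup>2 * (1 + q\<^sup>2) \<le> 2 * T\<^sup>2"
  proof -
    have "(\<phi> * q)\<^sup>2 \<le> T\<^sup>2" using \<open>\<phi> * q \<le> T\<close> \<phi> q0 by (intro power_mono) auto
    moreover have "\<phi>\<^sup>2 \<le> T\<^sup>2" using \<phi> by (intro power_mono) auto
    ultimately show ?thesis by (simp add: power_mult_distrib distrib_left)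
  qed
  then have "(\<phi>\<^sup>2 * (1 + q\<^sup>2))\<^sup>2 \<le> (2 * T\<^sup>2)\<^sup>2" using \<phi> by (intro power_mono) auto
  then have "\<phi> * (\<phi>\<^sup>2 * (1 + q\<^sup>2))\<^sup>2 \<le> T * (2 * T\<^sup>2)\<^sup>2" using \<phi> T by (intro mult_mono) auto
  then have "\<phi> ^ 5 * (1 + q\<^sup>2)\<^sup>2 \<le> 4 * T ^ 5"
    by (simp add: power_mult_distrib eval_nat_numeral algebra_simps)
  moreover have "(1 + q\<^sup>2)\<^sup>2 > 0" by (smt (verit) zero_le_power2 zero_less_power2)
  ultimately have "\<phi> ^ 5 \<le> 4 * T ^ 5 / (1 + q\<^sup>2)\<^sup>2" by (simp add: pos_le_divide_eq)
  then have "\<phi> ^ 5 * k \<le> 4 * T ^ 5 / (1 + q\<^sup>2)\<^sup>2 * k" using k by (intro mult_right_mono) auto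
  then show ?thesis using nn unfolding young_majorant_def q_def by (simp add: mult_ac)
qed

text \<open>
  The power \<open>m ^ 3\<close> is forced by scaling, \<open>p\<^sup>2\<close> being the radial density of three-space.
\<close>

lemma young_majorant_radial:
  assumes m0: "m \<ge> 0" and T: "T > 0" and l: "l > 0"
  shows "(\<integral>\<^sup>+p. ennreal (p\<^sup>2 * young_majorant (l * T\<^sup>2) T (m / \<bar>p\<bar>)) \<partial>lborel) = ennreal (4 * T / l\<^sup>2 * m ^ 3)"
proof (cases "m = 0")
  case False
  then have m: "m > 0" using m0 by simp
  define c where "c = l * T\<^sup>2 / m"
  have c: "c > 0" unfolding c_def using m l T by simp
  have eq: "p\<^sup>2 * young_majorant (l * T\<^sup>2) T (m / \<bar>p\<bar>) = 4 * m * T ^ 5 * (\<bar>p\<bar> / (1 + (c * p)\<^sup>2)\<^sup>2)" for p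
  proof (cases "p = 0")
    case p: False
    have sq: "(l * T\<^sup>2 / (m / \<bar>p\<bar>))\<^sup>2 = (c * p)\<^sup>2"
      unfolding c_def by (simp add: power_mult_distrib power_divide)
    have pp: "p\<^sup>2 * (m / \<bar>p\<bar>) = m * \<bar>p\<bar>"
      using p by (cases "p > 0") (simp_all add: power2_eq_square)
    have "p\<^sup>2 * young_majorant (l * T\<^sup>2) T (m / \<bar>p\<bar>) = 4 * (p\<^sup>2 * (m / \<bar>p\<bar>)) * T ^ 5 / (1 + (c * p)\<^sup>2)\<^sup>2"
      unfolding young_majorant_def sq by simp
    then show ?thesis unfolding pp by simp
  qed (simp add: young_majorant_def)
  have "(\<integral>\<^sup>+p. ennreal (p\<^sup>2 * young_majorant (l * T\<^sup>2) T (m / \<bar>p\<bar>)) \<partial>lborel) =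
    (\<integral>\<^sup>+p. ennreal (4 * m * T ^ 5) * ennreal (\<bar>p\<bar> / (1 + (c * p)\<^sup>2)\<^sup>2) \<partial>lborel)"
    unfolding eq using m T by (intro nn_integral_cong ennreal_mult) auto
  also have "\<dots> = ennreal (4 * m * T ^ 5) * ennreal (1 / c\<^sup>2)"
    by (subst nn_integral_cmult) (simp_all only: nn_integral_radial_profile[OF c], measurable)
  also have "\<dots> = ennreal (4 * m * T ^ 5 * (1 / c\<^sup>2))"
    using m T by (intro ennreal_mult[symmetric]) auto
  also have "4 * m * T ^ 5 * (1 / c\<^sup>2) = 4 * T / l\<^sup>2 * m ^ 3"
  proof -
    have "c\<^sup>2 = l\<^sup>2 * T ^ 4 / m\<^sup>2" unfolding c_def by (simp add: power_mult_distrib power_divide)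
    moreover have "T ^ 5 = T ^ 4 * T" "m ^ 3 = m\<^sup>2 * m" by (simp_all add: eval_nat_numeral)
    ultimately show ?thesis using T m by simp
  qed
  finally show ?thesis .
qed (simp add: young_majorant_def)

text \<open>
  In the chart \<open>z = (p, p * w, p * v)\<close> the direction of \<open>z\<close> is independent of \<open>p\<close>, so that it serves
  as polar coordinates whose only ingredients are affine substitutions.
\<close>

lemma nn_integral_cone:
  fixes \<Psi> :: "real ^ 3 \<Rightarrow> ennreal"
  assumes [measurable]: "\<Psi> \<in> borel_measurable borel"
  shows "(\<integral>\<^sup>+z. \<Psi> z \<partial>lborel) = (\<integral>\<^sup>+w. \<integral>\<^sup>+v. \<integral>\<^sup>+p. ennreal (p\<^sup>2) * \<Psi> (vector [p, p * w, p * v]) \<partial>lborel \<partial>lborel \<partial>lborel)"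
proof -
  have "(\<integral>\<^sup>+z. \<Psi> z \<partial>lborel) = (\<integral>\<^sup>+p. \<integral>\<^sup>+y. \<integral>\<^sup>+z. \<Psi> (vector [p, y, z]) \<partial>lborel \<partial>lborel \<partial>lborel)"
    by (rule nn_integral_vec3) measurable
  also have "\<dots> = (\<integral>\<^sup>+p. \<integral>\<^sup>+w. \<integral>\<^sup>+v. ennreal (p\<^sup>2) * \<Psi> (vector [p, p * w, p * v]) \<partial>lborel \<partial>lborel \<partial>lborel)"
    using AE_lborel_singleton[of "0 :: real"]
  proof (intro nn_integral_cong_AE, eventually_elim)
    fix p :: real assume p: "p \<noteq> 0"
    have "(\<integral>\<^sup>+y. \<integral>\<^sup>+z. \<Psi> (vector [p, y, z]) \<partial>lborel \<partial>lborel) =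
       (\<integral>\<^sup>+y. ennreal \<bar>p\<bar> * (\<integral>\<^sup>+v. \<Psi> (vector [p, y, 0 + p * v]) \<partial>lborel) \<partial>lborel)"
      by (intro nn_integral_cong nn_integral_real_affine p) measurable
    also have "\<dots> = ennreal \<bar>p\<bar> * (\<integral>\<^sup>+y. (\<integral>\<^sup>+v. \<Psi> (vector [p, y, 0 + p * v]) \<partial>lborel) \<partial>lborel)"
      by (rule nn_integral_cmult) measurable
    also have "\<dots> = ennreal \<bar>p\<bar> * (ennreal \<bar>p\<bar> * (\<integral>\<^sup>+w. (\<integral>\<^sup>+v. \<Psi> (vector [p, 0 + p * w, 0 + p * v]) \<partial>lborel) \<partial>lborel))"
      by (subst nn_integral_real_affine[where c = p and t = 0]) (measurable, use p in auto)
    also have "\<dots> = ennreal (p\<^sup>2) * (\<integral>\<^sup>+w. \<integral>\<^sup>+v. \<Psi> (vector [p, p * w, p * v]) \<partial>lborel \<partial>lborel)"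
      by (simp add: mult.assoc[symmetric] ennreal_mult[symmetric] power2_eq_square)
    also have "\<dots> = (\<integral>\<^sup>+w. \<integral>\<^sup>+v. ennreal (p\<^sup>2) * \<Psi> (vector [p, p * w, p * v]) \<partial>lborel \<partial>lborel)"
      by (simp add: nn_integral_cmult)
    finally show "(\<integral>\<^sup>+y. \<integral>\<^sup>+z. \<Psi> (vector [p, y, z]) \<partial>lborel \<partial>lborel) =
      (\<integral>\<^sup>+w. \<integral>\<^sup>+v. ennreal (p\<^sup>2) * \<Psi> (vector [p, p * w, p * v]) \<partial>lborel \<partial>lborel)" .
  qed
  also have "\<dots> = (\<integral>\<^sup>+w. \<integral>\<^sup>+p. \<integral>\<^sup>+v. ennreal (p\<^sup>2) * \<Psi> (vector [p, p * w, p * v]) \<partial>lborel \<partial>lborel \<partial>lborel)"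
    by (rule lborel_Fubini) measurable
  also have "\<dots> = (\<integral>\<^sup>+w. \<integral>\<^sup>+v. \<integral>\<^sup>+p. ennreal (p\<^sup>2) * \<Psi> (vector [p, p * w, p * v]) \<partial>lborel \<partial>lborel \<partial>lborel)"
    by (intro nn_integral_cong lborel_Fubini) measurable
  finally show ?thesis .
qed

text \<open>
  The kernel \<open>\<beta> (dist_line x z) / norm z\<close> is homogeneous of degree \<open>-1\<close> in \<open>z\<close>, so that the radial
  integral produces the cube of its angular part. After a rotation \<open>x\<close> points along the third axis.
  With \<open>v = sqrt (1 + w\<^sup>2) * y\<close> the distance becomes \<open>norm x / sqrt (1 + y\<^sup>2)\<close>, which is independent of
  \<open>w\<close>, and the integral over \<open>w\<close> is that of \<open>1 / (1 + w\<^sup>2)\<close>.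
\<close>

lemma young_integral:
  fixes \<beta> :: "real \<Rightarrow> real" and x :: "real ^ 3"
  assumes [measurable]: "\<beta> \<in> borel_measurable borel" and \<beta>: "\<And>h. \<beta> h \<ge> 0"
    and T: "T > 0" and l: "l > 0"
  shows "(\<integral>\<^sup>+z. ennreal (young_majorant (l * T\<^sup>2) T (\<beta> (dist_line x z) / norm z)) \<partial>lborel)
    = ennreal (4 * pi * T / l\<^sup>2) * (\<integral>\<^sup>+y. ennreal (1 / sqrt (1 + y\<^sup>2) ^ 3 * \<beta> (norm x / sqrt (1 + y\<^sup>2)) ^ 3) \<partial>lborel)"
proof -
  define S where "S = (\<lambda>y :: real. sqrt (1 + y\<^sup>2))"
  have S: "S y > 0" "S y \<noteq> 0" "S y ^ 2 = 1 + y\<^sup>2" "S y * S y = 1 + y\<^sup>2" for y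
    unfolding S_def by (auto simp: add_pos_nonneg add_nonneg_eq_0_iff)
  have Sw: "sqrt (1 + w\<^sup>2) = S w" for w by (simp add: S_def)
  have [measurable]: "S \<in> borel_measurable borel" unfolding S_def by measurable
  define A where "A = (\<lambda>y. 1 / S y ^ 3 * \<beta> (norm x / S y) ^ 3)"
  have A0: "A y \<ge> 0" for y unfolding A_def using S(1)[of y] \<beta> by simp
  have [measurable]: "A \<in> borel_measurable borel" unfolding A_def by measurable
  define \<Theta> where "\<Theta> = (\<lambda>z. ennreal (young_majorant (l * T\<^sup>2) T (\<beta> (dist_line x z) / norm z)))"
  have [measurable]: "\<Theta> \<in> borel_measurable borel" unfolding \<Theta>_def young_majorant_def by measurable
  have "norm (norm x *\<^sub>R axis 3 1 :: real ^ 3) = norm x" by simp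
  then obtain Q :: "real ^ 3 \<Rightarrow> real ^ 3" where Q: "orthogonal_transformation Q" "Q (norm x *\<^sub>R axis 3 1) = x"
    using orthogonal_transformation_exists by metis
  have Qn: "norm (Q z) = norm z" for z using Q(1) by (simp add: orthogonal_transformation_norm)
  have Qx: "x \<bullet> Q z = norm x * z $ 3" for z
  proof -
    have "x \<bullet> Q z = (norm x *\<^sub>R axis 3 1) \<bullet> z"
      using Q by (metis orthogonal_transformation_def)
    then show ?thesis by (simp add: inner_axis')
  qed
  have dist: "dist_line x (Q (vector [p, p * w, p * (S w * y)])) = norm x / S y"
    "norm (Q (vector [p, p * w, p * (S w * y)])) = \<bar>p\<bar> * (S w * S y)" if "p \<noteq> 0" for p w y
  proof -
    have "p\<^sup>2 + (p * w)\<^sup>2 + (p * (S w * y))\<^sup>2 = (p * (S w * S y))\<^sup>2"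
      unfolding power_mult_distrib S by (simp add: algebra_simps)
    then show n: "norm (Q (vector [p, p * w, p * (S w * y)])) = \<bar>p\<bar> * (S w * S y)"
      unfolding Qn unfolding vec3_norm vector_3 using S(1)[of w] S(1)[of y] by (simp add: abs_mult)
    have "(norm x)\<^sup>2 - (norm x * (p * (S w * y)))\<^sup>2 / (\<bar>p\<bar> * (S w * S y))\<^sup>2 = (norm x / S y)\<^sup>2"
    proof -
      have "(norm x * (p * (S w * y)))\<^sup>2 / (\<bar>p\<bar> * (S w * S y))\<^sup>2 = (norm x)\<^sup>2 * y\<^sup>2 / (S y)\<^sup>2"
        using that S(2)[of w] S(2)[of y] by (simp add: power_mult_distrib)
      moreover have "(S y)\<^sup>2 \<noteq> 0" using S(2) by simp
      ultimately show ?thesis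
        using S(3)[of y] by (simp add: power_divide field_simps)
    qed
    then show "dist_line x (Q (vector [p, p * w, p * (S w * y)])) = norm x / S y"
      unfolding dist_line_def n Qx vector_3 using S(1)[of y] by simp
  qed
  have inner: "(\<integral>\<^sup>+p. ennreal (p\<^sup>2) * \<Theta> (Q (vector [p, p * w, p * (S w * y)])) \<partial>lborel) =
     ennreal (4 * T / l\<^sup>2) * (ennreal (1 / S w ^ 3) * ennreal (A y))" for w y
  proof -
    define m where "m = \<beta> (norm x / S y) / (S w * S y)"
    have m0: "m \<ge> 0" unfolding m_def using \<beta> S(1)[of w] S(1)[of y] by simp
    have A: "m ^ 3 = 1 / S w ^ 3 * A y"
      unfolding m_def A_def by (simp add: power_divide power_mult_distrib)
    have step: "ennreal (p\<^sup>2) * \<Theta> (Q (vector [p, p * w, p * (S w * y)])) =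
        ennreal (p\<^sup>2 * young_majorant (l * T\<^sup>2) T (m / \<bar>p\<bar>))" if "p \<noteq> 0" for p
      unfolding \<Theta>_def dist[OF that] m_def
      by (subst ennreal_mult'[symmetric]) (auto simp: mult_ac)
    have "(\<integral>\<^sup>+p. ennreal (p\<^sup>2) * \<Theta> (Q (vector [p, p * w, p * (S w * y)])) \<partial>lborel) =
      (\<integral>\<^sup>+p. ennreal (p\<^sup>2 * young_majorant (l * T\<^sup>2) T (m / \<bar>p\<bar>)) \<partial>lborel)"
    proof (rule nn_integral_cong_AE)
      show "AE p in lborel. ennreal (p\<^sup>2) * \<Theta> (Q (vector [p, p * w, p * (S w * y)])) =
        ennreal (p\<^sup>2 * young_majorant (l * T\<^sup>2) T (m / \<bar>p\<bar>))"
        using AE_lborel_singleton[of "0 :: real"] by eventually_elim (rule step)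
    qed
    also have "\<dots> = ennreal (4 * T / l\<^sup>2 * m ^ 3)"
      by (rule young_majorant_radial[OF m0 T l])
    also have "\<dots> = ennreal (4 * T / l\<^sup>2) * (ennreal (1 / S w ^ 3) * ennreal (A y))"
    proof -
      have "ennreal (u * (v * k)) = ennreal u * (ennreal v * ennreal k)" if "0 \<le> u" "0 \<le> v" "0 \<le> k" for u v k :: real
        using that by (simp add: ennreal_mult)
      then show ?thesis unfolding A by this (use T S(1)[of w] A0[of y] in auto)
    qed
    finally show ?thesis .
  qed
  have [measurable]: "Q \<in> borel_measurable borel"
    using Q(1) by (intro borel_measurable_continuous_onI linear_continuous_on linear_conv_bounded_linear[THEN iffD1] orthogonal_transformation_linear)
  have "(\<integral>\<^sup>+z. \<Theta> z \<partial>lborel) = (\<integral>\<^sup>+z. \<Theta> (Q z) \<partial>lborel)"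
    by (rule nn_integral_orthogonal[OF Q(1), symmetric]) measurable
  also have "\<dots> = (\<integral>\<^sup>+w. \<integral>\<^sup>+v. \<integral>\<^sup>+p. ennreal (p\<^sup>2) * \<Theta> (Q (vector [p, p * w, p * v])) \<partial>lborel \<partial>lborel \<partial>lborel)"
    by (rule nn_integral_cone) measurable
  also have "\<dots> = (\<integral>\<^sup>+w. ennreal \<bar>S w\<bar> * (\<integral>\<^sup>+y. \<integral>\<^sup>+p. ennreal (p\<^sup>2) * \<Theta> (Q (vector [p, p * w, p * (0 + S w * y)])) \<partial>lborel \<partial>lborel) \<partial>lborel)"
    by (intro nn_integral_cong nn_integral_real_affine S) measurable
  also have "\<dots> = (\<integral>\<^sup>+w. ennreal (S w) * (\<integral>\<^sup>+y. ennreal (4 * T / l\<^sup>2) * (ennreal (1 / S w ^ 3) * ennreal (A y)) \<partial>lborel) \<partial>lborel)"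
    using S(1) by (simp add: inner abs_of_pos)
  also have "\<dots> = (\<integral>\<^sup>+w. (ennreal (4 * T / l\<^sup>2) * (\<integral>\<^sup>+y. ennreal (A y) \<partial>lborel)) * ennreal (1 / (1 + w\<^sup>2)) \<partial>lborel)"
  proof (rule nn_integral_cong)
    fix w
    have 1: "ennreal (S w) * ennreal (1 / S w ^ 3) = ennreal (1 / (1 + w\<^sup>2))"
      unfolding S(3)[symmetric] using S(1)[of w]
      by (simp add: ennreal_mult[symmetric] power3_eq_cube power2_eq_square)
    have 2: "(\<integral>\<^sup>+y. ennreal (4 * T / l\<^sup>2) * (ennreal (1 / S w ^ 3) * ennreal (A y)) \<partial>lborel) =
        ennreal (4 * T / l\<^sup>2) * (ennreal (1 / S w ^ 3) * (\<integral>\<^sup>+y. ennreal (A y) \<partial>lborel))"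
      by (simp add: nn_integral_cmult)
    show "ennreal (S w) * (\<integral>\<^sup>+y. ennreal (4 * T / l\<^sup>2) * (ennreal (1 / S w ^ 3) * ennreal (A y)) \<partial>lborel) =
       (ennreal (4 * T / l\<^sup>2) * (\<integral>\<^sup>+y. ennreal (A y) \<partial>lborel)) * ennreal (1 / (1 + w\<^sup>2))"
      unfolding 1[symmetric] 2 by (simp only: mult_ac)
  qed
  also have "\<dots> = (ennreal (4 * T / l\<^sup>2) * (\<integral>\<^sup>+y. ennreal (A y) \<partial>lborel)) * ennreal pi"
    by (subst nn_integral_cmult) (auto simp: nn_integral_cauchy_density)
  also have "\<dots> = (ennreal pi * ennreal (4 * T / l\<^sup>2)) * (\<integral>\<^sup>+y. ennreal (A y) \<partial>lborel)"
    by (simp only: mult_ac)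
  also have "ennreal pi * ennreal (4 * T / l\<^sup>2) = ennreal (4 * pi * T / l\<^sup>2)"
    using T by (subst ennreal_mult[symmetric]) (auto simp: mult_ac)
  finally show ?thesis unfolding \<Theta>_def A_def Sw .
qed

section \<open>The estimate for the truncated dual operator\<close>

text \<open>
  For \<open>h \<le> 0\<close> the formula in terms of square roots would give \<open>0\<close> at \<open>h = 0\<close> by the convention on
  division; the constant \<open>8\<close> exceeds the length \<open>2 * pi\<close> of the whole circle.
\<close>

definition kernel_bound :: "real \<Rightarrow> real \<Rightarrow> real \<Rightarrow> real" where
  "kernel_bound a b h = (if h \<le> 0 then 8 else
     28 * (b - a) / sqrt (h * (\<bar>h - b\<bar> + (b - a))) + 28 * (b - a) / sqrt (h * (\<bar>h - (- a)\<bar> + (b - a))))"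

lemma kernel_bound_nonneg: "a < b \<Longrightarrow> 0 \<le> kernel_bound a b h"
  unfolding kernel_bound_def by (auto intro!: add_nonneg_nonneg divide_nonneg_nonneg)

lemma measurable_kernel_bound [measurable]: "kernel_bound a b \<in> borel_measurable borel"
  unfolding kernel_bound_def[abs_def] by measurable

lemma arc_length_le_pi: "arc_length a b h \<le> ennreal pi"
proof -
  have "arc_length a b h \<le> (\<integral>\<^sup>+w. ennreal (1 / (1 + w\<^sup>2)) \<partial>lborel)"
    unfolding arc_length_def by (intro nn_integral_mono) (auto split: split_indicator)
  then show ?thesis by (simp add: nn_integral_cauchy_density)
qed

lemma arc_length_reflect: "arc_length a b (- h) = arc_length (- b) (- a) h"
  unfolding arc_length_def by (intro nn_integral_cong) (auto split: split_indicator)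

lemma arc_length_sum_le:
  assumes ab: "a < b"
  shows "arc_length a b h + arc_length a b (- h) \<le> ennreal (kernel_bound a b h)"
proof (cases "h \<le> 0")
  case True
  have "arc_length a b h + arc_length a b (- h) \<le> ennreal pi + ennreal pi"
    by (intro add_mono arc_length_le_pi)
  also have "\<dots> = ennreal (pi + pi)" by (rule ennreal_plus[symmetric]) auto
  also have "\<dots> \<le> ennreal 8" using pi_less_4 by (intro ennreal_leI) linarith
  finally show ?thesis using True by (simp add: kernel_bound_def)
next
  case False
  then have h: "h > 0" by simp
  have "arc_length a b h + arc_length a b (- h) \<le>
    ennreal (28 * (b - a) / sqrt (h * (\<bar>h - b\<bar> + (b - a)))) + ennreal (28 * (- a - - b) / sqrt (h * (\<bar>h - (- a)\<bar> + (- a - - b))))"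
    unfolding arc_length_reflect using ab by (intro add_mono arc_length_bound h) auto
  also have "\<dots> = ennreal (kernel_bound a b h)"
    unfolding kernel_bound_def using h ab by (subst ennreal_plus[symmetric]) auto
  finally show ?thesis .
qed

lemma cube_sum_le: "0 \<le> u \<Longrightarrow> 0 \<le> v \<Longrightarrow> (u + v) ^ 3 \<le> 4 * (u ^ 3 + v ^ 3)" for u v :: real
proof -
  assume "0 \<le> u" "0 \<le> v"
  then have "0 \<le> 3 * (u + v) * (u - v)\<^sup>2" by simp
  also have "\<dots> = 4 * (u ^ 3 + v ^ 3) - (u + v) ^ 3"
    by (simp add: power3_eq_cube power2_eq_square algebra_simps)
  finally show ?thesis by simp
qed

text \<open>
  This is the gain from the localization. For an angular part bounded by a constant, as it is for the
  operator without cutoff, the integral is of order \<open>1\<close>.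
\<close>

lemma angular_integral:
  assumes ab: "a < b" and r: "r > 0"
  shows "(\<integral>\<^sup>+y. ennreal (1 / sqrt (1 + y\<^sup>2) ^ 3 * kernel_bound a b (r / sqrt (1 + y\<^sup>2)) ^ 3) \<partial>lborel)
    \<le> ennreal (272 * 28 ^ 3 * ((b - a)\<^sup>2 / r\<^sup>2))"
proof -
  let ?d = "b - a"
  let ?S = "\<lambda>y :: real. sqrt (1 + y\<^sup>2)"
  let ?I = "\<lambda>c y. 1 / ?S y ^ 3 * (1 / sqrt (r / ?S y * (\<bar>r / ?S y - c\<bar> + ?d))) ^ 3"
  have d: "?d > 0" using ab by simp
  have S: "?S y > 0" for y by (simp add: add_pos_nonneg)
  have I0: "?I c y \<ge> 0" for c y using d r S[of y] by simp
  have "1 / ?S y ^ 3 * kernel_bound a b (r / ?S y) ^ 3 \<le> (4 * (28 * ?d) ^ 3) * (?I b y + ?I (- a) y)" for y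
  proof -
    have h: "r / ?S y > 0" using r S[of y] by simp
    let ?u = "\<lambda>c. 28 * ?d * (1 / sqrt (r / ?S y * (\<bar>r / ?S y - c\<bar> + ?d)))"
    have "kernel_bound a b (r / ?S y) ^ 3 = (?u b + ?u (- a)) ^ 3"
      using h by (simp add: kernel_bound_def)
    also have "\<dots> \<le> 4 * (?u b ^ 3 + ?u (- a) ^ 3)"
      using d h r by (intro cube_sum_le mult_nonneg_nonneg divide_nonneg_nonneg real_sqrt_ge_zero add_nonneg_nonneg) auto
    finally have "1 / ?S y ^ 3 * kernel_bound a b (r / ?S y) ^ 3 \<le> 1 / ?S y ^ 3 * (4 * (?u b ^ 3 + ?u (- a) ^ 3))"
      using S[of y] by (intro mult_left_mono) auto
    also have "\<dots> = (4 * (28 * ?d) ^ 3) * (?I b y + ?I (- a) y)"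
      unfolding power_mult_distrib[of "28 * ?d"] by (simp only: distrib_left mult_ac)
    finally show ?thesis .
  qed
  then have "(\<integral>\<^sup>+y. ennreal (1 / ?S y ^ 3 * kernel_bound a b (r / ?S y) ^ 3) \<partial>lborel) \<le>
    (\<integral>\<^sup>+y. ennreal (4 * (28 * ?d) ^ 3) * (ennreal (?I b y) + ennreal (?I (- a) y)) \<partial>lborel)"
    using I0 d by (intro nn_integral_mono) (simp only: ennreal_plus[symmetric] ennreal_mult[symmetric] ennreal_leI
      add_nonneg_nonneg mult_nonneg_nonneg zero_le_power zero_le_numeral less_imp_le)
  also have "\<dots> = ennreal (4 * (28 * ?d) ^ 3) * ((\<integral>\<^sup>+y. ennreal (?I b y) \<partial>lborel) + (\<integral>\<^sup>+y. ennreal (?I (- a) y) \<partial>lborel))"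
  proof -
    have sum: "(\<integral>\<^sup>+y. ennreal (?I b y) \<partial>lborel) + (\<integral>\<^sup>+y. ennreal (?I (- a) y) \<partial>lborel) =
      (\<integral>\<^sup>+y. ennreal (?I b y) + ennreal (?I (- a) y) \<partial>lborel)"
      by (rule nn_integral_add[symmetric]) measurable
    show ?thesis unfolding sum by (rule nn_integral_cmult) measurable
  qed
  also have "\<dots> \<le> ennreal (4 * (28 * ?d) ^ 3) * (ennreal (34 / (?d * r\<^sup>2)) + ennreal (34 / (?d * r\<^sup>2)))"
    by (intro mult_left_mono add_mono angular_integral_one d r) auto
  also have "\<dots> = ennreal (4 * (28 * ?d) ^ 3 * (34 / (?d * r\<^sup>2) + 34 / (?d * r\<^sup>2)))"
    using d r by (simp only: ennreal_plus[symmetric] ennreal_mult[symmetric] add_nonneg_nonneg mult_nonneg_nonneg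
      divide_nonneg_nonneg zero_le_power zero_le_numeral less_imp_le zero_le_power2)
  also have "4 * (28 * ?d) ^ 3 * (34 / (?d * r\<^sup>2) + 34 / (?d * r\<^sup>2)) = 272 * 28 ^ 3 * (?d\<^sup>2 / r\<^sup>2)"
  proof -
    have "4 * (28 * d) ^ 3 * (34 / (d * r\<^sup>2) + 34 / (d * r\<^sup>2)) = 272 * 28 ^ 3 * (d\<^sup>2 / r\<^sup>2)" if "d > 0" for d :: real
      using that r by (simp add: power3_eq_cube power2_eq_square field_simps)
    from this[OF d] show ?thesis .
  qed
  finally show ?thesis .
qed

lemma young_majorant_nonneg: "0 \<le> k \<Longrightarrow> 0 < T \<Longrightarrow> 0 \<le> young_majorant m T k"
  unfolding young_majorant_def by (intro divide_nonneg_nonneg mult_nonneg_nonneg) auto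

text \<open>
  The Hardy-Littlewood-Sobolev estimate with one variable \<open>x\<close> fixed. The restriction \<open>\<phi> y \<le> T\<close> allows
  the splitting of \<open>\<phi> y ^ 5\<close> times the kernel into a multiple of \<open>\<phi> y ^ 6\<close> and a quantity
  independent of \<open>\<phi>\<close>; it will be applied with \<open>T = \<phi> x\<close>.
\<close>

lemma dual_operator_bound:
  fixes \<phi> :: "real ^ 3 \<Rightarrow> real" and x :: "real ^ 3"
  assumes [measurable]: "\<phi> \<in> borel_measurable borel" and \<phi>: "\<And>y. 0 \<le> \<phi> y"
    and T: "T > 0" and l: "l > 0" and ab: "a < b" and x: "x \<noteq> 0"
  shows "(\<integral>\<^sup>+\<omega>. indicator {a..b} (x \<bullet> \<omega>) *
      plane_integral (\<lambda>y. if \<phi> y \<le> T then ennreal (\<phi> y ^ 5) else 0) (x \<bullet> \<omega>) \<omega> \<partial>sphere_measure)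
    \<le> ennreal (l * T) * (\<integral>\<^sup>+y. ennreal (\<phi> y ^ 6) \<partial>lborel) +
      ennreal (4 * pi * T / l\<^sup>2) * ennreal (272 * 28 ^ 3 * ((b - a)\<^sup>2 / (norm x)\<^sup>2))"
proof -
  let ?g = "\<lambda>y. if \<phi> y \<le> T then ennreal (\<phi> y ^ 5) else 0"
  let ?k = "\<lambda>z. kernel_bound a b (dist_line x z) / norm z"
  have k0: "?k z \<ge> 0" for z using kernel_bound_nonneg[OF ab] by simp
  have g[measurable]: "?g \<in> borel_measurable borel" by measurable
  have ym[measurable]: "(\<lambda>z. ennreal (young_majorant (l * T\<^sup>2) T (?k z))) \<in> borel_measurable borel"
    unfolding young_majorant_def by measurable
  have pw: "?g (x + z) * (ennreal (1 / norm z) * (arc_length a b (dist_line x z) + arc_length a b (- dist_line x z)))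
     \<le> ennreal (l * T) * ennreal (\<phi> (x + z) ^ 6) + ennreal (young_majorant (l * T\<^sup>2) T (?k z))" for z
  proof (cases "\<phi> (x + z) \<le> T")
    case True
    have "?g (x + z) * (ennreal (1 / norm z) * (arc_length a b (dist_line x z) + arc_length a b (- dist_line x z)))
      \<le> ennreal (\<phi> (x + z) ^ 5) * (ennreal (1 / norm z) * ennreal (kernel_bound a b (dist_line x z)))"
      using True by (simp add: mult_left_mono arc_length_sum_le[OF ab])
    also have "\<dots> = ennreal (\<phi> (x + z) ^ 5 * ?k z)"
      using \<phi>[of "x + z"] kernel_bound_nonneg[OF ab] by (simp add: ennreal_mult[symmetric])
    also have "\<dots> \<le> ennreal (l * T * \<phi> (x + z) ^ 6 + young_majorant (l * T\<^sup>2) T (?k z))"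
      by (intro ennreal_leI young_split k0 \<phi> True l T)
    also have "\<dots> = ennreal (l * T) * ennreal (\<phi> (x + z) ^ 6) + ennreal (young_majorant (l * T\<^sup>2) T (?k z))"
    proof -
      have "young_majorant (l * T\<^sup>2) T (?k z) \<ge> 0"
        by (rule young_majorant_nonneg[OF k0 T])
      then show ?thesis using l T \<phi>[of "x + z"] by (simp add: ennreal_mult)
    qed
    finally show ?thesis .
  qed simp
  have "(\<integral>\<^sup>+\<omega>. indicator {a..b} (x \<bullet> \<omega>) * plane_integral ?g (x \<bullet> \<omega>) \<omega> \<partial>sphere_measure)
    = (\<integral>\<^sup>+z. ?g (x + z) * (ennreal (1 / norm z) * (arc_length a b (dist_line x z) + arc_length a b (- dist_line x z))) \<partial>lborel)"
    by (rule dual_kernel) measurable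
  also have "\<dots> \<le> (\<integral>\<^sup>+z. ennreal (l * T) * ennreal (\<phi> (x + z) ^ 6) + ennreal (young_majorant (l * T\<^sup>2) T (?k z)) \<partial>lborel)"
    by (rule nn_integral_mono) (rule pw)
  also have "\<dots> = (\<integral>\<^sup>+z. ennreal (l * T) * ennreal (\<phi> (x + z) ^ 6) \<partial>lborel) + (\<integral>\<^sup>+z. ennreal (young_majorant (l * T\<^sup>2) T (?k z)) \<partial>lborel)"
    by (rule nn_integral_add) measurable
  also have "(\<integral>\<^sup>+z. ennreal (l * T) * ennreal (\<phi> (x + z) ^ 6) \<partial>lborel) = ennreal (l * T) * (\<integral>\<^sup>+z. ennreal (\<phi> (x + z) ^ 6) \<partial>lborel)"
    by (rule nn_integral_cmult) measurable
  also have "(\<integral>\<^sup>+z. ennreal (\<phi> (x + z) ^ 6) \<partial>lborel) = (\<integral>\<^sup>+y. ennreal (\<phi> y ^ 6) \<partial>lborel)"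
    by (rule nn_integral_translate) measurable
  also have "(\<integral>\<^sup>+z. ennreal (young_majorant (l * T\<^sup>2) T (?k z)) \<partial>lborel) = ennreal (4 * pi * T / l\<^sup>2) *
     (\<integral>\<^sup>+y. ennreal (1 / sqrt (1 + y\<^sup>2) ^ 3 * kernel_bound a b (norm x / sqrt (1 + y\<^sup>2)) ^ 3) \<partial>lborel)"
    by (rule young_integral) (auto intro: T l kernel_bound_nonneg[OF ab])
  also have "\<dots> \<le> ennreal (4 * pi * T / l\<^sup>2) * ennreal (272 * 28 ^ 3 * ((b - a)\<^sup>2 / (norm x)\<^sup>2))"
    using x by (intro mult_left_mono angular_integral ab) auto
  finally show ?thesis by (simp add: add_left_mono)
qed

text \<open>
  The square is a double integral over pairs of points of the plane. By symmetry, the pairs with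
  \<open>\<phi> y \<le> \<phi> x\<close> carry at least half of it.
\<close>

lemma plane_integral_square_le:
  fixes f :: "real ^ 3 \<Rightarrow> ennreal" and \<phi> :: "real ^ 3 \<Rightarrow> real"
  assumes [measurable]: "f \<in> borel_measurable borel" "\<phi> \<in> borel_measurable borel"
  shows "(plane_integral f s n)\<^sup>2 \<le>
    2 * plane_integral (\<lambda>x. f x * plane_integral (\<lambda>y. if \<phi> y \<le> \<phi> x then f y else 0) s n) s n"
proof -
  let ?c = "ennreal (1 / \<bar>n $ 3\<bar>)"
  define v where "v = (\<lambda>p :: real \<times> real. vector [fst p, snd p, (s - n $ 1 * fst p - n $ 2 * snd p) / n $ 3] :: real ^ 3)"
  have v: "v \<in> borel_measurable borel" unfolding v_def by measurable
  have [measurable]: "(\<lambda>x. v (p x)) \<in> borel_measurable M" if "p \<in> borel_measurable M" for p and M :: "'a measure"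
    using measurable_compose[OF that v] .
  define F where "F = (\<lambda>p. f (v p))"
  define H where "H = (\<lambda>p q. if \<phi> (v q) \<le> \<phi> (v p) then F q else 0)"
  have [measurable]: "(\<lambda>x. F (p x)) \<in> borel_measurable M" if [measurable]: "p \<in> borel_measurable M" for p and M :: "'a measure"
    unfolding F_def by measurable
  have [measurable]: "(\<lambda>x. H (p x) (q x)) \<in> borel_measurable M"
    if [measurable]: "p \<in> borel_measurable M" "q \<in> borel_measurable M" for p q and M :: "'a measure"
    unfolding H_def by measurable
  have "(\<integral>\<^sup>+p. F p \<partial>lborel) * (\<integral>\<^sup>+q. F q \<partial>lborel) = (\<integral>\<^sup>+p. \<integral>\<^sup>+q. F p * F q \<partial>lborel \<partial>lborel)"
    by (simp add: nn_integral_cmult nn_integral_multc)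
  also have "\<dots> \<le> (\<integral>\<^sup>+p. \<integral>\<^sup>+q. F p * H p q + F q * H q p \<partial>lborel \<partial>lborel)"
    unfolding H_def by (intro nn_integral_mono) (auto simp: mult.commute)
  also have "\<dots> = (\<integral>\<^sup>+p. \<integral>\<^sup>+q. F p * H p q \<partial>lborel \<partial>lborel) + (\<integral>\<^sup>+p. \<integral>\<^sup>+q. F q * H q p \<partial>lborel \<partial>lborel)"
    by (simp add: nn_integral_add)
  also have "(\<integral>\<^sup>+p. \<integral>\<^sup>+q. F q * H q p \<partial>lborel \<partial>lborel) = (\<integral>\<^sup>+p. \<integral>\<^sup>+q. F p * H p q \<partial>lborel \<partial>lborel)"
    by (rule lborel_Fubini) measurable
  also have "(\<integral>\<^sup>+p. \<integral>\<^sup>+q. F p * H p q \<partial>lborel \<partial>lborel) = (\<integral>\<^sup>+p. F p * (\<integral>\<^sup>+q. H p q \<partial>lborel) \<partial>lborel)"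
    by (simp add: nn_integral_cmult)
  finally have le: "(\<integral>\<^sup>+p. F p \<partial>lborel) * (\<integral>\<^sup>+q. F q \<partial>lborel) \<le> 2 * (\<integral>\<^sup>+p. F p * (\<integral>\<^sup>+q. H p q \<partial>lborel) \<partial>lborel)"
    by (simp add: mult_2)
  have "(plane_integral f s n)\<^sup>2 = (?c * ?c) * ((\<integral>\<^sup>+p. F p \<partial>lborel) * (\<integral>\<^sup>+q. F q \<partial>lborel))"
    unfolding plane_integral_def F_def v_def power2_eq_square by (simp only: mult_ac)
  also have "\<dots> \<le> (?c * ?c) * (2 * (\<integral>\<^sup>+p. F p * (\<integral>\<^sup>+q. H p q \<partial>lborel) \<partial>lborel))"
    by (intro mult_left_mono le) auto
  also have "\<dots> = 2 * (?c * (\<integral>\<^sup>+p. ?c * (F p * (\<integral>\<^sup>+q. H p q \<partial>lborel)) \<partial>lborel))"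
    by (subst nn_integral_cmult, measurable) (simp only: mult_ac)
  also have "\<dots> = 2 * plane_integral (\<lambda>x. f x * plane_integral (\<lambda>y. if \<phi> y \<le> \<phi> x then f y else 0) s n) s n"
    unfolding plane_integral_def F_def H_def v_def by (simp only: mult_ac)
  finally show ?thesis .
qed

section \<open>Duality and the final estimate\<close>

lemma measurable_snd_sphere: "snd \<in> borel_measurable (M \<Otimes>\<^sub>M sphere_measure)"
  by (rule measurable_compose[OF measurable_snd measurable_ident_sphere])

lemma measurable_incidence [measurable]:
  "(\<lambda>p. (fst p \<bullet> snd p, snd p)) \<in> measurable (borel \<Otimes>\<^sub>M sphere_measure) (lborel \<Otimes>\<^sub>M sphere_measure)"
proof (rule measurable_Pair)
  show "(\<lambda>p. fst p \<bullet> snd p) \<in> measurable (borel \<Otimes>\<^sub>M sphere_measure) lborel"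
    unfolding measurable_lborel1 vec3_inner by measurable
qed measurable

lemma ennreal_AM_GM:
  fixes u v :: ennreal
  assumes m: "m > 0"
  shows "2 * (u * v) \<le> ennreal (1 / m) * u\<^sup>2 + ennreal m * v\<^sup>2"
proof (cases u; cases v)
  fix x y :: real assume xy: "0 \<le> x" "u = ennreal x" "0 \<le> y" "v = ennreal y"
  have "0 \<le> (x - m * y)\<^sup>2 / m" using m by simp
  also have "\<dots> = 1 / m * x\<^sup>2 + m * y\<^sup>2 - 2 * (x * y)"
    using m by (simp add: power2_eq_square field_simps)
  finally have le: "ennreal (2 * (x * y)) \<le> ennreal (1 / m * x\<^sup>2 + m * y\<^sup>2)"
    by (intro ennreal_leI) simp
  have left: "ennreal (2 * (x * y)) = 2 * (u * v)"
    using xy by (simp add: ennreal_mult)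
  have "ennreal (k * X + m * Y) = ennreal k * ennreal X + ennreal m * ennreal Y"
    if "0 \<le> k" "0 \<le> X" "0 \<le> Y" for k X Y
    using that m by (simp add: ennreal_mult)
  then have right: "ennreal (1 / m * x\<^sup>2 + m * y\<^sup>2) = ennreal (1 / m) * u\<^sup>2 + ennreal m * v\<^sup>2"
    unfolding xy(2) xy(4) ennreal_power[OF xy(1)] ennreal_power[OF xy(3)] by this (use m in auto)
  show ?thesis using le unfolding left right .
qed (use m in \<open>auto simp: power2_eq_square ennreal_mult_top ennreal_top_mult ennreal_mult_eq_top_iff\<close>)

text \<open>
  The choice \<open>m = A / e\<close> and \<open>l = 1 / (4 * A)\<close> turns the terms on the right into \<open>e\<close>, \<open>e / 2\<close> and
  \<open>32 * c * A ^ 3\<close>. Any \<open>B \<ge> A\<close> may take the place of \<open>A\<close>, and small positive \<open>B\<close> settle the case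
  \<open>A = 0\<close>.
\<close>

lemma optimize_parameters:
  fixes e A c :: real
  assumes e: "e \<ge> 0" and A: "A \<ge> 0" and c: "c \<ge> 0"
    and le: "\<And>m l. m > 0 \<Longrightarrow> l > 0 \<Longrightarrow> 2 * e \<le> A / m + m * (2 * e * (l * e + c / l\<^sup>2))"
  shows "e \<le> 64 * c * A ^ 3"
proof -
  have *: "e \<le> 64 * c * B ^ 3" if B: "B > 0" "A \<le> B" for B
  proof (cases "e = 0")
    case False
    then have e0: "e > 0" using e by simp
    have "2 * e \<le> A / (B / e) + B / e * (2 * e * (1 / (4 * B) * e + c / (1 / (4 * B))\<^sup>2))"
      using B e0 by (intro le) auto
    also have "A / (B / e) \<le> e" using B e0 by (simp add: field_simps)
    also have "B / e * (2 * e * (1 / (4 * B) * e + c / (1 / (4 * B))\<^sup>2)) = e / 2 + 32 * c * B ^ 3"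
      using B e0 by (simp add: power2_eq_square power3_eq_cube field_simps)
    finally show ?thesis by simp
  qed (use B c in simp)
  show ?thesis
  proof (cases "A > 0")
    case False
    then have A0: "A = 0" using A by simp
    show ?thesis
    proof (rule ccontr)
      assume "\<not> ?thesis"
      then have e0: "e > 0" using A0 by simp
      define B where "B = min 1 (e / (64 * c + 1) / 2)"
      have B: "B > 0" "B \<le> 1" "B \<le> e / (64 * c + 1) / 2" unfolding B_def using e0 c by auto
      have "B ^ 3 \<le> B" using B power_decreasing[of 1 3 B] by simp
      then have "64 * c * B ^ 3 \<le> (64 * c + 1) * B" using c B by (intro mult_mono) auto
      also have "\<dots> \<le> (64 * c + 1) * (e / (64 * c + 1) / 2)" using B c by (intro mult_left_mono) auto
      also have "\<dots> = e / 2" using c by (simp add: field_simps)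
      finally show False using *[of B] B e0 A0 by simp
    qed
  qed (use * in auto)
qed

text \<open>
  Here \<open>\<phi>\<close> stands for a truncation of \<open>\<integral>\<^sup>+\<omega>. g (x \<bullet> \<omega>, \<omega>)\<close>. Its sixth moment \<open>e\<close> is finite, so that
  an estimate of \<open>e\<close> by a multiple of itself plus a controlled term is of use.
\<close>

lemma truncated_sixth_moment_bound:
  fixes \<phi> :: "real ^ 3 \<Rightarrow> real" and g :: "real \<times> (real ^ 3) \<Rightarrow> ennreal"
  assumes g[measurable]: "g \<in> borel_measurable cylinder_measure"
    and supp: "AE p in cylinder_measure. fst p \<notin> {a..b} \<longrightarrow> g p = 0"
    and A: "(\<integral>\<^sup>+p. (g p)\<^sup>2 \<partial>cylinder_measure) = ennreal A" "A \<ge> 0"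
    and \<phi>m[measurable]: "\<phi> \<in> borel_measurable borel" and \<phi>0: "\<And>x. 0 \<le> \<phi> x"
    and \<phi>R: "\<And>x. \<phi> x \<noteq> 0 \<Longrightarrow> norm x > R" and R: "R > 0" and ab: "a < b"
    and \<phi>F: "\<And>x. ennreal (\<phi> x) \<le> (\<integral>\<^sup>+\<omega>. g (x \<bullet> \<omega>, \<omega>) \<partial>sphere_measure)"
    and fin: "(\<integral>\<^sup>+x. ennreal (\<phi> x ^ 6) \<partial>lborel) < \<infinity>"
  shows "(\<integral>\<^sup>+x. ennreal (\<phi> x ^ 6) \<partial>lborel) \<le> ennreal (64 * (4 * pi * (272 * 28 ^ 3 * ((b - a)\<^sup>2 / R\<^sup>2))) * A ^ 3)"
proof -
  interpret LS: pair_sigma_finite "lborel :: (real ^ 3) measure" sphere_measure ..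
  interpret CS: pair_sigma_finite "lborel :: real measure" sphere_measure ..
  note measurable_snd_sphere[measurable]
  define W where "W = 4 * pi * (272 * 28 ^ 3 * ((b - a)\<^sup>2 / R\<^sup>2))"
  have W0: "W \<ge> 0" unfolding W_def by simp
  define f where "f = (\<lambda>x. ennreal (\<phi> x ^ 5))"
  have fm: "f \<in> borel_measurable borel" unfolding f_def by measurable
  have [measurable]: "(\<lambda>x. f (h x)) \<in> borel_measurable M" if "h \<in> borel_measurable M" for h and M :: "'a measure"
    using measurable_compose[OF that fm] .
  define P where "P = (\<lambda>s \<omega>. plane_integral f s \<omega>)"
  define D where "D = (\<lambda>x s \<omega>. plane_integral (\<lambda>y. if \<phi> y \<le> \<phi> x then f y else 0) s \<omega>)"
  have Pm: "(\<lambda>p. P (fst p) (snd p)) \<in> borel_measurable cylinder_measure"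
    unfolding P_def by measurable
  obtain e where e: "(\<integral>\<^sup>+x. ennreal (\<phi> x ^ 6) \<partial>lborel) = ennreal e" "e \<ge> 0"
    using fin by (cases "\<integral>\<^sup>+x. ennreal (\<phi> x ^ 6) \<partial>lborel") auto
  define Q where "Q = (\<integral>\<^sup>+\<omega>. \<integral>\<^sup>+s. indicator {a..b} s * (P s \<omega>)\<^sup>2 \<partial>lborel \<partial>sphere_measure)"
  have gm: "(\<lambda>p. g (fst p \<bullet> snd p, snd p)) \<in> borel_measurable (borel \<Otimes>\<^sub>M sphere_measure)"
    by (rule measurable_compose[OF measurable_incidence g])

  \<comment> \<open>testing against \<open>\<phi> ^ 5\<close> and passing to the adjoint, which integrates over planes\<close>
  have E1: "ennreal e \<le> (\<integral>\<^sup>+p. g p * (indicator {a..b} (fst p) * P (fst p) (snd p)) \<partial>cylinder_measure)"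
  proof -
    have "ennreal e = (\<integral>\<^sup>+x. f x * ennreal (\<phi> x) \<partial>lborel)"
      unfolding e(1)[symmetric] f_def using \<phi>0 by (intro nn_integral_cong) (simp add: ennreal_mult[symmetric] eval_nat_numeral mult_ac)
    also have "\<dots> \<le> (\<integral>\<^sup>+x. f x * (\<integral>\<^sup>+\<omega>. g (x \<bullet> \<omega>, \<omega>) \<partial>sphere_measure) \<partial>lborel)"
      by (intro nn_integral_mono mult_left_mono \<phi>F) simp
    also have "\<dots> = (\<integral>\<^sup>+x. \<integral>\<^sup>+\<omega>. f x * g (x \<bullet> \<omega>, \<omega>) \<partial>sphere_measure \<partial>lborel)"
    proof (intro nn_integral_cong nn_integral_cmult[symmetric])
      fix x :: "real ^ 3"
      show "(\<lambda>\<omega>. g (x \<bullet> \<omega>, \<omega>)) \<in> borel_measurable sphere_measure"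
        using measurable_Pair2[OF gm, of x] by simp
    qed
    also have "\<dots> = (\<integral>\<^sup>+\<omega>. \<integral>\<^sup>+x. f x * g (x \<bullet> \<omega>, \<omega>) \<partial>lborel \<partial>sphere_measure)"
    proof (rule LS.Fubini'[symmetric])
      show "(\<lambda>(x, \<omega>). f x * g (x \<bullet> \<omega>, \<omega>)) \<in> borel_measurable (lborel \<Otimes>\<^sub>M sphere_measure)"
        using gm by (simp add: case_prod_beta)
    qed
    also have "\<dots> = (\<integral>\<^sup>+\<omega>. \<integral>\<^sup>+s. g (s, \<omega>) * P s \<omega> \<partial>lborel \<partial>sphere_measure)"
    proof (rule nn_integral_cong_AE)
      show "AE \<omega> in sphere_measure. (\<integral>\<^sup>+x. f x * g (x \<bullet> \<omega>, \<omega>) \<partial>lborel) = (\<integral>\<^sup>+s. g (s, \<omega>) * P s \<omega> \<partial>lborel)"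
        using AE_sphere_third_nonzero AE_space
      proof eventually_elim
        fix \<omega> :: "real ^ 3" assume w: "\<omega> $ 3 \<noteq> 0" "\<omega> \<in> space sphere_measure"
        have gw[measurable]: "(\<lambda>s. g (s, \<omega>)) \<in> borel_measurable borel"
          using measurable_Pair1[OF g w(2)] by simp
        have "(\<integral>\<^sup>+x. f x * g (x \<bullet> \<omega>, \<omega>) \<partial>lborel) = (\<integral>\<^sup>+x. g (x \<bullet> \<omega>, \<omega>) * f x \<partial>lborel)"
          by (simp only: mult.commute)
        also have "\<dots> = (\<integral>\<^sup>+s. plane_integral (\<lambda>x. g (s, \<omega>) * f x) s \<omega> \<partial>lborel)"
          by (rule plane_disintegration[OF w(1)]) measurable
        also have "\<dots> = (\<integral>\<^sup>+s. g (s, \<omega>) * P s \<omega> \<partial>lborel)"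
          unfolding P_def by (intro nn_integral_cong plane_integral_cmult fm)
        finally show "(\<integral>\<^sup>+x. f x * g (x \<bullet> \<omega>, \<omega>) \<partial>lborel) = (\<integral>\<^sup>+s. g (s, \<omega>) * P s \<omega> \<partial>lborel)" .
      qed
    qed
    also have "\<dots> = (\<integral>\<^sup>+p. g p * P (fst p) (snd p) \<partial>cylinder_measure)"
      using CS.nn_integral_snd[of "\<lambda>p. g p * P (fst p) (snd p)"] Pm by simp
    also have "\<dots> = (\<integral>\<^sup>+p. g p * (indicator {a..b} (fst p) * P (fst p) (snd p)) \<partial>cylinder_measure)"
      using supp by (intro nn_integral_cong_AE, elim eventually_mono) (auto split: split_indicator)
    finally show ?thesis .
  qed

  \<comment> \<open>the weighted inequality of the means separates \<open>g\<close> from the plane integrals\<close>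
  have E2: "2 * ennreal e \<le> ennreal (1 / m) * ennreal A + ennreal m * Q" if m: "m > 0" for m
  proof -
    define v where "v = (\<lambda>p. indicator {a..b} (fst p) * P (fst p) (snd p))"
    have vm[measurable]: "v \<in> borel_measurable cylinder_measure" unfolding v_def using Pm by measurable
    have "2 * ennreal e \<le> 2 * (\<integral>\<^sup>+p. g p * v p \<partial>cylinder_measure)"
      unfolding v_def by (intro mult_left_mono E1) simp
    also have "\<dots> = (\<integral>\<^sup>+p. 2 * (g p * v p) \<partial>cylinder_measure)"
      by (rule nn_integral_cmult[symmetric]) measurable
    also have "\<dots> \<le> (\<integral>\<^sup>+p. ennreal (1 / m) * (g p)\<^sup>2 + ennreal m * (v p)\<^sup>2 \<partial>cylinder_measure)"
      by (intro nn_integral_mono ennreal_AM_GM m)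
    also have "\<dots> = ennreal (1 / m) * (\<integral>\<^sup>+p. (g p)\<^sup>2 \<partial>cylinder_measure) + ennreal m * (\<integral>\<^sup>+p. (v p)\<^sup>2 \<partial>cylinder_measure)"
      using vm by (simp add: nn_integral_add nn_integral_cmult)
    also have "(\<integral>\<^sup>+p. (v p)\<^sup>2 \<partial>cylinder_measure) = (\<integral>\<^sup>+\<omega>. \<integral>\<^sup>+s. (v (s, \<omega>))\<^sup>2 \<partial>lborel \<partial>sphere_measure)"
      by (rule CS.nn_integral_snd[symmetric]) measurable
    also have "\<dots> = Q"
      unfolding Q_def v_def by (intro nn_integral_cong) (auto split: split_indicator)
    finally show ?thesis using A by simp
  qed

  \<comment> \<open>the square of the adjoint as a double integral over ordered pairs of points in a common plane\<close>
  have E3: "Q \<le> 2 * (\<integral>\<^sup>+x. f x * (\<integral>\<^sup>+\<omega>. indicator {a..b} (x \<bullet> \<omega>) * D x (x \<bullet> \<omega>) \<omega> \<partial>sphere_measure) \<partial>lborel)"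
  proof -
    have Dm: "(\<lambda>p. D (fst p) (fst p \<bullet> snd p) (snd p)) \<in> borel_measurable (borel \<Otimes>\<^sub>M sphere_measure)"
      unfolding D_def vec3_inner by measurable
    have im: "(\<lambda>p. indicator {a..b} (fst p \<bullet> snd p) :: ennreal) \<in> borel_measurable (borel \<Otimes>\<^sub>M sphere_measure)"
      unfolding vec3_inner by measurable
    have "Q \<le> (\<integral>\<^sup>+\<omega>. 2 * (\<integral>\<^sup>+x. f x * (indicator {a..b} (x \<bullet> \<omega>) * D x (x \<bullet> \<omega>) \<omega>) \<partial>lborel) \<partial>sphere_measure)"
      unfolding Q_def
    proof (rule nn_integral_mono_AE)
      show "AE \<omega> in sphere_measure. (\<integral>\<^sup>+s. indicator {a..b} s * (P s \<omega>)\<^sup>2 \<partial>lborel) \<le>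
        2 * (\<integral>\<^sup>+x. f x * (indicator {a..b} (x \<bullet> \<omega>) * D x (x \<bullet> \<omega>) \<omega>) \<partial>lborel)"
        using AE_sphere_third_nonzero
      proof eventually_elim
        fix \<omega> :: "real ^ 3" assume w: "\<omega> $ 3 \<noteq> 0"
        have Dm': "(\<lambda>(s, x). D x s \<omega>) \<in> borel_measurable (borel \<Otimes>\<^sub>M borel)"
          unfolding D_def by measurable
        have Dm'': "(\<lambda>x. D x s \<omega>) \<in> borel_measurable borel" for s
          unfolding D_def by measurable
        have Dms: "(\<lambda>s. plane_integral (\<lambda>x. indicator {a..b} s * (f x * D x s \<omega>)) s \<omega>) \<in> borel_measurable borel"
          unfolding D_def by measurable
        have "(\<integral>\<^sup>+s. indicator {a..b} s * (P s \<omega>)\<^sup>2 \<partial>lborel) \<le>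
          (\<integral>\<^sup>+s. 2 * plane_integral (\<lambda>x. indicator {a..b} s * (f x * D x s \<omega>)) s \<omega> \<partial>lborel)"
        proof (rule nn_integral_mono)
          fix s
          have "indicator {a..b} s * (P s \<omega>)\<^sup>2 \<le> indicator {a..b} s * (2 * plane_integral (\<lambda>x. f x * D x s \<omega>) s \<omega>)"
            unfolding P_def D_def by (intro mult_left_mono plane_integral_square_le fm \<phi>m) simp
          also have "\<dots> = 2 * (indicator {a..b} s * plane_integral (\<lambda>x. f x * D x s \<omega>) s \<omega>)"
            by (simp only: mult_ac)
          also have "indicator {a..b} s * plane_integral (\<lambda>x. f x * D x s \<omega>) s \<omega> = plane_integral (\<lambda>x. indicator {a..b} s * (f x * D x s \<omega>)) s \<omega>"
            by (intro plane_integral_cmult[symmetric] borel_measurable_times_ennreal fm Dm'')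
          finally show "indicator {a..b} s * (P s \<omega>)\<^sup>2 \<le> 2 * plane_integral (\<lambda>x. indicator {a..b} s * (f x * D x s \<omega>)) s \<omega>" .
        qed
        also have "\<dots> = 2 * (\<integral>\<^sup>+s. plane_integral (\<lambda>x. indicator {a..b} s * (f x * D x s \<omega>)) s \<omega> \<partial>lborel)"
          using Dms by (intro nn_integral_cmult) simp
        also have "(\<integral>\<^sup>+s. plane_integral (\<lambda>x. indicator {a..b} s * (f x * D x s \<omega>)) s \<omega> \<partial>lborel) =
          (\<integral>\<^sup>+x. indicator {a..b} (x \<bullet> \<omega>) * (f x * D x (x \<bullet> \<omega>) \<omega>) \<partial>lborel)"
          by (rule plane_disintegration[OF w, symmetric]) (unfold D_def, measurable)
        also have "\<dots> = (\<integral>\<^sup>+x. f x * (indicator {a..b} (x \<bullet> \<omega>) * D x (x \<bullet> \<omega>) \<omega>) \<partial>lborel)"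
          by (simp only: mult.left_commute)
        finally show "(\<integral>\<^sup>+s. indicator {a..b} s * (P s \<omega>)\<^sup>2 \<partial>lborel) \<le>
          2 * (\<integral>\<^sup>+x. f x * (indicator {a..b} (x \<bullet> \<omega>) * D x (x \<bullet> \<omega>) \<omega>) \<partial>lborel)" .
      qed
    qed
    also have "\<dots> = 2 * (\<integral>\<^sup>+\<omega>. (\<integral>\<^sup>+x. f x * (indicator {a..b} (x \<bullet> \<omega>) * D x (x \<bullet> \<omega>) \<omega>) \<partial>lborel) \<partial>sphere_measure)"
    proof (rule nn_integral_cmult)
      have "(\<lambda>(\<omega>, x). f x * (indicator {a..b} (x \<bullet> \<omega>) * D x (x \<bullet> \<omega>) \<omega>)) \<in> borel_measurable (sphere_measure \<Otimes>\<^sub>M lborel)"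
      proof -
        have sw: "(\<lambda>p. (snd p, fst p)) \<in> measurable (sphere_measure \<Otimes>\<^sub>M lborel) (borel \<Otimes>\<^sub>M sphere_measure)"
          by measurable
        show ?thesis
          using measurable_compose[OF sw borel_measurable_times_ennreal[OF im Dm]]
          by (simp add: case_prod_beta)
      qed
      then show "(\<lambda>\<omega>. \<integral>\<^sup>+x. f x * (indicator {a..b} (x \<bullet> \<omega>) * D x (x \<bullet> \<omega>) \<omega>) \<partial>lborel) \<in> borel_measurable sphere_measure"
        by (rule lborel.borel_measurable_nn_integral)
    qed
    also have "(\<integral>\<^sup>+\<omega>. (\<integral>\<^sup>+x. f x * (indicator {a..b} (x \<bullet> \<omega>) * D x (x \<bullet> \<omega>) \<omega>) \<partial>lborel) \<partial>sphere_measure) =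
      (\<integral>\<^sup>+x. (\<integral>\<^sup>+\<omega>. f x * (indicator {a..b} (x \<bullet> \<omega>) * D x (x \<bullet> \<omega>) \<omega>) \<partial>sphere_measure) \<partial>lborel)"
    proof (rule LS.Fubini')
      show "(\<lambda>(x, \<omega>). f x * (indicator {a..b} (x \<bullet> \<omega>) * D x (x \<bullet> \<omega>) \<omega>)) \<in> borel_measurable (lborel \<Otimes>\<^sub>M sphere_measure)"
        using im Dm by (simp add: case_prod_beta)
    qed
    also have "\<dots> = (\<integral>\<^sup>+x. f x * (\<integral>\<^sup>+\<omega>. indicator {a..b} (x \<bullet> \<omega>) * D x (x \<bullet> \<omega>) \<omega> \<partial>sphere_measure) \<partial>lborel)"
      unfolding D_def by (intro nn_integral_cong nn_integral_cmult) measurable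
    finally show ?thesis .
  qed

  \<comment> \<open>the inner integral is the truncated dual operator with \<open>T = \<phi> x\<close>; only \<open>norm x > R\<close> matters\<close>
  have E4: "Q \<le> ennreal (2 * e * (l * e + W / l\<^sup>2))" if l: "l > 0" for l
  proof -
    have pw: "f x * (\<integral>\<^sup>+\<omega>. indicator {a..b} (x \<bullet> \<omega>) * D x (x \<bullet> \<omega>) \<omega> \<partial>sphere_measure) \<le>
      ennreal (l * e + W / l\<^sup>2) * ennreal (\<phi> x ^ 6)" for x
    proof (cases "\<phi> x = 0")
      case False
      then have T: "\<phi> x > 0" using \<phi>0[of x] by simp
      have nx: "norm x > R" using \<phi>R False by simp
      have x0: "x \<noteq> 0" using nx R by auto
      have "(\<integral>\<^sup>+\<omega>. indicator {a..b} (x \<bullet> \<omega>) * D x (x \<bullet> \<omega>) \<omega> \<partial>sphere_measure) \<le>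
         ennreal (l * \<phi> x) * ennreal e + ennreal (4 * pi * \<phi> x / l\<^sup>2) * ennreal (272 * 28 ^ 3 * ((b - a)\<^sup>2 / (norm x)\<^sup>2))"
        unfolding D_def f_def e(1)[symmetric] by (rule dual_operator_bound[OF \<phi>m \<phi>0 T l ab x0])
      also have "\<dots> \<le> ennreal (l * \<phi> x) * ennreal e + ennreal (4 * pi * \<phi> x / l\<^sup>2) * ennreal (272 * 28 ^ 3 * ((b - a)\<^sup>2 / R\<^sup>2))"
        using nx R x0 by (intro add_left_mono mult_left_mono ennreal_leI divide_left_mono power_mono mult_pos_pos zero_less_power) auto
      also have "\<dots> = ennreal (\<phi> x * (l * e + W / l\<^sup>2))"
      proof -
        have "\<phi> x * (l * e + W / l\<^sup>2) = (l * \<phi> x) * e + (4 * pi * \<phi> x / l\<^sup>2) * (272 * 28 ^ 3 * ((b - a)\<^sup>2 / R\<^sup>2))"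
          unfolding W_def by (simp add: algebra_simps)
        then show ?thesis
          using T l e(2) by (simp only: ennreal_plus ennreal_mult mult_nonneg_nonneg divide_nonneg_nonneg less_imp_le zero_le_power2 zero_le_numeral pi_ge_zero zero_le_power)
      qed
      finally have "f x * (\<integral>\<^sup>+\<omega>. indicator {a..b} (x \<bullet> \<omega>) * D x (x \<bullet> \<omega>) \<omega> \<partial>sphere_measure) \<le>
        ennreal (\<phi> x ^ 5) * ennreal (\<phi> x * (l * e + W / l\<^sup>2))"
        unfolding f_def by (intro mult_left_mono) auto
      also have "\<dots> = ennreal (\<phi> x ^ 5 * (\<phi> x * (l * e + W / l\<^sup>2)))"
        using T l e(2) W0 by (intro ennreal_mult[symmetric]) auto
      also have "\<phi> x ^ 5 * (\<phi> x * (l * e + W / l\<^sup>2)) = (l * e + W / l\<^sup>2) * \<phi> x ^ 6"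
        by (simp add: eval_nat_numeral)
      also have "ennreal \<dots> = ennreal (l * e + W / l\<^sup>2) * ennreal (\<phi> x ^ 6)"
        using T l e(2) W0 by (intro ennreal_mult) auto
      finally show ?thesis .
    qed (simp add: f_def)
    have "Q \<le> 2 * (\<integral>\<^sup>+x. ennreal (l * e + W / l\<^sup>2) * ennreal (\<phi> x ^ 6) \<partial>lborel)"
      by (rule order_trans[OF E3]) (intro mult_left_mono nn_integral_mono pw, simp)
    also have "(\<integral>\<^sup>+x. ennreal (l * e + W / l\<^sup>2) * ennreal (\<phi> x ^ 6) \<partial>lborel) = ennreal (l * e + W / l\<^sup>2) * ennreal e"
      unfolding e(1)[symmetric] by (rule nn_integral_cmult) measurable
    also have "2 * (ennreal (l * e + W / l\<^sup>2) * ennreal e) = ennreal (2 * e * (l * e + W / l\<^sup>2))"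
    proof -
      have "2 * (ennreal u * ennreal e) = ennreal (2 * e * u)" if "u \<ge> 0" for u
        using that e(2) by (simp add: ennreal_mult mult_ac)
      then show ?thesis by this (use l e(2) W0 in auto)
    qed
    finally show ?thesis .
  qed

  have "e \<le> 64 * W * A ^ 3"
  proof (rule optimize_parameters[OF e(2) A(2) W0])
    fix m l :: real assume m: "m > 0" and l: "l > 0"
    have B0: "0 \<le> 2 * e * (l * e + W / l\<^sup>2)" using l e(2) W0 by simp
    have "ennreal (2 * e) \<le> ennreal (1 / m) * ennreal A + ennreal m * ennreal (2 * e * (l * e + W / l\<^sup>2))"
      using order_trans[OF E2[OF m] add_left_mono[OF mult_left_mono[OF E4[OF l]]]] e(2) by (simp add: ennreal_mult)
    also have "\<dots> = ennreal (1 / m * A + m * (2 * e * (l * e + W / l\<^sup>2)))"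
      using m A(2) B0 by (simp only: ennreal_plus ennreal_mult mult_nonneg_nonneg divide_nonneg_nonneg less_imp_le zero_le_one)
    finally show "2 * e \<le> A / m + m * (2 * e * (l * e + W / l\<^sup>2))"
      using m A(2) B0 by (subst (asm) ennreal_le_iff) auto
  qed
  then show ?thesis unfolding e(1) W_def by (rule ennreal_leI)
qed

theorem corollary1p4:
  "\<exists>C :: real. C > 0 \<and>
     (\<forall>(a :: real) (b :: real) (R :: real) (G :: real \<times> (real ^ 3) \<Rightarrow> complex).
        a < b \<longrightarrow> R > 0 \<longrightarrow> in_L2 G \<longrightarrow> supported_in a b G \<longrightarrow>
        (\<integral>\<^sup>+ x \<in> {x. norm x > R}. ennreal (cmod (T_op G x) ^ 6) \<partial>lborel)
          \<le> ennreal (C * ((b - a)\<^sup>2 / R\<^sup>2) * L2_norm_cyl G ^ 6))"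
proof (intro exI[of _ "64 * (4 * pi * (272 * 28 ^ 3))"] conjI allI impI)
  fix a b R :: real and G :: "real \<times> (real ^ 3) \<Rightarrow> complex"
  assume ab: "a < b" and R: "R > 0" and L2: "in_L2 G" and supp: "supported_in a b G"
  let ?C = "64 * (4 * pi * (272 * 28 ^ 3)) :: real"
  have G[measurable]: "G \<in> borel_measurable cylinder_measure" and Gi: "integrable cylinder_measure (\<lambda>p. (cmod (G p))\<^sup>2)"
    using L2 unfolding in_L2_def by auto
  define A where "A = (\<integral>p. (cmod (G p))\<^sup>2 \<partial>cylinder_measure)"
  have A0: "A \<ge> 0" unfolding A_def by simp
  have A: "(\<integral>\<^sup>+p. (ennreal (cmod (G p)))\<^sup>2 \<partial>cylinder_measure) = ennreal A"
    unfolding A_def using nn_integral_eq_integral[OF Gi] by (simp add: ennreal_power)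
  have norm6: "L2_norm_cyl G ^ 6 = A ^ 3"
  proof -
    have "L2_norm_cyl G ^ 6 = (sqrt A ^ 2) ^ 3" unfolding L2_norm_cyl_def A_def by (simp only: power_mult[symmetric]) simp
    then show ?thesis using A0 by simp
  qed
  define B where "B = ennreal (?C * ((b - a)\<^sup>2 / R\<^sup>2) * L2_norm_cyl G ^ 6)"
  have gm: "(\<lambda>p. G (fst p \<bullet> snd p, snd p)) \<in> borel_measurable (borel \<Otimes>\<^sub>M sphere_measure)"
    by (rule measurable_compose[OF measurable_incidence G])
  have Tm[measurable]: "T_op G \<in> borel_measurable borel"
    unfolding T_op_def[abs_def]
    by (rule sphere.borel_measurable_lebesgue_integral) (use gm in \<open>simp add: case_prod_beta\<close>)
  have TF: "ennreal (cmod (T_op G x)) \<le> (\<integral>\<^sup>+\<omega>. ennreal (cmod (G (x \<bullet> \<omega>, \<omega>))) \<partial>sphere_measure)" for x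
  proof (cases "integrable sphere_measure (\<lambda>\<omega>. G (x \<bullet> \<omega>, \<omega>))")
    case True
    then show ?thesis unfolding T_op_def by (rule integral_norm_bound_ennreal)
  qed (simp add: T_op_def not_integrable_integral_eq)
  \<comment> \<open>truncation in height and in space makes the sixth moment finite\<close>
  define \<phi> where "\<phi> = (\<lambda>(n :: nat) x. if R < norm x \<and> norm x < real n then min (cmod (T_op G x)) (real n) else 0)"
  have \<phi>m[measurable]: "\<phi> n \<in> borel_measurable borel" for n unfolding \<phi>_def by measurable
  have bound: "(\<integral>\<^sup>+x. ennreal (\<phi> n x ^ 6) \<partial>lborel) \<le> B" for n
    unfolding B_def norm6 mult.assoc[of 64] mult.assoc[of "4 * pi"]
  proof (rule order_trans[OF truncated_sixth_moment_bound[where g = "\<lambda>p. ennreal (cmod (G p))" and a = a and b = b and R = R and A = A]])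
    show "AE p in cylinder_measure. fst p \<notin> {a..b} \<longrightarrow> ennreal (cmod (G p)) = 0"
      using supp unfolding supported_in_def by (rule eventually_mono) simp
    show "ennreal (\<phi> n x) \<le> (\<integral>\<^sup>+\<omega>. ennreal (cmod (G (x \<bullet> \<omega>, \<omega>))) \<partial>sphere_measure)" for x
      by (rule order_trans[OF ennreal_leI TF]) (simp add: \<phi>_def)
    have "(\<integral>\<^sup>+x. ennreal (\<phi> n x ^ 6) \<partial>lborel) \<le> (\<integral>\<^sup>+x. ennreal (real n ^ 6) * indicator (ball 0 (real n)) (x :: real ^ 3) \<partial>lborel)"
      by (intro nn_integral_mono) (auto simp: \<phi>_def intro!: ennreal_leI power_mono split: split_indicator)
    also have "\<dots> = ennreal (real n ^ 6) * emeasure lborel (ball (0 :: real ^ 3) (real n))"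
      by (rule nn_integral_cmult_indicator) simp
    also have "\<dots> < \<infinity>"
      using emeasure_lborel_ball_finite[of "0 :: real ^ 3" "real n"] by (simp add: ennreal_mult_less_top)
    finally show "(\<integral>\<^sup>+x. ennreal (\<phi> n x ^ 6) \<partial>lborel) < \<infinity>" .
  qed (use A A0 ab R in \<open>auto simp: \<phi>_def split: if_splits\<close>)
  have mono: "\<phi> m x \<le> \<phi> n x" if "m \<le> n" for m n x
    using that by (auto simp: \<phi>_def)
  have \<phi>0: "0 \<le> \<phi> n x" for n x by (simp add: \<phi>_def)
  have "(\<integral>\<^sup>+ x \<in> {x. norm x > R}. ennreal (cmod (T_op G x) ^ 6) \<partial>lborel) \<le> (\<integral>\<^sup>+x. (SUP n. ennreal (\<phi> n x ^ 6)) \<partial>lborel)"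
  proof (rule nn_integral_mono)
    fix x :: "real ^ 3"
    obtain n where n: "max (norm x + 1) (cmod (T_op G x)) \<le> real n" using real_arch_simple by blast
    have "ennreal (cmod (T_op G x) ^ 6) * indicator {x. norm x > R} x \<le> ennreal (\<phi> n x ^ 6)"
      using n by (auto simp: \<phi>_def split: split_indicator)
    then show "ennreal (cmod (T_op G x) ^ 6) * indicator {x. norm x > R} x \<le> (SUP n. ennreal (\<phi> n x ^ 6))"
      by (intro SUP_upper2[of n]) auto
  qed
  also have "\<dots> = (SUP n. \<integral>\<^sup>+x. ennreal (\<phi> n x ^ 6) \<partial>lborel)"
    by (rule nn_integral_monotone_convergence_SUP)
      (auto simp: incseq_def le_fun_def intro!: ennreal_leI power_mono mono \<phi>0)
  also have "\<dots> \<le> B" by (intro SUP_least bound)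
  finally show "(\<integral>\<^sup>+ x \<in> {x. norm x > R}. ennreal (cmod (T_op G x) ^ 6) \<partial>lborel) \<le>
    ennreal (?C * ((b - a)\<^sup>2 / R\<^sup>2) * L2_norm_cyl G ^ 6)"
    unfolding B_def .
qed simp

end
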